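(* Let $\gamma\in(0,\tfrac12]$ and let $k>0$ satisfy $\frac{1}{a k}<1-\gamma$. Let $\bar u\in C^2([0,L])$ be a stationary subsonic state with $\bar u'(0)=\frac{\theta}{2}\,\frac{|\bar u(0)|\,\bar u(0)^2}{a^2-\bar u(0)^2}$ and $\bar u(x)\in(0,\gamma a)$ for all $x\in[0,L]$. Assume that $$2k^2K_\partial(k,\bar u(0))\le a^2-\Big(\bar u(0)+\frac2k\Big)^2,\qquad \|\bar u\|_{C([0,L])}<\varepsilon_1,\qquad \sup_{x\in[0,L]}\frac{\bar u(x)\,(a^2-\bar u(x)^2)}{a^2+3\bar u(x)^2}<\frac{1}{2\,\mathrm e\,k},$$ where $\varepsilon_1=\varepsilon_1(2k^2)$ and $\varepsilon_2$ are the constants described in the context. For $T>0$ call initial data $(\varphi,\psi)$ admissible for $T$ if $(\varphi,\psi)\in C^2([0,L])\times C^1([0,L])$, $\|(\varphi,\psi)\|_{C^2([0,L])\times C^1([0,L])}\le\varepsilon_0(T)$ (with $\varepsilon_0(T)$ as described in the context), the $C^2$-compatibility conditions at $(0,0)$ and $(0,L)$ hold, and the solution $u\in C^2([0,T]\times[0,L])$ of Problem (P) satisfies $T_{Li}(t)<a$ for all $t\in[0,T]$ and $$\kappa:=\max_{t\in[0,T]}\big(P_0(T_{Li}(t))+P_1(T_{Li}(t))\big)(1+L^2)\Big(\frac1{K_1}+\frac1{\tilde K_1}\Big)+2k^2\,C_{E1}(\bar u(0))\,\frac{L}{K_1}\ \le\ \frac{1}{4\,\mathrm e\,L\,k}.$$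 In this case put $\mu:=\frac{1}{2\,\mathrm e\,L\,k}-\kappa\ge\frac{1}{4\,\mathrm e\,L\,k}$. Then there exist constants $\eta_1>0$ and $\eta_2>0$, independent of $T$ (and of the initial data), such that for every $T>0$, all initial data $(\varphi,\psi)$ admissible for $T$ and all $t\in[0,T]$ the solution $u$ of Problem (P) satisfies $$\|(u(t,\cdot),u_t(t,\cdot))\|_{H^2(0,L)\times H^1(0,L)}\le\eta_1\,\|(\varphi,\psi)\|_{H^2(0,L)\times H^1(0,L)}\,\exp\Big(-\frac\mu2t\Big),$$ $$\|(u(t,\cdot),u_t(t,\cdot))\|_{C^1([0,L])\times C^0([0,L])}\le\eta_2\,\|(\varphi,\psi)\|_{H^2(0,L)\times H^1(0,L)}\,\exp\Big(-\frac\mu2t\Big).$$ Moreover, for all sufficiently large $T$ and all initial data admissible for $T$, $$\|(u(T,\cdot),u_t(T,\cdot))\|_{H^2(0,L)\times H^1(0,L)}\le\tfrac12\|(\varphi,\psi)\|_{H^2(0,L)\times H^1(0,L)},$$ $$\|(u(T,\cdot),u_t(T,\cdot))\|_{C^1([0,L])\times C^0([0,L])}\le\tfrac12\|(\varphi,\psi)\|_{H^2(0,L)\times H^1(0,L)}.$$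
   Context: Constants: $a>0$, $\theta>0$, $L>0$; $\mathrm e$ is Euler's number. For real $p,q,r$ let $\tilde F(p,q,r)=-2rq-2pq^2-\frac32\theta\,p|p|\,q-\theta|p|\,r$. A stationary subsonic state is $\bar u\in C^2([0,L])$ with $|\bar u|<a$ and $(a^2-\bar u^2)\bar u''=2\bar u(\bar u')^2+\frac32\theta\,\bar u|\bar u|\,\bar u'$ on $[0,L]$. Put $$F(x,p,q,r)=\tilde F(p+\bar u(x),q+\bar u'(x),r)+\frac{a^2-(\bar u(x)+p)^2}{a^2-\bar u(x)^2}\,\bar u(x)\Big(2\bar u'(x)^2+\frac32\theta|\bar u(x)|\bar u'(x)\Big).$$ Problem (P) on $[0,T]\times[0,L]$: $u_{tt}+2(\bar u+u)u_{tx}-(a^2-(\bar u+u)^2)u_{xx}=F(x,u,u_x,u_t)$; $u(0,x)=\varphi(x)$, $u_t(0,x)=\psi(x)$; $u_x(t,0)=k\,u_t(t,0)$; $u(t,L)=0$. Classical solutions are $C^2$ functions satisfying these relations pointwise. Norms: $\|(\varphi,\psi)\|_{C^2\times C^1}=\max\{\|\varphi\|_{C^2},\|\psi\|_{C^1}\}$ (similarly $C^1\times C^0$); $\|(f,g)\|_{H^2\times H^1}^2=\int_0^L f^2+f'^2+f''^2+g^2+g'^2\,dx$. $C^2$-compatibility conditions: with $w(x)=F(x,\varphi,\varphi',\psi)-2(\bar u+\varphi)\psi'+(a^2-(\bar u+\varphi)^2)\varphi''$ (the value of $u_{tt}$ at $t=0$), they are $\varphi'(0)=k\psi(0)$, $\psi'(0)=k\,w(0)$,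 $\varphi(L)=0$, $\psi(L)=0$, $w(L)=0$. Weights: $h_1(x)=k$, $h_2(x)=\exp(-x/L)$. Constant $\varepsilon_2$: let $k_1(x,v)=h_1(x)(a^2-(\bar u(x)+v)^2)-2h_2(x)(\bar u(x)+v)$. $\varepsilon_2>0$ is a fixed number (it exists under the stated assumptions) such that $$K_1:=\min_{x\in[0,L],\,|v|\le\varepsilon_2}\Big(k_1(x,v)-\frac{h_2(x)^2}{h_1(x)}\Big)>0,\qquad \tilde K_1:=\min_{x\in[0,L],\,|v|\le\varepsilon_2}\frac{h_1(x)k_1(x,v)-h_2(x)^2}{k_1(x,v)}>0.$$ Constant $\varepsilon_1=\varepsilon_1(\upsilon)$ with $\upsilon=2k^2$: a fixed positive number (it exists, and does not depend on $T$ or $\bar u$) such that $\tilde B_3(z)$ is positive definite for $|z|\le2\varepsilon_1$ and $\tilde A_3(z)$ is positive definite for $0<|z|\le2\varepsilon_1$, where $$\tilde B_3(z)=\begin{pmatrix}1+2zk-\frac{(1+2zk)^2}{k^2(a^2-z^2)}&\frac{1+2zk}{k(a^2-z^2)}-k\\ \frac{1+2zk}{k(a^2-z^2)}-k&\upsilon-\frac1{a^2-z^2}\end{pmatrix},$$ $$\tilde A_3(z)=\begin{pmatrix}\frac1{\mathrm e}\frac{a^2+3z^2}{a^2-z^2}-2kz&k-\frac1{\mathrm e}\frac{2z}{a^2-z^2}\\ k-\frac1{\mathrm e}\frac{2z}{a^2-z^2}&C_g(z)+\frac1{\mathrm e}\frac1{a^2-z^2}\end{pmatrix},\quad C_g(z)=\frac{a^2-z^2}{\mathrm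 e\,z^2\big(2+\frac32\theta z+\frac{2\theta z^3}{a^2-z^2}\big)^2}.$$ Constant $\varepsilon_0(T)$: for each $T>0$, $\varepsilon_0(T)>0$ and $C_T>0$ are fixed constants (which exist) such that for all $C^2$-compatible data with $\|(\varphi,\psi)\|_{C^2\times C^1}\le\varepsilon_0(T)$ Problem (P) has a unique solution $u\in C^2([0,T]\times[0,L])$, and this solution satisfies $\|u\|_{C^2([0,T]\times[0,L])}\le C_T\|(\varphi,\psi)\|_{C^2\times C^1}$, $\|u\|_{C([0,T]\times[0,L])}\le\min\{\varepsilon_1,\varepsilon_2\}$, $|u(t,x)|\le\min\{\gamma a-|\bar u(x)|,|\bar u(x)|,\frac1k\}$ and $|u_x(t,x)|\le\min\{1,\frac1k\}$ on $[0,T]\times[0,L]$. For $\bar u_0\in(0,a)$: $$K_\partial(k,\bar u_0)=2\Big[\frac4{k^2}+\frac{2\bar u_0}{k}+\theta\frac{\bar u_0^4+3a^2\bar u_0^2+\frac2ka^2\bar u_0}{2(a^2-\bar u_0^2)}+\frac52\frac{\theta}{k^2}+\frac{\theta}{k}\frac{3a^2\bar u_0-\bar u_0^3}{a^2-\bar u_0^2}\Big]^2,$$ $$C_{E1}(\bar u_0)=\frac{2\theta^4}{k^2}\Big[\frac{6ka^4\bar u_0^4-4ka^2\bar u_0^6+2k\bar u_0^8+2\bar u_0^7-3a^2\bar u_0^5+3a^4\bar u_0^3}{4(a^2-\bar u_0^2)^3}\Big]^2.$$ $T_{Li}(t)=\max_{x\in[0,L]}\{|u(t,x)|,|u_x(t,x)|,|u_t(t,x)|,|\bar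 u(x)|,|\bar u'(x)|\}$. For $s\in[0,a)$: $$P_0(s)=4ks^2+2k\big(1+\tfrac\theta2\big)s+4k\big(1+\tfrac\theta2\big)s^2+2s+4\big(1+\tfrac\theta2\big)s^2+2(k+1)\Big[\theta^2\frac{3a^4s^4+2a^2s^6+s^8}{2(a^2-s^2)^3}+\theta\frac{a^2s}{a^2-s^2}+\theta\frac{s^4+3a^2s^2}{2(a^2-s^2)}+\theta^2\frac{2s^7+3a^2s^5+3a^4s^3}{4(a^2-s^2)^3}s+2s^2+\theta\frac{3a^2s+s^3}{a^2-s^2}s+2s+2s^2+\tfrac32\theta s^2+\theta s\Big],$$ $$P_1(s)=8s+2s+8s^2+4ks^2+4ks+2(k+1)\Big[\theta^3\frac{9a^6s^3+2s^9+6a^4s^5+11a^2s^7}{8(a^2-s^2)^4}s+\theta^2\frac{s^7+6a^4s^3+3a^2s^5}{2(a^2-s^2)^3}s+\theta\frac{s^3}{a^2-s^2}s+4s^2+\theta\frac{3a^2s+s^3}{a^2-s^2}2s+\theta^3\frac{6a^6s^6+4a^2s^{10}+s^{12}+3a^4s^8}{2(a^2-s^2)^5}+\theta^2\frac{a^4s^3+a^2s^5}{2(a^2-s^2)^3}+\theta^2\frac{3a^4s^4}{(a^2-s^2)^3}+\theta\frac{a^2s}{a^2-s^2}+\theta\frac{3a^2s^2+s^4}{2(a^2-s^2)}+2s+2s+2s^2+4s^2+3\theta s^2+\tfrac32\theta s^2+\theta s+\theta s\Big].$$ *)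

theory Defs
  imports "HOL-Analysis.Analysis"
begin

text \<open>Derivatives are taken within the closed interval, i.e. they are one-sided at its
  end points. All intervals \<open>{0..L}\<close>, \<open>{0..T}\<close> in use are nondegenerate, so these
  derivatives are unique. Functions are total; only their values on the
  interval or rectangle matter.\<close>

definition deriv_in :: "real set \<Rightarrow> (real \<Rightarrow> real) \<Rightarrow> real \<Rightarrow> real" where
  "deriv_in S f x = vector_derivative f (at x within S)"

fun Ck_on :: "nat \<Rightarrow> real set \<Rightarrow> (real \<Rightarrow> real) \<Rightarrow> bool" where
  "Ck_on 0 S f \<longleftrightarrow> continuous_on S f"
| "Ck_on (Suc n) S f \<longleftrightarrow>
     continuous_on S f \<and> f differentiable_on S \<and> Ck_on n S (deriv_in S f)"

definition sup_norm :: "real set \<Rightarrow> (real \<Rightarrow> real) \<Rightarrow> real" where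
  "sup_norm S f = (SUP x\<in>S. \<bar>f x\<bar>)"

fun Ck_norm :: "nat \<Rightarrow> real set \<Rightarrow> (real \<Rightarrow> real) \<Rightarrow> real" where
  "Ck_norm 0 S f = sup_norm S f"
| "Ck_norm (Suc n) S f = max (sup_norm S f) (Ck_norm n S (deriv_in S f))"

text \<open>A function \<open>u\<close> on \<open>{0..T} \<times> {0..L}\<close> is written \<open>u t x\<close>.\<close>

definition dt :: "real \<Rightarrow> (real \<Rightarrow> real \<Rightarrow> real) \<Rightarrow> real \<Rightarrow> real \<Rightarrow> real" where
  "dt T u t x = deriv_in {0..T} (\<lambda>s. u s x) t"

definition dx :: "real \<Rightarrow> (real \<Rightarrow> real \<Rightarrow> real) \<Rightarrow> real \<Rightarrow> real \<Rightarrow> real" where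
  "dx L u t x = deriv_in {0..L} (u t) x"

fun Ck_rect :: "nat \<Rightarrow> real \<Rightarrow> real \<Rightarrow> (real \<Rightarrow> real \<Rightarrow> real) \<Rightarrow> bool" where
  "Ck_rect 0 T L u \<longleftrightarrow> continuous_on ({0..T} \<times> {0..L}) (\<lambda>(t, x). u t x)"
| "Ck_rect (Suc n) T L u \<longleftrightarrow>
     continuous_on ({0..T} \<times> {0..L}) (\<lambda>(t, x). u t x) \<and>
     (\<forall>x\<in>{0..L}. (\<lambda>t. u t x) differentiable_on {0..T}) \<and>
     (\<forall>t\<in>{0..T}. (\<lambda>x. u t x) differentiable_on {0..L}) \<and>
     Ck_rect n T L (dt T u) \<and> Ck_rect n T L (dx L u)"

definition sup_norm_rect :: "real \<Rightarrow> real \<Rightarrow> (real \<Rightarrow> real \<Rightarrow> real) \<Rightarrow> real" where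
  "sup_norm_rect T L u = (SUP (t, x)\<in>{0..T} \<times> {0..L}. \<bar>u t x\<bar>)"

fun Ck_norm_rect :: "nat \<Rightarrow> real \<Rightarrow> real \<Rightarrow> (real \<Rightarrow> real \<Rightarrow> real) \<Rightarrow> real" where
  "Ck_norm_rect 0 T L u = sup_norm_rect T L u"
| "Ck_norm_rect (Suc n) T L u =
     max (sup_norm_rect T L u) (max (Ck_norm_rect n T L (dt T u)) (Ck_norm_rect n T L (dx L u)))"

definition C2C1_norm :: "real \<Rightarrow> (real \<Rightarrow> real) \<Rightarrow> (real \<Rightarrow> real) \<Rightarrow> real" where
  "C2C1_norm L f g = max (Ck_norm 2 {0..L} f) (Ck_norm 1 {0..L} g)"

definition C1C0_norm :: "real \<Rightarrow> (real \<Rightarrow> real) \<Rightarrow> (real \<Rightarrow> real) \<Rightarrow> real" where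
  "C1C0_norm L f g = max (Ck_norm 1 {0..L} f) (Ck_norm 0 {0..L} g)"

text \<open>Only applied to pairs in \<open>C\<^sup>2 \<times> C\<^sup>1\<close>, whose weak derivatives are the classical ones.\<close>

definition H2H1_norm :: "real \<Rightarrow> (real \<Rightarrow> real) \<Rightarrow> (real \<Rightarrow> real) \<Rightarrow> real" where
  "H2H1_norm L f g = sqrt (integral {0..L} (\<lambda>x.
      (f x)^2 + (deriv_in {0..L} f x)^2 + (deriv_in {0..L} (deriv_in {0..L} f) x)^2
      + (g x)^2 + (deriv_in {0..L} g x)^2))"

definition stationary_subsonic :: "real \<Rightarrow> real \<Rightarrow> real \<Rightarrow> (real \<Rightarrow> real) \<Rightarrow> bool" where
  "stationary_subsonic a \<theta> L ub \<longleftrightarrow>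
     Ck_on 2 {0..L} ub \<and>
     (\<forall>x\<in>{0..L}. \<bar>ub x\<bar> < a \<and>
        (a^2 - (ub x)^2) * deriv_in {0..L} (deriv_in {0..L} ub) x =
          2 * ub x * (deriv_in {0..L} ub x)^2
          + 3/2 * \<theta> * ub x * \<bar>ub x\<bar> * deriv_in {0..L} ub x)"

definition Ftilde :: "real \<Rightarrow> real \<Rightarrow> real \<Rightarrow> real \<Rightarrow> real" where
  "Ftilde \<theta> p q r = - 2 * r * q - 2 * p * q^2 - 3/2 * \<theta> * p * \<bar>p\<bar> * q - \<theta> * \<bar>p\<bar> * r"

definition Frhs :: "real \<Rightarrow> real \<Rightarrow> real \<Rightarrow> (real \<Rightarrow> real) \<Rightarrow> real \<Rightarrow> real \<Rightarrow> real \<Rightarrow> real \<Rightarrow> real" where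
  "Frhs a \<theta> L ub x p q r =
     Ftilde \<theta> (p + ub x) (q + deriv_in {0..L} ub x) r
     + (a^2 - (ub x + p)^2) / (a^2 - (ub x)^2) * ub x
       * (2 * (deriv_in {0..L} ub x)^2 + 3/2 * \<theta> * \<bar>ub x\<bar> * deriv_in {0..L} ub x)"

definition is_solution ::
  "real \<Rightarrow> real \<Rightarrow> real \<Rightarrow> real \<Rightarrow> (real \<Rightarrow> real) \<Rightarrow> real \<Rightarrow> (real \<Rightarrow> real) \<Rightarrow> (real \<Rightarrow> real)
    \<Rightarrow> (real \<Rightarrow> real \<Rightarrow> real) \<Rightarrow> bool" where
  "is_solution a \<theta> L k ub T \<phi> \<psi> u \<longleftrightarrow>
     Ck_rect 2 T L u \<and>
     (\<forall>t\<in>{0..T}. \<forall>x\<in>{0..L}.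
        dt T (dt T u) t x + 2 * (ub x + u t x) * dx L (dt T u) t x
        - (a^2 - (ub x + u t x)^2) * dx L (dx L u) t x
        = Frhs a \<theta> L ub x (u t x) (dx L u t x) (dt T u t x)) \<and>
     (\<forall>x\<in>{0..L}. u 0 x = \<phi> x \<and> dt T u 0 x = \<psi> x) \<and>
     (\<forall>t\<in>{0..T}. dx L u t 0 = k * dt T u t 0 \<and> u t L = 0)"

text \<open>The value of \<open>u\<^sub>t\<^sub>t\<close> at \<open>t = 0\<close> that the equation forces.\<close>

definition utt_init ::
  "real \<Rightarrow> real \<Rightarrow> real \<Rightarrow> (real \<Rightarrow> real) \<Rightarrow> (real \<Rightarrow> real) \<Rightarrow> (real \<Rightarrow> real) \<Rightarrow> real \<Rightarrow> real" where
  "utt_init a \<theta> L ub \<phi> \<psi> x =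
     Frhs a \<theta> L ub x (\<phi> x) (deriv_in {0..L} \<phi> x) (\<psi> x)
     - 2 * (ub x + \<phi> x) * deriv_in {0..L} \<psi> x
     + (a^2 - (ub x + \<phi> x)^2) * deriv_in {0..L} (deriv_in {0..L} \<phi>) x"

definition C2_compatible ::
  "real \<Rightarrow> real \<Rightarrow> real \<Rightarrow> real \<Rightarrow> (real \<Rightarrow> real) \<Rightarrow> (real \<Rightarrow> real) \<Rightarrow> (real \<Rightarrow> real) \<Rightarrow> bool" where
  "C2_compatible a \<theta> L k ub \<phi> \<psi> \<longleftrightarrow>
     deriv_in {0..L} \<phi> 0 = k * \<psi> 0 \<and>
     deriv_in {0..L} \<psi> 0 = k * utt_init a \<theta> L ub \<phi> \<psi> 0 \<and>
     \<phi> L = 0 \<and> \<psi> L = 0 \<and> utt_init a \<theta> L ub \<phi> \<psi> L = 0"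

definition h1 :: "real \<Rightarrow> real \<Rightarrow> real" where
  "h1 k x = k"

definition h2 :: "real \<Rightarrow> real \<Rightarrow> real" where
  "h2 L x = exp (- x / L)"

definition k1 :: "real \<Rightarrow> real \<Rightarrow> real \<Rightarrow> (real \<Rightarrow> real) \<Rightarrow> real \<Rightarrow> real \<Rightarrow> real" where
  "k1 a L k ub x v = h1 k x * (a^2 - (ub x + v)^2) - 2 * h2 L x * (ub x + v)"

text \<open>The infima below are minima: the first function is continuous on a compact set, and if
  \<open>K1\<close> is positive then \<open>k1\<close> is bounded away from \<open>0\<close>, so that the second one is continuous too.\<close>

definition K1 :: "real \<Rightarrow> real \<Rightarrow> real \<Rightarrow> (real \<Rightarrow> real) \<Rightarrow> real \<Rightarrow> real" where
  "K1 a L k ub \<epsilon>2 =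
     (INF (x, v)\<in>{0..L} \<times> {-\<epsilon>2..\<epsilon>2}. k1 a L k ub x v - (h2 L x)^2 / h1 k x)"

definition K1tilde :: "real \<Rightarrow> real \<Rightarrow> real \<Rightarrow> (real \<Rightarrow> real) \<Rightarrow> real \<Rightarrow> real" where
  "K1tilde a L k ub \<epsilon>2 =
     (INF (x, v)\<in>{0..L} \<times> {-\<epsilon>2..\<epsilon>2}.
        (h1 k x * k1 a L k ub x v - (h2 L x)^2) / k1 a L k ub x v)"

definition eps2_const :: "real \<Rightarrow> real \<Rightarrow> real \<Rightarrow> (real \<Rightarrow> real) \<Rightarrow> real \<Rightarrow> bool" where
  "eps2_const a L k ub \<epsilon>2 \<longleftrightarrow> 0 < \<epsilon>2 \<and> 0 < K1 a L k ub \<epsilon>2 \<and> 0 < K1tilde a L k ub \<epsilon>2"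

definition pos_def :: "real^'n^'n \<Rightarrow> bool" where
  "pos_def A \<longleftrightarrow> transpose A = A \<and> (\<forall>v. v \<noteq> 0 \<longrightarrow> 0 < v \<bullet> (A *v v))"

definition B3 :: "real \<Rightarrow> real \<Rightarrow> real \<Rightarrow> real \<Rightarrow> real^2^2" where
  "B3 a k \<upsilon> z = vector
     [vector [1 + 2*z*k - (1 + 2*z*k)^2 / (k^2 * (a^2 - z^2)),
              (1 + 2*z*k) / (k * (a^2 - z^2)) - k],
      vector [(1 + 2*z*k) / (k * (a^2 - z^2)) - k,
              \<upsilon> - 1 / (a^2 - z^2)]]"

definition Cg_base :: "real \<Rightarrow> real \<Rightarrow> real \<Rightarrow> real" where
  "Cg_base a \<theta> z = 2 + 3/2 * \<theta> * z + 2 * \<theta> * z^3 / (a^2 - z^2)"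

definition Cg :: "real \<Rightarrow> real \<Rightarrow> real \<Rightarrow> real" where
  "Cg a \<theta> z = (a^2 - z^2) / (exp 1 * z^2 * (Cg_base a \<theta> z)^2)"

definition A3 :: "real \<Rightarrow> real \<Rightarrow> real \<Rightarrow> real \<Rightarrow> real^2^2" where
  "A3 a \<theta> k z = vector
     [vector [1 / exp 1 * ((a^2 + 3*z^2) / (a^2 - z^2)) - 2*k*z,
              k - 1 / exp 1 * (2*z / (a^2 - z^2))],
      vector [k - 1 / exp 1 * (2*z / (a^2 - z^2)),
              Cg a \<theta> z + 1 / exp 1 * (1 / (a^2 - z^2))]]"

text \<open>The nonvanishing conditions say that all denominators in \<open>B3\<close>, \<open>A3\<close> are nonzero, so that
  the convention \<open>x / 0 = 0\<close> plays no role.\<close>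

definition eps1_const :: "real \<Rightarrow> real \<Rightarrow> real \<Rightarrow> real \<Rightarrow> real \<Rightarrow> bool" where
  "eps1_const a \<theta> k \<upsilon> \<epsilon>1 \<longleftrightarrow>
     0 < \<epsilon>1 \<and>
     (\<forall>z. \<bar>z\<bar> \<le> 2 * \<epsilon>1 \<longrightarrow> a^2 - z^2 \<noteq> 0 \<and> pos_def (B3 a k \<upsilon> z)) \<and>
     (\<forall>z. 0 < \<bar>z\<bar> \<and> \<bar>z\<bar> \<le> 2 * \<epsilon>1 \<longrightarrow> Cg_base a \<theta> z \<noteq> 0 \<and> pos_def (A3 a \<theta> k z))"

text \<open>The property that characterizes the constants \<open>\<epsilon>\<^sub>0(T)\<close> and \<open>C\<^sub>T\<close>.\<close>

definition eps0_const ::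
  "real \<Rightarrow> real \<Rightarrow> real \<Rightarrow> real \<Rightarrow> real \<Rightarrow> (real \<Rightarrow> real) \<Rightarrow> real \<Rightarrow> real \<Rightarrow> real \<Rightarrow> real \<Rightarrow> real \<Rightarrow> bool" where
  "eps0_const a \<theta> L k \<gamma> ub \<epsilon>1 \<epsilon>2 T \<epsilon>0 C \<longleftrightarrow>
     0 < \<epsilon>0 \<and> 0 < C \<and>
     (\<forall>\<phi> \<psi>. Ck_on 2 {0..L} \<phi> \<and> Ck_on 1 {0..L} \<psi> \<and> C2_compatible a \<theta> L k ub \<phi> \<psi> \<and>
        C2C1_norm L \<phi> \<psi> \<le> \<epsilon>0 \<longrightarrow>
        (\<exists>u. is_solution a \<theta> L k ub T \<phi> \<psi> u \<and>
           (\<forall>v. is_solution a \<theta> L k ub T \<phi> \<psi> v \<longrightarrow> (\<forall>t\<in>{0..T}. \<forall>x\<in>{0..L}. v t x = u t x)) \<and>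
           Ck_norm_rect 2 T L u \<le> C * C2C1_norm L \<phi> \<psi> \<and>
           sup_norm_rect T L u \<le> min \<epsilon>1 \<epsilon>2 \<and>
           (\<forall>t\<in>{0..T}. \<forall>x\<in>{0..L}.
              \<bar>u t x\<bar> \<le> Min {\<gamma> * a - \<bar>ub x\<bar>, \<bar>ub x\<bar>, 1 / k} \<and>
              \<bar>dx L u t x\<bar> \<le> min 1 (1 / k))))"

definition K_bdry :: "real \<Rightarrow> real \<Rightarrow> real \<Rightarrow> real \<Rightarrow> real" where
  "K_bdry a \<theta> k u0 = 2 *
     (4 / k^2 + 2 * u0 / k
      + \<theta> * ((u0^4 + 3 * a^2 * u0^2 + 2 / k * a^2 * u0) / (2 * (a^2 - u0^2)))
      + 5/2 * (\<theta> / k^2)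
      + \<theta> / k * ((3 * a^2 * u0 - u0^3) / (a^2 - u0^2)))^2"

definition C_E1 :: "real \<Rightarrow> real \<Rightarrow> real \<Rightarrow> real \<Rightarrow> real" where
  "C_E1 a \<theta> k u0 = 2 * \<theta>^4 / k^2 *
     ((6 * k * a^4 * u0^4 - 4 * k * a^2 * u0^6 + 2 * k * u0^8
       + 2 * u0^7 - 3 * a^2 * u0^5 + 3 * a^4 * u0^3) / (4 * (a^2 - u0^2)^3))^2"

definition T_Li :: "real \<Rightarrow> (real \<Rightarrow> real) \<Rightarrow> real \<Rightarrow> (real \<Rightarrow> real \<Rightarrow> real) \<Rightarrow> real \<Rightarrow> real" where
  "T_Li L ub T u t = (SUP x\<in>{0..L}.
     Max {\<bar>u t x\<bar>, \<bar>dx L u t x\<bar>, \<bar>dt T u t x\<bar>, \<bar>ub x\<bar>, \<bar>deriv_in {0..L} ub x\<bar>})"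

definition P0 :: "real \<Rightarrow> real \<Rightarrow> real \<Rightarrow> real \<Rightarrow> real" where
  "P0 a \<theta> k s =
     4*k * s^2 + 2*k*(1 + \<theta>/2) * s + 4*k*(1 + \<theta>/2) * s^2 + 2 * s + 4*(1 + \<theta>/2) * s^2
     + 2*(k + 1) *
       (\<theta>^2 * ((3*a^4 * s^4 + 2*a^2 * s^6 + s^8) / (2*(a^2 - s^2)^3))
        + \<theta> * (a^2 * s / (a^2 - s^2))
        + \<theta> * ((s^4 + 3*a^2 * s^2) / (2*(a^2 - s^2)))
        + \<theta>^2 * ((2 * s^7 + 3*a^2 * s^5 + 3*a^4 * s^3) / (4*(a^2 - s^2)^3)) * s
        + 2 * s^2
        + \<theta> * ((3*a^2 * s + s^3) / (a^2 - s^2)) * s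
        + 2 * s + 2 * s^2 + 3/2*\<theta> * s^2 + \<theta> * s)"

definition P1 :: "real \<Rightarrow> real \<Rightarrow> real \<Rightarrow> real \<Rightarrow> real" where
  "P1 a \<theta> k s =
     8 * s + 2 * s + 8 * s^2 + 4*k * s^2 + 4*k * s
     + 2*(k + 1) *
       (\<theta>^3 * ((9*a^6 * s^3 + 2 * s^9 + 6*a^4 * s^5 + 11*a^2 * s^7) / (8*(a^2 - s^2)^4)) * s
        + \<theta>^2 * ((s^7 + 6*a^4 * s^3 + 3*a^2 * s^5) / (2*(a^2 - s^2)^3)) * s
        + \<theta> * (s^3 / (a^2 - s^2)) * s
        + 4 * s^2
        + \<theta> * ((3*a^2 * s + s^3) / (a^2 - s^2)) * (2 * s)
        + \<theta>^3 * ((6*a^6 * s^6 + 4*a^2 * s^10 + s^12 + 3*a^4 * s^8) / (2*(a^2 - s^2)^5))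
        + \<theta>^2 * ((a^4 * s^3 + a^2 * s^5) / (2*(a^2 - s^2)^3))
        + \<theta>^2 * (3*a^4 * s^4 / (a^2 - s^2)^3)
        + \<theta> * (a^2 * s / (a^2 - s^2))
        + \<theta> * ((3*a^2 * s^2 + s^4) / (2*(a^2 - s^2)))
        + 2 * s + 2 * s + 2 * s^2 + 4 * s^2 + 3*\<theta> * s^2 + 3/2*\<theta> * s^2 + \<theta> * s + \<theta> * s)"

text \<open>For a solution \<open>u\<close> with \<open>T_Li < a\<close> on \<open>{0..T}\<close> the supremum is a maximum, because
  \<open>T_Li\<close> is then continuous in \<open>t\<close> and \<open>P0\<close>, \<open>P1\<close> are continuous on \<open>{0..<a}\<close>.\<close>

definition kappa ::
  "real \<Rightarrow> real \<Rightarrow> real \<Rightarrow> real \<Rightarrow> (real \<Rightarrow> real) \<Rightarrow> real \<Rightarrow> real \<Rightarrow> (real \<Rightarrow> real \<Rightarrow> real) \<Rightarrow> real" where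
  "kappa a \<theta> L k ub \<epsilon>2 T u =
     (SUP t\<in>{0..T}. P0 a \<theta> k (T_Li L ub T u t) + P1 a \<theta> k (T_Li L ub T u t))
       * (1 + L^2) * (1 / K1 a L k ub \<epsilon>2 + 1 / K1tilde a L k ub \<epsilon>2)
     + 2 * k^2 * C_E1 a \<theta> k (ub 0) * (L / K1 a L k ub \<epsilon>2)"

definition decay_rate ::
  "real \<Rightarrow> real \<Rightarrow> real \<Rightarrow> real \<Rightarrow> (real \<Rightarrow> real) \<Rightarrow> real \<Rightarrow> real \<Rightarrow> (real \<Rightarrow> real \<Rightarrow> real) \<Rightarrow> real" where
  "decay_rate a \<theta> L k ub \<epsilon>2 T u = 1 / (2 * exp 1 * L * k) - kappa a \<theta> L k ub \<epsilon>2 T u"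

text \<open>The data \<open>(\<phi>, \<psi>)\<close> are admissible for \<open>T\<close> and \<open>u\<close> is the corresponding solution.
  Uniqueness of \<open>u\<close> is part of the defining property of \<open>\<epsilon>0 = \<epsilon>\<^sub>0(T)\<close>.\<close>

definition admissible ::
  "real \<Rightarrow> real \<Rightarrow> real \<Rightarrow> real \<Rightarrow> (real \<Rightarrow> real) \<Rightarrow> real \<Rightarrow> real \<Rightarrow> real
    \<Rightarrow> (real \<Rightarrow> real) \<Rightarrow> (real \<Rightarrow> real) \<Rightarrow> (real \<Rightarrow> real \<Rightarrow> real) \<Rightarrow> bool" where
  "admissible a \<theta> L k ub \<epsilon>2 T \<epsilon>0 \<phi> \<psi> u \<longleftrightarrow>
     Ck_on 2 {0..L} \<phi> \<and> Ck_on 1 {0..L} \<psi> \<and>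
     C2C1_norm L \<phi> \<psi> \<le> \<epsilon>0 \<and>
     C2_compatible a \<theta> L k ub \<phi> \<psi> \<and>
     is_solution a \<theta> L k ub T \<phi> \<psi> u \<and>
     (\<forall>t\<in>{0..T}. T_Li L ub T u t < a) \<and>
     kappa a \<theta> L k ub \<epsilon>2 T u \<le> 1 / (4 * exp 1 * L * k)"

end

theory Submission
  imports Defs
begin

text \<open>
  Put \<open>b = ub + u\<close>, \<open>c = a\<^sup>2 - b\<^sup>2\<close>, \<open>h = exp (- x / L)\<close>. For a solution \<open>w\<close> of
  \<open>w\<^sub>t\<^sub>t + 2 b w\<^sub>t\<^sub>x - c w\<^sub>x\<^sub>x = g\<close> the functional
  \<open>E[w] = \<integral> (k c - 2 h b) w\<^sub>x\<^sup>2 - 2 h w\<^sub>x w\<^sub>t + k w\<^sub>t\<^sup>2\<close> has a derivative whose boundary terms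
  have the right sign if \<open>w\<^sub>x = k w\<^sub>t\<close> at \<open>0\<close> and \<open>w = 0\<close> at \<open>L\<close>, and whose main part is
  \<open>- (1/L) \<integral> h (w\<^sub>t\<^sup>2 + c w\<^sub>x\<^sup>2)\<close>; everything else is small because \<open>\<kappa>\<close> is.
  Both \<open>u\<close> and \<open>u\<^sub>t\<close> satisfy these homogeneous boundary conditions, so \<open>E[u]\<close> and \<open>E[u\<^sub>t]\<close> decay
  exponentially, and the equation recovers \<open>u\<^sub>x\<^sub>x\<close> from \<open>u\<^sub>t\<^sub>t\<close>, \<open>u\<^sub>t\<^sub>x\<close> and lower order terms.
  Differentiating in time rather than in space makes a separate treatment of the boundary traces
  of second derivatives unnecessary. Since \<open>u\<close> is only \<open>C\<^sup>2\<close>, the estimate for \<open>E[u\<^sub>t]\<close> is proved for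
  difference quotients in time, with a source error that tends to \<open>0\<close> with the step.
\<close>

section \<open>Quadratic energy densities\<close>

text \<open>The hypotheses place the flow at low Mach number. The inequality for
  \<open>K_bdry\<close> forces a k \<ge> 8, the supremum condition forces 2 k ub \<le> 1, and
  \<bar>u\<bar> \<le> ub then yields 0 \<le> b \<le> 1/k \<le> a/8. Numbers such as 63/64, 53/64 and
  8/63 come from this. The rate has some room. The functional by itself dissipates at rate 7/(8 e L
  k), more than the 1/(2 e L k) that occurs in \<mu>. Since \<open>K1\<close> is at most k a^2 and
  \<open>K1tilde\<close> at most k, the perturbation costs at most 5/2 \<kappa>, and the surplus
  together with \<kappa> \<le> 1/(4 e L k) pays for the factor 5/2. The obstacle in the estimate for
  u_t is the product u_t u_xx in the differentiated equation: neither energy contains u_xx. The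
  undifferentiated equation replaces it by u_tt, u_tx and the source, at the price of coefficients
  that are still of order s. The second derivative of the stationary state must also be small with
  s. A first integral makes it explicit in v, and the resulting bound is matched by one of the
  fractions in \<open>P0\<close>.\<close>

definition edens :: "real \<Rightarrow> real \<Rightarrow> real \<Rightarrow> real \<Rightarrow> real \<Rightarrow> real \<Rightarrow> real" where
  "edens a k h b p q = (k * (a^2 - b^2) - 2 * h * b) * p^2 - 2 * h * p * q + k * q^2"

definition eflux :: "real \<Rightarrow> real \<Rightarrow> real \<Rightarrow> real \<Rightarrow> real \<Rightarrow> real \<Rightarrow> real" where
  "eflux a k h b p q =
     2 * k * ((a^2 - b^2) * p * q - b * q^2) - h * (q^2 + (a^2 - b^2) * p^2)"

text \<open>Multiplying the equation by \<open>2 * k * w_t - 2 * h * w_x\<close> gives a balance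
  law: the time derivative of \<open>edens\<close> is the space derivative of \<open>eflux\<close>
  plus this remainder. Here \<open>p\<close> is w_x, \<open>q\<close> is w_t, \<open>g\<close> is
  the source, and the damping factor \<open>h / L\<close> is - h' for h = exp (- x / L).\<close>

definition eprod ::
  "real \<Rightarrow> real \<Rightarrow> real \<Rightarrow> real \<Rightarrow> real \<Rightarrow> real \<Rightarrow> real \<Rightarrow> real \<Rightarrow> real \<Rightarrow> real \<Rightarrow> real" where
  "eprod a k L h b bt bx p q g =
     - (h / L) * (q^2 + (a^2 - b^2) * p^2)
     - 2 * k * b * bt * p^2 + 4 * k * b * bx * p * q + 2 * k * bx * q^2
     - 2 * h * b * bx * p^2 - 2 * h * bt * p^2 + 2 * k * q * g - 2 * h * p * g"

lemma weighted_AM_GM: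
  fixes x y c :: real
  assumes "c > 0"
  shows "2 * \<bar>x\<bar> * \<bar>y\<bar> \<le> c * x^2 + y^2 / c"
proof -
  have "0 \<le> (c * \<bar>x\<bar> - \<bar>y\<bar>)^2 / c" using assms by simp
  also have "\<dots> = c * x^2 + y^2 / c - 2 * \<bar>x\<bar> * \<bar>y\<bar>"
    using assms by (simp add: power2_diff field_simps power2_eq_square)
  finally show ?thesis by simp
qed

text \<open>AM-GM with weight \<open>a\<close> produces the factors a and 1/a; the assumption on
  \<open>a * k\<close> bounds them by k a^2 / 8 and k / 8.\<close>

lemma cross_term_bound:
  fixes a k h p q :: real
  assumes "0 < a" "0 < k" "8 \<le> a * k" "0 \<le> h" "h \<le> 1"
  shows "\<bar>2 * h * p * q\<bar> \<le> h * (k / 8) * (a^2 * p^2 + q^2)"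
proof -
  have "2 * \<bar>p\<bar> * \<bar>q\<bar> \<le> a * p^2 + q^2 / a" by (rule weighted_AM_GM) (use assms in simp)
  also have "a * p^2 \<le> k / 8 * a^2 * p^2"
    using assms mult_left_mono[of 8 "a * k" a]
        by (intro mult_right_mono) (auto simp: power2_eq_square mult_ac)
  also have "q^2 / a \<le> k / 8 * q^2"
    using assms mult_right_mono[of 8 "a * k" "q^2"] by (simp add: field_simps mult_ac)
  finally have "2 * \<bar>p\<bar> * \<bar>q\<bar> \<le> k / 8 * (a^2 * p^2 + q^2)" by (simp add: algebra_simps)
  from mult_left_mono[OF this \<open>0 \<le> h\<close>] show ?thesis
    using assms by (simp add: abs_mult algebra_simps)
qed

text \<open>The Mach number b/a is at most 1/8 because b \<le> 1/k \<le> a/8; the rest follows, the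
  last bound through 2 b \<le> a/4 and 8 \<le> a k.\<close>

lemma speed_bound:
  fixes a k b :: real
  assumes "0 < a" "0 < k" "8 \<le> a * k" "0 \<le> b" "k * b \<le> 1"
  shows "b \<le> a / 8" "b^2 \<le> a^2 / 64" "63 / 64 * a^2 \<le> a^2 - b^2" "2 * b \<le> k * a^2 / 32"
proof -
  have "k * (8 * b) \<le> k * a" using assms by
      (simp only: mult.left_commute[of k 8] mult.commute[of k a])
  then have "8 * b \<le> a" using assms by (simp only: mult_le_cancel_left_pos)
  then show b: "b \<le> a / 8" by simp
  then have "b^2 \<le> (a/8)^2" using assms by (intro power_mono) auto
  then show b2: "b^2 \<le> a^2 / 64" by (simp add: power_divide)
  then show "63 / 64 * a^2 \<le> a^2 - b^2" by simp
  have "8 * a \<le> (a * k) * a" using assms by (intro mult_right_mono) auto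
  with b show "2 * b \<le> k * a^2 / 32" by (simp add: power2_eq_square algebra_simps)
qed

text \<open>Budget for p^2: 63/64 from the subsonic factor, less 2/64 for the term
  \<open>2 * h * b\<close> and 8/64 for the cross term.\<close>

lemma edens_lower:
  fixes a k h b p q :: real
  assumes ak: "0 < a" "0 < k" "8 \<le> a * k" and b: "0 \<le> b" "k * b \<le> 1" and h: "0 \<le> h" "h \<le> 1"
  shows "53 / 64 * k * (a^2 * p^2 + q^2) \<le> edens a k h b p q"
proof -
  note sb = speed_bound[OF ak b]
  have 1: "2 * h * p * q \<le> k / 8 * (a^2 * p^2 + q^2)"
  proof -
    have "\<bar>2 * h * p * q\<bar> \<le> h * (k / 8 * (a^2 * p^2 + q^2))"
      using cross_term_bound[OF ak h, of p q] by (simp add: algebra_simps)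
    also have "\<dots> \<le> 1 * (k / 8 * (a^2 * p^2 + q^2))"
      using h ak by (intro mult_right_mono) auto
    finally show ?thesis by simp
  qed
  have "2 * h * b \<le> 1 * (2 * b)" using h b mult_right_mono[of h 1 "2 * b"]
      by (simp add: mult.commute mult.left_commute)
  then have "2 * h * b \<le> k * a^2 / 32" using sb(4) by linarith
  moreover have "k * (63/64 * a^2) \<le> k * (a^2 - b^2)" using sb(3) ak by (intro mult_left_mono) auto
  ultimately have "61 / 64 * (k * a^2) \<le> k * (a^2 - b^2) - 2 * h * b" by (simp add: algebra_simps)
  then have 2: "61 / 64 * (k * a^2) * p^2 \<le> (k * (a^2 - b^2) - 2 * h * b) * p^2"
    by (intro mult_right_mono) auto
  have 3: "0 \<le> k * q^2" using ak by simp
  have 4: "k / 8 * (a^2 * p^2 + q^2) = (k * a^2) * p^2 / 8 + k * q^2 / 8"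
    "53 / 64 * k * (a^2 * p^2 + q^2) = 53 / 64 * ((k * a^2) * p^2) + 53 / 64 * (k * q^2)"
    by (simp_all add: algebra_simps)
  show ?thesis using 1 2 3 unfolding edens_def 4 by linarith
qed

text \<open>The correction keeps its factor \<open>h\<close> instead of the cruder bound 1, since
  \<open>dissipation_bound\<close> compares it with a damping that is itself proportional to
  \<open>h\<close>. The number 8/63 is 1/8 times 64/63, the latter from replacing a^2 by a^2 -
  b^2.\<close>

lemma edens_upper:
  fixes a k h b p q :: real
  assumes ak: "0 < a" "0 < k" "8 \<le> a * k" and b: "0 \<le> b" "k * b \<le> 1" and h: "0 \<le> h" "h \<le> 1"
  shows "edens a k h b p q \<le> k * (1 + 8 / 63 * h) * (q^2 + (a^2 - b^2) * p^2)"
proof -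
  note sb = speed_bound[OF ak b]
  have "- (2 * h * p * q) \<le> h * (k / 8) * (a^2 * p^2 + q^2)"
    using cross_term_bound[OF ak h, of p q] by linarith
  also have "\<dots> \<le> h * (k / 8) * (64/63 * (q^2 + (a^2 - b^2) * p^2))"
  proof (intro mult_left_mono)
    have "a^2 * p^2 \<le> (64/63 * (a^2 - b^2)) * p^2" using sb(3) by (intro mult_right_mono) auto
    then show "a^2 * p^2 + q^2 \<le> 64/63 * (q^2 + (a^2 - b^2) * p^2)"
      using zero_le_power2[of q] unfolding distrib_left mult.assoc by linarith
  qed (use h ak in auto)
  finally have 1: "- (2 * h * p * q) \<le> h * (k / 8) * (64/63 * (q^2 + (a^2 - b^2) * p^2))" .
  have 2: "0 \<le> 2 * h * b * p^2" using h b by simp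
  define X where "X = q^2 + (a^2 - b^2) * p^2"
  have 3: "edens a k h b p q = k * X - 2 * h * b * p^2 - 2 * h * p * q"
    unfolding edens_def X_def by (simp add: algebra_simps)
  have 4: "k * (1 + 8 / 63 * h) * X = k * X + h * (k / 8) * (64/63 * X)"
      by (simp add: algebra_simps)
  show ?thesis using 1 2 unfolding X_def[symmetric] 3 4 by linarith
qed

lemma exp1_ge: "5 / 2 \<le> exp (1::real)"
  using exp_lower_Taylor_quadratic[of 1] by simp

text \<open>The worst weight is h = 1/e, attained at x = L, where the damping against k (q^2 + c
  p^2), with c = a^2 - b^2, has rate 1/(e L k). One eighth of this rate is given up to cover the
  cross term.\<close>

lemma dissipation_bound:
  fixes a k h b p q L :: real
  assumes ak: "0 < a" "0 < k" "8 \<le> a * k" and b: "0 \<le> b" "k * b \<le> 1" and h: "1 / exp 1 \<le> h" "h \<le> 1"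
    and L: "0 < L"
  shows "7 / (8 * exp 1 * L * k) * edens a k h b p q \<le> h / L * (q^2 + (a^2 - b^2) * p^2)"
proof -
  note sb = speed_bound[OF ak b]
  define X where "X = q^2 + (a^2 - b^2) * p^2"
  have X: "0 \<le> X" using sb(3) zero_le_power2[of a] unfolding X_def
      by (intro add_nonneg_nonneg mult_nonneg_nonneg zero_le_power2) linarith
  have h0: "0 \<le> h" using h(1) order_trans[of 0 "1 / exp 1" h] by simp
  have "7 / (8 * exp 1 * L * k) * edens a k h b p q
      \<le> 7 / (8 * exp 1 * L * k) * (k * (1 + 8 / 63 * h) * X)"
    using edens_upper[OF ak b h0 h(2), of p q] ak L unfolding X_def by (intro mult_left_mono) auto
  also have "\<dots> = ((7 / 8) * (1 / exp 1) + (1/9) * h * (1 / exp 1)) / L * X"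
    using ak L by (simp add: field_simps)
  also have "\<dots> \<le> h / L * X"
  proof (intro mult_right_mono divide_right_mono)
    have "1 / exp 1 \<le> (2/5::real)" using exp1_ge by (simp add: field_simps)
    then have "h * (1 / exp 1) \<le> h * (2/5)" using h0 by (rule mult_left_mono)
    then show "(7 / 8) * (1 / exp 1) + (1/9) * h * (1 / exp 1) \<le> h" using h h0 by linarith
  qed (use L X in auto)
  finally show ?thesis unfolding X_def .
qed

text \<open>Every term except the damping carries a derivative of the speed, of size s, or the
  source. The AM-GM weights a, 1/L and a/L are chosen so that a later application of Poincare, with
  constant L^2, turns the w^2 terms into multiples of p^2 of the same size as those already present.
  The error \<open>d\<close> is kept linear, multiplied by a plain bound \<open>N\<close>, because
  it is sent to 0 afterwards.\<close>

lemma eprod_bound: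
  fixes a k L h b bt bx p q g w s A B D d N :: real
  assumes a: "0 < a" and k: "0 < k" and L: "0 < L" and h: "0 \<le> h" "h \<le> 1" and s: "0 \<le> s"
    and ABD: "0 \<le> A" "0 \<le> B" "0 \<le> D" "0 \<le> d"
    and b: "0 \<le> b" "b \<le> 2 * s" "\<bar>bt\<bar> \<le> s" "\<bar>bx\<bar> \<le> 2 * s"
    and g: "\<bar>g\<bar> \<le> A * \<bar>w\<bar> + B * \<bar>p\<bar> + D * \<bar>q\<bar> + d"
    and N: "2 * k * \<bar>q\<bar> + 2 * \<bar>p\<bar> \<le> N"
  shows "eprod a k L h b bt bx p q g \<le> - (h / L) * (q^2 + (a^2 - b^2) * p^2)
     + (4 * k * s^2 + 8 * s^2 + 2 * s + 2 * B + a * (8 * k * s^2 + k * B + D) + L * A) * p^2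
     + (4 * k * s + 2 * k * D + (8 * k * s^2 + k * B + D) / a + L / a * (k * A)) * q^2
     + (A / L + a / L * (k * A)) * w^2 + N * d"
proof -
  have bbt: "b * \<bar>bt\<bar> \<le> 2 * s^2"
    using mult_mono[OF b(2,3)] s by (simp add: power2_eq_square)
  have bbx: "b * \<bar>bx\<bar> \<le> 4 * s^2"
    using mult_mono[OF b(2,4)] s by (simp add: power2_eq_square)
  have 1: "- 2 * k * b * bt * p^2 \<le> 4 * k * s^2 * p^2"
  proof -
    have "- (b * bt) \<le> 2 * s^2" using bbt abs_mult[of b bt] b by linarith
    then have "2 * k * p^2 * (- (b * bt)) \<le> 2 * k * p^2 * (2 * s^2)"
      by (rule mult_left_mono) (use k in simp)
    moreover have "- 2 * k * b * bt * p^2 = 2 * k * p^2 * (- (b * bt))"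
      "2 * k * p^2 * (2 * s^2) = 4 * k * s^2 * p^2" by algebra+
    ultimately show ?thesis by linarith
  qed
  have 2: "4 * k * b * bx * p * q \<le> 8 * k * s^2 * (2 * \<bar>p\<bar> * \<bar>q\<bar>)"
  proof -
    have "4 * k * b * bx * p * q \<le> \<bar>4 * k * b * bx * p * q\<bar>" by (rule abs_ge_self)
    also have "\<dots> = 4 * k * \<bar>p\<bar> * \<bar>q\<bar> * (b * \<bar>bx\<bar>)" using b k by (simp add: abs_mult)
    also have "\<dots> \<le> 4 * k * \<bar>p\<bar> * \<bar>q\<bar> * (4 * s^2)" by (rule mult_left_mono[OF bbx]) (use k in simp)
    also have "\<dots> = 8 * k * s^2 * (2 * \<bar>p\<bar> * \<bar>q\<bar>)" by algebra
    finally show ?thesis .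
  qed
  have 3: "2 * k * bx * q^2 \<le> 4 * k * s * q^2"
  proof -
    have "bx \<le> 2 * s" using b by linarith
    then have "bx * (2 * k * q^2) \<le> (2 * s) * (2 * k * q^2)"
        by (rule mult_right_mono) (use k in simp)
    moreover have "2 * k * bx * q^2 = bx * (2 * k * q^2)"
        "(2 * s) * (2 * k * q^2) = 4 * k * s * q^2" by algebra+
    ultimately show ?thesis by linarith
  qed
  have hm: "h * y \<le> z" if "y \<le> z" "0 \<le> z" for y z
  proof -
    have "h * y \<le> h * z" using that h by (intro mult_left_mono)
    also have "\<dots> \<le> 1 * z" using that h by (intro mult_right_mono)
    finally show ?thesis by simp
  qed
  have 4: "- 2 * h * b * bx * p^2 \<le> 8 * s^2 * p^2"
  proof -
    have "- (b * bx) \<le> 4 * s^2" using bbx abs_mult[of b bx] b by linarith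
    then have "h * - (b * bx) \<le> 4 * s^2" by (rule hm) simp
    then have "2 * p^2 * (h * - (b * bx)) \<le> 2 * p^2 * (4 * s^2)" by (rule mult_left_mono) simp
    moreover have "- 2 * h * b * bx * p^2 = 2 * p^2 * (h * - (b * bx))"
      "2 * p^2 * (4 * s^2) = 8 * s^2 * p^2" by algebra+
    ultimately show ?thesis by linarith
  qed
  have 5: "- 2 * h * bt * p^2 \<le> 2 * s * p^2"
  proof -
    have "- bt \<le> s" using b by linarith
    then have "h * - bt \<le> s" by (rule hm) (rule s)
    then have "2 * p^2 * (h * - bt) \<le> 2 * p^2 * s" by (rule mult_left_mono) simp
    moreover have "- 2 * h * bt * p^2 = 2 * p^2 * (h * - bt)" "2 * p^2 * s = 2 * s * p^2"
        by algebra+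
    ultimately show ?thesis by linarith
  qed
  have 6: "2 * k * q * g - 2 * h * p * g \<le> (2 * k * \<bar>q\<bar> + 2 * \<bar>p\<bar>) * (A * \<bar>w\<bar> + B * \<bar>p\<bar> + D * \<bar>q\<bar>)
      + N * d"
  proof -
    have "2 * k * (q * g) \<le> 2 * k * \<bar>q * g\<bar>" by (rule mult_left_mono) (use k in auto)
    moreover have "h * - (p * g) \<le> \<bar>p * g\<bar>" by (rule hm) auto
    moreover have "2 * k * q * g = 2 * k * (q * g)" "- (2 * h * p * g) = 2 * (h * - (p * g))"
        by algebra+
    ultimately have "2 * k * q * g - 2 * h * p * g \<le> 2 * k * (\<bar>q\<bar> * \<bar>g\<bar>) + 2 * (\<bar>p\<bar> * \<bar>g\<bar>)"
      unfolding abs_mult by linarith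
    also have "\<dots> = (2 * k * \<bar>q\<bar> + 2 * \<bar>p\<bar>) * \<bar>g\<bar>" by algebra
    also have "\<dots> \<le> (2 * k * \<bar>q\<bar> + 2 * \<bar>p\<bar>) * (A * \<bar>w\<bar> + B * \<bar>p\<bar> + D * \<bar>q\<bar> + d)"
      by (rule mult_left_mono[OF g]) (use k in simp)
    also have "\<dots> = (2 * k * \<bar>q\<bar> + 2 * \<bar>p\<bar>) * (A * \<bar>w\<bar> + B * \<bar>p\<bar> + D * \<bar>q\<bar>)
        + (2 * k * \<bar>q\<bar> + 2 * \<bar>p\<bar>) * d"
      by algebra
    also have "(2 * k * \<bar>q\<bar> + 2 * \<bar>p\<bar>) * d \<le> N * d"
        by (rule mult_right_mono[OF N]) (use ABD in simp)
    finally show ?thesis by simp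
  qed
  have 7: "(2 * k * \<bar>q\<bar> + 2 * \<bar>p\<bar>) * (A * \<bar>w\<bar> + B * \<bar>p\<bar> + D * \<bar>q\<bar>)
     = 2 * B * p^2 + 2 * k * D * q^2 + (k * B + D) * (2 * \<bar>p\<bar> * \<bar>q\<bar>)
       + A * (2 * \<bar>w\<bar> * \<bar>p\<bar>) + k * A * (2 * \<bar>w\<bar> * \<bar>q\<bar>)"
    unfolding power2_abs[of p, symmetric] power2_abs[of q, symmetric] by algebra
  have 8: "8 * k * s^2 * (2 * \<bar>p\<bar> * \<bar>q\<bar>) \<le> 8 * k * s^2 * (a * p^2 + q^2 / a)"
    by (rule mult_left_mono[OF weighted_AM_GM[OF a]]) (use k in simp)
  have 11: "(k * B + D) * (2 * \<bar>p\<bar> * \<bar>q\<bar>) \<le> (k * B + D) * (a * p^2 + q^2 / a)"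
    by (rule mult_left_mono[OF weighted_AM_GM[OF a]]) (use k ABD in simp)
  have 9: "A * (2 * \<bar>w\<bar> * \<bar>p\<bar>) \<le> A * (1 / L * w^2 + p^2 / (1 / L))"
    by (rule mult_left_mono[OF weighted_AM_GM]) (use L ABD in simp_all)
  have 10: "k * A * (2 * \<bar>w\<bar> * \<bar>q\<bar>) \<le> k * A * (a / L * w^2 + q^2 / (a / L))"
    by (rule mult_left_mono[OF weighted_AM_GM]) (use L ABD a k in simp_all)
  have "eprod a k L h b bt bx p q g \<le> - (h / L) * (q^2 + (a^2 - b^2) * p^2)
     + 4 * k * s^2 * p^2 + 4 * k * s * q^2 + 8 * s^2 * p^2 + 2 * s * p^2
     + (2 * B * p^2 + 2 * k * D * q^2 + 8 * k * s^2 * (a * p^2 + q^2 / a) + (k * B + D) *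
         (a * p^2 + q^2 / a)
       + A * (1 / L * w^2 + p^2 / (1 / L)) + k * A * (a / L * w^2 + q^2 / (a / L))) + N * d"
    using 1 2 3 4 5 6 8 9 10 11 unfolding 7 eprod_def by linarith
  also have "\<dots> = - (h / L) * (q^2 + (a^2 - b^2) * p^2)
     + (4 * k * s^2 + 8 * s^2 + 2 * s + 2 * B + a * (8 * k * s^2 + k * B + D) + L * A) * p^2
     + (4 * k * s + 2 * k * D + (8 * k * s^2 + k * B + D) / a + L / a * (k * A)) * q^2
     + (A / L + a / L * (k * A)) * w^2 + N * d"
    by (simp add: divide_inverse algebra_simps)
  finally show ?thesis .
qed

section \<open>Gronwall, Poincare and Sobolev inequalities on an interval\<close>

lemma nonincreasing_within:
  fixes f f' :: "real \<Rightarrow> real"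
  assumes "0 \<le> t" "t \<le> T"
    and der: "\<And>x. x \<in> {0..T} \<Longrightarrow> (f has_real_derivative f' x) (at x within {0..T})"
    and le: "\<And>x. x \<in> {0..T} \<Longrightarrow> f' x \<le> 0"
  shows "f t \<le> f 0"
proof -
  have "\<And>x. x \<in> {0..t} \<Longrightarrow> (f has_real_derivative f' x) (at x within {0..t})"
    using der assms(2) by (meson DERIV_subset atLeastAtMost_iff atLeastatMost_subset_iff order_trans
        order_refl)
  then have "\<exists>x\<in>{0..t}. f t - f 0 = f' x * (t - 0)"
    using mvt_very_simple[of 0 t f "\<lambda>x y. f' x * y"] assms(1)
        by (auto simp: has_field_derivative_def)
  then obtain x where x: "x \<in> {0..t}" "f t - f 0 = f' x * t" by auto
  have "f' x * t \<le> 0" using le[of x] x assms by (intro mult_nonpos_nonneg) auto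
  with x show ?thesis by simp
qed

lemma gronwall_decay:
  fixes f f' :: "real \<Rightarrow> real"
  assumes "0 \<le> t" "t \<le> T" "0 < \<mu>" "0 \<le> c"
    and der: "\<And>x. x \<in> {0..T} \<Longrightarrow> (f has_real_derivative f' x) (at x within {0..T})"
    and le: "\<And>x. x \<in> {0..T} \<Longrightarrow> f' x \<le> - \<mu> * f x + c"
  shows "f t \<le> exp (- \<mu> * t) * f 0 + c / \<mu>"
proof -
  define F where "F x = exp (\<mu> * x) * (f x - c / \<mu>)" for x
  define F' where "F' x = exp (\<mu> * x) * \<mu> * (f x - c / \<mu>) + exp (\<mu> * x) * f' x" for x
  have "F t \<le> F 0"
  proof (rule nonincreasing_within[OF assms(1,2)])
    show "(F has_real_derivative F' x) (at x within {0..T})" if "x \<in> {0..T}" for x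
      unfolding F_def F'_def by (rule derivative_eq_intros der[OF that] refl | simp)+
    show "F' x \<le> 0" if "x \<in> {0..T}" for x
    proof -
      have "F' x = exp (\<mu> * x) * (\<mu> * f x - c + f' x)"
        using assms(3) unfolding F'_def by (simp add: algebra_simps)
      then show ?thesis using le[OF that] by (simp add: mult_nonneg_nonpos)
    qed
  qed
  then have "exp (- \<mu> * t) * F t \<le> exp (- \<mu> * t) * F 0" by simp
  moreover have "exp (- \<mu> * t) * F t = f t - c / \<mu>"
    unfolding F_def by (simp add: exp_minus field_simps)
  moreover have "exp (- \<mu> * t) * F 0 \<le> exp (- \<mu> * t) * f 0"
    using assms unfolding F_def by simp
  ultimately show ?thesis by linarith
qed

text \<open>The integral of (f - c)^2 is nonnegative when c is the mean value of f.\<close>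

lemma integral_squared_le:
  fixes f :: "real \<Rightarrow> real"
  assumes L: "0 < L" and f: "continuous_on {0..L} f"
  shows "(integral {0..L} f)^2 \<le> L * integral {0..L} (\<lambda>x. (f x)^2)"
proof -
  define c where "c = integral {0..L} f / L"
  have i: "f integrable_on {0..L}" "(\<lambda>x. (f x)^2) integrable_on {0..L}"
    by (auto intro!: integrable_continuous_real continuous_intros f)
  have "((\<lambda>x. c^2) has_integral (L * c^2)) {0..L}"
    using has_integral_const_real[of "c^2" 0 L] L by simp
  then have "((\<lambda>x. (f x)^2 - 2 * c * f x + c^2) has_integral
      (integral {0..L} (\<lambda>x. (f x)^2) - 2 * c * integral {0..L} f + L * c^2)) {0..L}"
    using L by (intro has_integral_add has_integral_diff has_integral_mult_right integrable_integral
        i)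
  then have "0 \<le> integral {0..L} (\<lambda>x. (f x)^2) - 2 * c * integral {0..L} f + L * c^2"
  proof (rule has_integral_nonneg)
    show "0 \<le> (f x)^2 - 2 * c * f x + c^2" for x
      using zero_le_power2[of "f x - c"] by (simp add: power2_diff mult_ac)
  qed
  moreover have "integral {0..L} f = L * c" using L unfolding c_def by simp
  ultimately have "0 \<le> integral {0..L} (\<lambda>x. (f x)^2) - L * c^2" by (simp add: power2_eq_square)
  then have "L * (L * c^2) \<le> L * integral {0..L} (\<lambda>x. (f x)^2)" using L by simp
  then show ?thesis unfolding \<open>integral {0..L} f = L * c\<close> by (simp add: power2_eq_square mult_ac)
qed

lemma poincare:
  fixes w p :: "real \<Rightarrow> real"
  assumes L: "0 < L" and p: "continuous_on {0..L} p"
    and der: "\<And>x. x \<in> {0..L} \<Longrightarrow> (w has_real_derivative p x) (at x within {0..L})"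
    and wL: "w L = 0"
  shows "integral {0..L} (\<lambda>x. (w x)^2) \<le> L^2 * integral {0..L} (\<lambda>x. (p x)^2)"
proof -
  have w: "continuous_on {0..L} w" by (rule DERIV_continuous_on[OF der])
  have *: "(w x)^2 \<le> L * integral {0..L} (\<lambda>x. (p x)^2)" if x: "x \<in> {0..L}" for x
  proof -
    have "(p has_integral (w L - w x)) {x..L}"
      using x by (intro fundamental_theorem_of_calculus)
        (auto intro!: has_vector_derivative_within_subset[OF
            der[unfolded has_real_derivative_iff_has_vector_derivative]])
    then have "\<bar>w x\<bar> = \<bar>integral {x..L} p\<bar>" using wL by (simp add: has_integral_iff)
    also have "\<dots> \<le> integral {x..L} (\<lambda>x. \<bar>p x\<bar>)"
      using x by (intro integral_norm_bound_integral[of p "{x..L}"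
          "\<lambda>x. \<bar>p x\<bar>", unfolded real_norm_def])
        (auto intro!: integrable_continuous_real continuous_intros continuous_on_subset[OF p])
    also have "\<dots> \<le> integral {0..L} (\<lambda>x. \<bar>p x\<bar>)"
      using x by (intro integral_subset_le)
        (auto intro!: integrable_continuous_real continuous_intros continuous_on_subset[OF p])
    finally have "\<bar>w x\<bar>^2 \<le> (integral {0..L} (\<lambda>x. \<bar>p x\<bar>))^2" by (intro power_mono) auto
    also have "\<dots> \<le> L * integral {0..L} (\<lambda>x. \<bar>p x\<bar>^2)"
      by (intro integral_squared_le L continuous_intros p)
    finally show ?thesis by simp
  qed
  have "integral {0..L} (\<lambda>x. (w x)^2) \<le> integral {0..L} (\<lambda>x. L * integral {0..L} (\<lambda>x. (p x)^2))"
    by (intro integral_le * integrable_continuous_real continuous_intros w)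
  also have "\<dots> = L^2 * integral {0..L} (\<lambda>x. (p x)^2)" using L by (simp add: power2_eq_square)
  finally show ?thesis .
qed

lemma abs_product_le:
  fixes x y :: real
  shows "\<bar>2 * x * y\<bar> \<le> x^2 + y^2"
  using sum_squares_bound[of "\<bar>x\<bar>" "\<bar>y\<bar>"] by (simp add: abs_mult)

text \<open>The derivative 2 f f' of f^2 is dominated by f^2 + f'^2, so f(x)^2 differs from f(y)^2
  by at most the integral on the right. Averaging over y takes the place of a boundary value; this
  matters for u_x, which has no prescribed zero.\<close>

lemma sobolev:
  fixes f f' :: "real \<Rightarrow> real"
  assumes L: "0 < L" and f': "continuous_on {0..L} f'"
    and der: "\<And>x. x \<in> {0..L} \<Longrightarrow> (f has_real_derivative f' x) (at x within {0..L})"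
    and x: "x \<in> {0..L}"
  shows "(f x)^2 \<le> (1 / L + 1) * integral {0..L} (\<lambda>x. (f x)^2 + (f' x)^2)"
proof -
  have f: "continuous_on {0..L} f" by (rule DERIV_continuous_on[OF der])
  define I where "I = integral {0..L} (\<lambda>x. (f x)^2 + (f' x)^2)"
  have sq: "((\<lambda>x. (f x)^2) has_vector_derivative 2 * f x * f' x) (at x within {0..L})"
    if "x \<in> {0..L}" for x
    using DERIV_mult[OF der[OF that] der[OF that]]
    by (simp add: has_real_derivative_iff_has_vector_derivative power2_eq_square mult_ac)
  have le: "\<bar>integral {y..z} (\<lambda>x. 2 * f x * f' x)\<bar> \<le> I" if "y \<in> {0..L}" "z \<in> {0..L}" for y z
  proof -
    have c: "continuous_on {y..z} f" "continuous_on {y..z} f'"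
      using that by (auto intro: continuous_on_subset[OF f] continuous_on_subset[OF f'])
    have "norm (integral {y..z} (\<lambda>x. 2 * f x * f' x)) \<le> integral {y..z} (\<lambda>x. (f x)^2 + (f' x)^2)"
    proof (rule integral_norm_bound_integral)
      show "norm (2 * f x * f' x) \<le> (f x)^2 + (f' x)^2" for x
        using abs_product_le[of "f x" "f' x"] by simp
    qed (intro integrable_continuous_real continuous_intros c)+
    also have "\<dots> \<le> I" unfolding I_def
    proof (rule integral_subset_le)
      show "{y..z} \<subseteq> {0..L}" using that by auto
    qed (auto intro!: integrable_continuous_real continuous_intros c f f')
    finally show ?thesis by simp
  qed
  have *: "(f x)^2 \<le> (f y)^2 + I" if y: "y \<in> {0..L}" for y
  proof (cases "y \<le> x")
    case True
    have "((\<lambda>x. 2 * f x * f' x) has_integral ((f x)^2 - (f y)^2)) {y..x}"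
      using x y True by (intro fundamental_theorem_of_calculus)
          (auto intro!: has_vector_derivative_within_subset[OF sq])
    then show ?thesis using le[OF y x] by (simp add: has_integral_iff)
  next
    case False
    have "((\<lambda>x. 2 * f x * f' x) has_integral ((f y)^2 - (f x)^2)) {x..y}"
      using x y False by (intro fundamental_theorem_of_calculus)
          (auto intro!: has_vector_derivative_within_subset[OF sq])
    then show ?thesis using le[OF x y] by (simp add: has_integral_iff)
  qed
  have "integral {0..L} (\<lambda>y. (f x)^2) \<le> integral {0..L} (\<lambda>y. (f y)^2 + I)"
    by (intro integral_le * integrable_continuous_real continuous_intros f)
  also have "\<dots> = integral {0..L} (\<lambda>y. (f y)^2) + integral {0..L} (\<lambda>y. I)"
    by (intro integral_add integrable_continuous_real continuous_intros f)
  also have "integral {0..L} (\<lambda>y. (f y)^2) \<le> I"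
    unfolding I_def by (intro integral_le integrable_continuous_real continuous_intros f f') auto
  finally have "L * (f x)^2 \<le> (1 + L) * I" using L by (simp add: algebra_simps)
  then show ?thesis using L unfolding I_def by (simp add: field_simps)
qed

text \<open>The fractions in \<open>A\<close>, \<open>B\<close>, \<open>D\<close> arise when \<open>u\<^sub>x\<^sub>x\<close> is eliminated from the time-differentiated
  equation. The polynomial \<open>R\<close> is the part of \<open>P0 + P1\<close> that is kept in \<open>P0_P1_lower\<close>, where \<open>Z\<close>
  controls the second derivative of the stationary state.\<close>

lemma coefficient_bounds:
  fixes a k \<theta> s L Z :: real
  assumes a: "0 < a" and k: "0 < k" and ak: "8 \<le> a * k" and nn: "0 \<le> \<theta>" "0 \<le> Z" "0 < L"
    and s: "0 \<le> s" "s \<le> a"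
  defines "\<Phi> \<equiv> 4 * s + 2 * \<theta> * s + 14 * s^2 + 21/2 * \<theta> * s^2 + 9/4 * s * Z"
  defines "A \<equiv> \<theta> * s + 8 * s^2 + 12 * \<theta> * s^2 + 3 * s * Z + 21/10 * s * \<Phi> / (k * a^2)"
    and "B \<equiv> 4 * s + 16 * s^2 + 6 * \<theta> * s^2 + 21/5 * s / (k * a)^2"
    and "D \<equiv> 4 * s + 2 * \<theta> * s + 21/10 * s / (k * a^2)"
    and "R \<equiv> 24 * s + 16 * k * s + 40 * (1+k) * s^2 + (1+k) * (10 * \<theta> * s + 36 * \<theta> * s^2)
        + 5 * (k+1) * s * Z"
  shows "4 * k * s^2 + 8 * s^2 + 2 * s + 2 * B + a * (8 * k * s^2 + k * B + D) + 2 * L * A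
      + a * L * (k * A)
      \<le> 2 * R * ((1 + L^2) * (1 + a^2))"
    and "a^2 * (4 * k * s + 2 * k * D) + a * (8 * k * s^2 + k * B + D) + a * L * (k * A)
        \<le> 2 * R * ((1 + L^2) * (1 + a^2))"
proof -
  define J where "J = (1 + L^2) * (1 + a^2)"
  define A0 where "A0 = \<theta> * s + 8 * s^2 + 12 * \<theta> * s^2 + 3 * s * Z"
  define B0 where "B0 = 4 * s + 16 * s^2 + 6 * \<theta> * s^2"
  define D0 where "D0 = 4 * s + 2 * \<theta> * s"
  \<comment> \<open>The numbers \<open>\<sigma>\<close> \<le> 1 and \<open>u\<close> \<le> 1/8
    absorb the fractions in \<open>A\<close>, \<open>B\<close> and \<open>D\<close>, leaving
    polynomial terms with small numerical factors.\<close>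
  define \<sigma> where "\<sigma> = s / a"
  define u where "u = 1 / (a * k)"
  have u: "0 \<le> u" "u \<le> 1/8" using a k ak unfolding u_def by (auto simp: field_simps)
  have \<Phi>: "0 \<le> \<Phi>" unfolding \<Phi>_def using s nn by simp
  have AA: "A = A0 + 21/10 * u * \<sigma> * \<Phi>" using a k unfolding A_def A0_def u_def \<sigma>_def
      by (simp add: field_simps power2_eq_square)
  have akA: "a * L * (k * A) = a * L * (k * A0) + 21/10 * L * (\<sigma> * \<Phi>)"
    using a k unfolding A_def A0_def \<sigma>_def by (simp add: field_simps power2_eq_square)
  have BB: "B = B0 + 21/5 * s * u^2" unfolding B_def B0_def u_def
      by (simp add: power_divide mult.commute)
  have akB: "a * (k * B) = a * (k * B0) + 21/5 * s * u"
    using a k unfolding B_def B0_def u_def by (simp add: field_simps power2_eq_square)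
  have aD: "a * D = a * D0 + 21/10 * s * u"
      using a k unfolding D_def D0_def u_def by (simp add: field_simps power2_eq_square)
  have akD: "a^2 * (2 * k * D) = a^2 * (2 * k * D0) + 21/5 * s"
      using a k unfolding D_def D0_def by (simp add: field_simps)
  have sa: "0 \<le> \<sigma>" "\<sigma> \<le> 1" using s a unfolding \<sigma>_def by auto
  have 1: "21/10 * u * \<sigma> * \<Phi> \<le> 21/80 * \<Phi>"
  proof -
    have "u * \<sigma> \<le> 1/8 * 1" using u sa by (intro mult_mono) auto
    from mult_right_mono[OF this \<Phi>] have "u * \<sigma> * \<Phi> \<le> 1/8 * \<Phi>" by simp
    moreover have "21/10 * u * \<sigma> * \<Phi> = 21/10 * (u * \<sigma> * \<Phi>)" by (simp only: mult.assoc)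
    ultimately show ?thesis by linarith
  qed
  have 2: "\<sigma> * \<Phi> \<le> \<Phi>" using mult_right_mono[OF sa(2) \<Phi>] by simp
  have 3: "21/5 * s * u \<le> 21/40 * s" "21/10 * s * u \<le> 21/80 * s"
      using mult_left_mono[OF u(2) s(1)] by linarith+
  have 4: "21/5 * s * u^2 \<le> 21/320 * s"
  proof -
    have "u^2 \<le> (1/8)^2" using u by (intro power_mono)
    from mult_left_mono[OF this s(1)] show ?thesis by (simp add: power_divide)
  qed
  have nn0: "0 \<le> A0" "0 \<le> B0" "0 \<le> D0" unfolding A0_def B0_def D0_def using s nn by simp_all
  have la: "2 * a \<le> 1 + a^2" "2 * L \<le> 1 + L^2"
    using sum_squares_bound[of 1 a] sum_squares_bound[of 1 L] by simp_all
  have aL1: "1 \<le> 1 + a^2" "1 \<le> 1 + L^2" by simp_all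
  \<comment> \<open>The single weight \<open>J\<close> dominates 1, 2 a, 2 L, 4 a L and a^2, so it
    can replace every power of a and L standing in front of a polynomial in s.\<close>
  have J1: "1 \<le> J" unfolding J_def using mult_mono[OF aL1(2,1)] by simp
  have Ja: "2 * a \<le> J" unfolding J_def using mult_mono[OF aL1(2) la(1)] a by simp
  have JL: "2 * L \<le> J" unfolding J_def using mult_mono[OF la(2) aL1(1)] nn by simp
  have JaL: "4 * (a * L) \<le> J" unfolding J_def using mult_mono[OF la(2,1)] nn a
      by (simp add: mult_ac)
  have Jaa: "a^2 \<le> J" unfolding J_def using mult_mono[OF aL1(2), of "a^2" "1 + a^2"] by simp
  define W where "W = 8 * k * s^2 + k * B0 + D0"
  have W0: "0 \<le> W" unfolding W_def using s k nn0 by simp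
  have aW: "a * (8 * k * s^2 + k * B + D) \<le> a * W + 63/80 * s"
    using 3 akB aD unfolding W_def by (simp add: algebra_simps)
  have aWJ: "a * W \<le> J * W / 2" using mult_right_mono[OF Ja W0] by simp
  have LA: "2 * L * A \<le> J * (A0 + 21/80 * \<Phi>)"
  proof -
    have "2 * L * A \<le> 2 * L * (A0 + 21/80 * \<Phi>)"
        using 1 nn unfolding AA by (intro mult_left_mono) auto
    also have "\<dots> \<le> J * (A0 + 21/80 * \<Phi>)" using JL nn0 \<Phi> by (intro mult_right_mono) auto
    finally show ?thesis .
  qed
  have LkA: "a * L * (k * A) \<le> J * (k * A0 / 4 + 21/20 * \<Phi>)"
  proof -
    have "4 * (a * L) * (k * A0) \<le> J * (k * A0)" using JaL k nn0 by (intro mult_right_mono) auto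
    moreover have "2 * L * (\<sigma> * \<Phi>) \<le> J * \<Phi>" using JL 2 sa \<Phi> J1 by (intro mult_mono) auto
    ultimately show ?thesis unfolding akA by (simp add: algebra_simps)
  qed
  have one: "X \<le> J * X" if "0 \<le> X" for X using mult_right_mono[OF J1 that] by simp
  have p0: "0 \<le> k * s" "0 \<le> k * s^2" "0 \<le> s^2" "0 \<le> \<theta> * s" "0 \<le> \<theta> * s^2" "0 \<le> k * (\<theta> * s)"
      "0 \<le> k * (\<theta> * s^2)" "0 \<le> s * Z" "0 \<le> k * (s * Z)"
    using s k nn by simp_all
  have R2: "2 * R = 48 * s + 80 * s^2 + 32 * (k * s) + 80 * (k * s^2) + 20 * (\<theta> * s)
      + 72 * (\<theta> * s^2) + 20 * (k * (\<theta> * s)) + 72 * (k * (\<theta> * s^2)) + 10 * (s * Z) + 10 *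
      (k * (s * Z))"
    unfolding R_def by (simp add: algebra_simps)
  have "4 * k * s^2 + 8 * s^2 + 2 * s + 2 * B
      \<le> J * (4 * k * s^2 + 8 * s^2 + 2 * s + 2 * B0 + 21/160 * s)"
    using one[of "4 * k * s^2 + 8 * s^2 + 2 * s + 2 * B0 + 21/160 * s"] 4 s k nn0
        unfolding BB by simp
  moreover have "63/80 * s \<le> J * (63/80 * s)" using one[of "63/80 * s"] s by simp
  ultimately have "4 * k * s^2 + 8 * s^2 + 2 * s + 2 * B + a * (8 * k * s^2 + k * B + D) + 2 * L * A
      + a * L * (k * A)
    \<le> J * ((4 * k * s^2 + 8 * s^2 + 2 * s + 2 * B0 + 21/160 * s) + 63/80 * s + W/2 +
        (A0 + 21/80 * \<Phi>) + (k * A0/4 + 21/20 * \<Phi>))"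
    using aW aWJ LA LkA by (simp add: algebra_simps)
  \<comment> \<open>Both sides are now combinations of the same ten nonnegative monomials in s, k,
    \<theta> and Z, and the coefficients are compared one by one.\<close>
  also have "\<dots> \<le> J * (2 * R)"
  proof (rule mult_left_mono)
    have "(4 * k * s^2 + 8 * s^2 + 2 * s + 2 * B0 + 21/160 * s) + 63/80 * s + W/2 + (A0 + 21/80 * \<Phi>)
        + (k * A0/4 + 21/20 * \<Phi>)
      = 2907/160 * s + 531/8 * s^2 + 2 * (k * s) + 18 * (k * s^2) + 37/8 * (\<theta> * s) + 1209/32 *
          (\<theta> * s^2) + 1/4 * (k * (\<theta> * s)) + 6 * (k * (\<theta> * s^2)) + 381/64 * (s * Z) + 3/4 *
          (k * (s * Z))"
      unfolding W_def A0_def B0_def D0_def \<Phi>_def by (simp add: field_simps)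
    then show "(4 * k * s^2 + 8 * s^2 + 2 * s + 2 * B0 + 21/160 * s) + 63/80 * s + W/2
        + (A0 + 21/80 * \<Phi>) + (k * A0/4 + 21/20 * \<Phi>) \<le> 2 * R"
      unfolding R2 using s(1) p0 by linarith
  qed (use J1 in auto)
  finally show "4 * k * s^2 + 8 * s^2 + 2 * s + 2 * B + a * (8 * k * s^2 + k * B + D) + 2 * L * A
      + a * L * (k * A)
      \<le> 2 * R * ((1 + L^2) * (1 + a^2))" unfolding J_def by (simp only: mult_ac)
  have "a^2 * (4 * k * s + 2 * k * D0) \<le> J * (4 * k * s + 2 * k * D0)"
    using Jaa s k nn0 by (intro mult_right_mono) auto
  moreover have "63/80 * s + 21/5 * s \<le> J * (63/80 * s + 21/5 * s)"
      using one[of "63/80 * s+21/5 * s"] s by simp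
  moreover have "a^2 * (4 * k * s + 2 * k * D) = a^2 * (4 * k * s + 2 * k * D0) + 21/5 * s"
      using akD by (simp add: algebra_simps)
  ultimately have "a^2 * (4 * k * s + 2 * k * D) + a * (8 * k * s^2 + k * B + D) + a * L * (k * A)
    \<le> J * ((4 * k * s + 2 * k * D0) + (63/80 * s + 21/5 * s) + W/2 + (k * A0/4 + 21/20 * \<Phi>))"
    using aW aWJ LkA unfolding distrib_left by linarith
  also have "\<dots> \<le> J * (2 * R)"
  proof (rule mult_left_mono)
    have "(4 * k * s + 2 * k * D0) + (63/80 * s + 21/5 * s) + W/2 + (k * A0/4 + 21/20 * \<Phi>)
      = 179/16 * s + 147/10 * s^2 + 14 * (k * s) + 14 * (k * s^2) + 31/10 * (\<theta> * s) + 441/40 *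
          (\<theta> * s^2) + 17/4 * (k * (\<theta> * s)) + 6 * (k * (\<theta> * s^2)) + 189/80 * (s * Z) + 3/4 *
          (k * (s * Z))"
      unfolding W_def A0_def B0_def D0_def \<Phi>_def by (simp add: field_simps)
    then show "(4 * k * s + 2 * k * D0) + (63/80 * s + 21/5 * s) + W/2 + (k * A0/4 + 21/20 * \<Phi>)
        \<le> 2 * R"
      unfolding R2 using s(1) p0 by linarith
  qed (use J1 in auto)
  finally show "a^2 * (4 * k * s + 2 * k * D) + a * (8 * k * s^2 + k * B + D) + a * L * (k * A)
      \<le> 2 * R * ((1 + L^2) * (1 + a^2))"
    unfolding J_def by (simp only: mult_ac)
qed

section \<open>The energy identity\<close>

abbreviation cont_rect :: "real \<Rightarrow> real \<Rightarrow> (real \<Rightarrow> real \<Rightarrow> real) \<Rightarrow> bool" where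
  "cont_rect T L f \<equiv> continuous_on ({0..T} \<times> {0..L}) (\<lambda>z. f (fst z) (snd z))"

lemma cont_rect_slice:
  assumes "cont_rect T L f" "t \<in> {0..T}"
  shows "continuous_on {0..L} (f t)"
proof -
  have "continuous_on {0..L} ((\<lambda>z. f (fst z) (snd z)) \<circ> (\<lambda>x. (t, x)))"
    by (rule continuous_on_compose) (use assms in \<open>auto intro!: continuous_intros intro:
        continuous_on_subset\<close>)
  then show ?thesis by (simp add: o_def)
qed

lemma cont_rect_integral:
  fixes f :: "real \<Rightarrow> real \<Rightarrow> real"
  assumes "cont_rect T L f"
  shows "continuous_on {0..T} (\<lambda>t. integral {0..L} (f t))"
  using integral_continuous_on_param[of "{0..T}" 0 L f] assms by (simp add: split_beta)

lemma integral_rect_derivative: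
  fixes f ft :: "real \<Rightarrow> real \<Rightarrow> real"
  assumes "\<And>t x. t \<in> {0..T} \<Longrightarrow> x \<in> {0..L} \<Longrightarrow> ((\<lambda>t. f t x) has_real_derivative ft t x)
      (at t within {0..T})"
    and "cont_rect T L f" "cont_rect T L ft" "t \<in> {0..T}"
  shows "((\<lambda>t. integral {0..L} (f t)) has_real_derivative integral {0..L} (ft t))
      (at t within {0..T})"
proof (rule leibniz_rule_field_derivative[of "{0..T}" 0 L f ft t, unfolded cbox_interval])
  show "f t integrable_on {0..L}" if "t \<in> {0..T}" for t
    using cont_rect_slice[OF assms(2) that] by (rule integrable_continuous_real)
qed (use assms in \<open>auto simp: split_beta\<close>)

lemma edens_has_derivative:
  assumes "(b has_real_derivative bt) (at t within S)" "(p has_real_derivative m) (at t within S)"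
    "(q has_real_derivative r) (at t within S)"
  shows "((\<lambda>t. edens a k h (b t) (p t) (q t)) has_real_derivative
    (- 2 * k * b t * bt - 2 * h * bt) * (p t)^2 + 2 * (k * (a^2 - (b t)^2) - 2 * h * b t) * p t * m
      - 2 * h * (r * p t + q t * m) + 2 * k * q t * r) (at t within S)"
proof -
  have "((\<lambda>t. (k * (a^2 - b t * b t) - 2 * h * b t) * (p t * p t) - 2 * h * p t * q t
      + k * (q t * q t)) has_real_derivative
    (k * (0 - (bt * b t + bt * b t)) - 2 * h * bt) * (p t * p t) + (m * p t + m * p t) *
        (k * (a^2 - b t * b t) - 2 * h * b t)
     - (2 * h * m * q t + r * (2 * h * p t)) + k * (r * q t + r * q t)) (at t within S)"
    by (intro DERIV_add DERIV_diff DERIV_mult DERIV_cmult DERIV_const assms)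
  then show ?thesis unfolding edens_def power2_eq_square by (rule DERIV_cong) algebra
qed

lemma eflux_has_derivative:
  assumes "(b has_real_derivative bx) (at x within S)" "(p has_real_derivative n) (at x within S)"
    "(q has_real_derivative m) (at x within S)" "L \<noteq> 0"
  shows "((\<lambda>x. eflux a k (exp (- x / L)) (b x) (p x) (q x)) has_real_derivative
     2 * k * (- 2 * b x * bx * p x * q x + (a^2 - (b x)^2) * n * q x + (a^2 - (b x)^2) * p x * m
       - bx * (q x)^2 - 2 * b x * q x * m)
     + exp (- x / L) / L * ((q x)^2 + (a^2 - (b x)^2) * (p x)^2)
     - exp (- x / L) * (2 * q x * m - 2 * b x * bx * (p x)^2 + 2 * (a^2 - (b x)^2) * p x * n))
         (at x within S)"
proof -
  have e: "((\<lambda>x. exp (- x / L)) has_real_derivative - (exp (- x / L) * inverse L)) (at x within S)"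
    using assms(4) by (auto intro!: derivative_eq_intros simp: field_simps)
  have "((\<lambda>x. 2 * k * ((a^2 - b x * b x) * p x * q x - b x * (q x * q x))
      - exp (- x / L) * (q x * q x + (a^2 - b x * b x) * (p x * p x))) has_real_derivative
    2 * k * ((((0 - (bx * b x + bx * b x)) * p x + n * (a^2 - b x * b x)) * q x + m *
        ((a^2 - b x * b x) * p x))
        - (bx * (q x * q x) + (m * q x + m * q x) * b x))
    - (- (exp (- x / L) * inverse L) * (q x * q x + (a^2 - b x * b x) * (p x * p x))
        + ((m * q x + m * q x) + ((0 - (bx * b x + bx * b x)) * (p x * p x) + (n * p x + n * p x) *
            (a^2 - b x * b x))) * exp (- x / L))) (at x within S)"
    by (intro DERIV_add DERIV_diff DERIV_mult DERIV_cmult DERIV_const assms e)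
  then show ?thesis unfolding eflux_def power2_eq_square divide_inverse by (rule DERIV_cong) algebra
qed

text \<open>The left side is the time derivative from \<open>edens_has_derivative\<close>, the
  bracket on the right the space derivative from \<open>eflux_has_derivative\<close>. The letter
  \<open>m\<close> stands both for p_t and for q_x, which is where equality of the mixed derivatives
  enters.\<close>

lemma energy_identity:
  fixes a k L h b bt bx p q m n r g :: real
  assumes "r + 2 * b * m - (a^2 - b^2) * n = g"
  shows "(- 2 * k * b * bt - 2 * h * bt) * p^2 + 2 * (k * (a^2 - b^2) - 2 * h * b) * p * m
      - 2 * h * (r * p + q * m) + 2 * k * q * r
    = (2 * k * (- 2 * b * bx * p * q + (a^2 - b^2) * n * q + (a^2 - b^2) * p * m - bx * q^2 - 2 * b
        * q * m)
     + h / L * (q^2 + (a^2 - b^2) * p^2)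
     - h * (2 * q * m - 2 * b * bx * p^2 + 2 * (a^2 - b^2) * p * n)) + eprod a k L h b bt bx p q g"
  unfolding eprod_def assms[symmetric] divide_inverse by algebra

text \<open>The real \<open>d\<close> is a uniform error in the source; it is \<open>0\<close> for \<open>w = u\<close> and tends to \<open>0\<close>
  with the step for the difference quotients of \<open>u\<close>.\<close>

locale forced_wave =
  fixes a k L T s A B D d N R :: real and b bt bx w p q m n r g :: "real \<Rightarrow> real \<Rightarrow> real"
  assumes ak: "0 < a" "0 < k" "8 \<le> a * k" and LT: "0 < L" and s: "0 \<le> s"
    and ABD: "0 \<le> A" "0 \<le> B" "0 \<le> D" "0 \<le> d" and R: "0 \<le> R"
    and R1: "4 * k * s^2 + 8 * s^2 + 2 * s + 2 * B + a * (8 * k * s^2 + k * B + D) + 2 * L * A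
        + a * L * (k * A) \<le> 2 * R"
    and R2: "a^2 * (4 * k * s + 2 * k * D) + a * (8 * k * s^2 + k * B + D) + a * L * (k * A)
        \<le> 2 * R"
    and der: "\<And>t x. t \<in> {0..T} \<Longrightarrow> x \<in> {0..L}
        \<Longrightarrow> ((\<lambda>t. b t x) has_real_derivative bt t x) (at t within {0..T})"
      "\<And>t x. t \<in> {0..T} \<Longrightarrow> x \<in> {0..L} \<Longrightarrow> (b t has_real_derivative bx t x) (at x within {0..L})"
      "\<And>t x. t \<in> {0..T} \<Longrightarrow> x \<in> {0..L} \<Longrightarrow> (w t has_real_derivative p t x) (at x within {0..L})"
      "\<And>t x. t \<in> {0..T} \<Longrightarrow> x \<in> {0..L} \<Longrightarrow> ((\<lambda>t. p t x) has_real_derivative m t x) (at t within {0..T})"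
      "\<And>t x. t \<in> {0..T} \<Longrightarrow> x \<in> {0..L} \<Longrightarrow> (p t has_real_derivative n t x) (at x within {0..L})"
      "\<And>t x. t \<in> {0..T} \<Longrightarrow> x \<in> {0..L} \<Longrightarrow> ((\<lambda>t. q t x) has_real_derivative r t x) (at t within {0..T})"
      "\<And>t x. t \<in> {0..T} \<Longrightarrow> x \<in> {0..L} \<Longrightarrow> (q t has_real_derivative m t x) (at x within {0..L})"
    and cont: "cont_rect T L b" "cont_rect T L bt" "cont_rect T L bx" "cont_rect T L p"
        "cont_rect T L q"
      "cont_rect T L m" "cont_rect T L n" "cont_rect T L r"
    and eq: "\<And>t x. t \<in> {0..T} \<Longrightarrow> x \<in> {0..L} \<Longrightarrow>
        r t x + 2 * b t x * m t x - (a^2 - (b t x)^2) * n t x = g t x"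
    and bc: "\<And>t. t \<in> {0..T} \<Longrightarrow> p t 0 = k * q t 0" "\<And>t. t \<in> {0..T} \<Longrightarrow> w t L = 0"
      "\<And>t. t \<in> {0..T} \<Longrightarrow> q t L = 0"
    and b: "\<And>t x. t \<in> {0..T} \<Longrightarrow> x \<in> {0..L} \<Longrightarrow>
        0 \<le> b t x \<and> k * b t x \<le> 1 \<and> b t x \<le> 2 * s \<and> \<bar>bt t x\<bar> \<le> s \<and> \<bar>bx t x\<bar> \<le> 2 * s"
    and g: "\<And>t x. t \<in> {0..T} \<Longrightarrow> x \<in> {0..L} \<Longrightarrow>
        \<bar>g t x\<bar> \<le> A * \<bar>w t x\<bar> + B * \<bar>p t x\<bar> + D * \<bar>q t x\<bar> + d"
    and N: "\<And>t x. t \<in> {0..T} \<Longrightarrow> x \<in> {0..L} \<Longrightarrow> 2 * k * \<bar>q t x\<bar> + 2 * \<bar>p t x\<bar> \<le> N"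
begin

abbreviation "E \<equiv> \<lambda>t. integral {0..L} (\<lambda>x. edens a k (exp (- x / L)) (b t x) (p t x) (q t x))"

abbreviation "E' \<equiv> \<lambda>t. integral {0..L} (\<lambda>x. (- 2 * k * b t x * bt t x
    - 2 * exp (- x / L) * bt t x) * (p t x)^2
        + 2 * (k * (a^2 - (b t x)^2) - 2 * exp (- x / L) * b t x) * p t x * m t x
      - 2 * exp (- x / L) * (r t x * p t x + q t x * m t x) + 2 * k * q t x * r t x)"

text \<open>Integration of the balance law leaves boundary terms of good sign, the damping, and
  quadratic errors. After Poincare, \<open>R1\<close> bounds the coefficient of w_x^2 and
  \<open>R2\<close> bounds a^2 times the coefficient of w_t^2, so that the errors form a multiple of
  a^2 w_x^2 + w_t^2, which \<open>edens_lower\<close> controls.\<close>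

lemma energy_dissipation:
  assumes t: "t \<in> {0..T}"
  shows "(E has_real_derivative E' t) (at t within {0..T})"
    and "E' t \<le> - (7 / (8 * exp 1 * L * k) - 5 / 2 * R / (k * a^2)) * E t + L * N * d"
proof -
  define h where "h x = exp (- x / L)" for x
  have ch: "continuous_on ({0..T} \<times> {0..L}) (\<lambda>z. h (snd z))"
    unfolding h_def using LT by (auto intro!: continuous_intros)
  show "(E has_real_derivative E' t) (at t within {0..T})"
    unfolding h_def[symmetric]
  proof (rule integral_rect_derivative[OF _ _ _ t])
    show "cont_rect T L (\<lambda>t x. edens a k (h x) (b t x) (p t x) (q t x))"
      unfolding edens_def by (intro continuous_intros cont ch)
    show "cont_rect T L (\<lambda>t x. (- 2 * k * b t x * bt t x - 2 * h x * bt t x) * (p t x)^2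
        + 2 * (k * (a^2 - (b t x)^2) - 2 * h x * b t x) * p t x * m t x
      - 2 * h x * (r t x * p t x + q t x * m t x) + 2 * k * q t x * r t x)"
      by (intro continuous_intros cont ch)
  qed (use edens_has_derivative[OF der(1,4,6)] in blast)
  have h: "1 / exp 1 \<le> h x" "h x \<le> 1" "0 \<le> h x" if "x \<in> {0..L}" for x
  proof -
    have "x / L \<le> 1" using that LT by simp
    then have "exp (- 1) \<le> exp (- x / L)" by simp
    then show "1 / exp 1 \<le> h x" unfolding h_def by (simp add: exp_minus inverse_eq_divide)
  qed (use that LT in \<open>auto simp: h_def\<close>)
  have sl: "continuous_on {0..L} (b t)" "continuous_on {0..L} (bt t)" "continuous_on {0..L} (bx t)"
    "continuous_on {0..L} (p t)" "continuous_on {0..L} (q t)" "continuous_on {0..L} (m t)"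
    "continuous_on {0..L} (n t)" "continuous_on {0..L} (r t)" "continuous_on {0..L} h"
    using cont t LT by (auto intro: cont_rect_slice simp: h_def intro!: continuous_intros)
  have w: "continuous_on {0..L} (w t)" by (rule DERIV_continuous_on[OF der(3)[OF t]])
  define fx where "fx x = 2 * k * (- 2 * b t x * bx t x * p t x * q t x
      + (a^2 - (b t x)^2) * n t x * q t x
       + (a^2 - (b t x)^2) * p t x * m t x - bx t x * (q t x)^2 - 2 * b t x * q t x * m t x)
     + h x / L * ((q t x)^2 + (a^2 - (b t x)^2) * (p t x)^2)
     - h x * (2 * q t x * m t x - 2 * b t x * bx t x * (p t x)^2 + 2 * (a^2 - (b t x)^2) * p t x * n
         t x)" for x
  define f where "f x = eflux a k (h x) (b t x) (p t x) (q t x)" for x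
  have fx: "(fx has_integral (f L - f 0)) {0..L}"
    using LT eflux_has_derivative[OF der(2)[OF t] der(5)[OF t] der(7)[OF t]]
    unfolding f_def fx_def h_def
    by (intro fundamental_theorem_of_calculus)
        (auto simp: has_real_derivative_iff_has_vector_derivative)
  \<comment> \<open>Since w_t vanishes at \<open>L\<close>, only - h (a^2 - b^2) w_x^2 is left of
    the flux.\<close>
  have fL: "f L \<le> 0"
  proof -
    have "L \<in> {0..L}" using LT by simp
    note bL = b[OF t this] and hL = h(3)[OF this]
    have "0 \<le> a^2 - (b t L)^2"
      using speed_bound(3)[OF ak, of "b t L"] bL zero_le_power2[of a] by linarith
    with hL show ?thesis unfolding f_def eflux_def bc(3)[OF t] by simp
  qed
  \<comment> \<open>With w_x = k w_t and h = 1 the flux at 0 equals ((a k)^2 - (1 + k b)^2) w_t^2,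
    where a k \<ge> 8 and 1 + k b \<le> 2.\<close>
  have f0: "0 \<le> f 0"
  proof -
    define y where "y = b t 0"
    have y: "0 \<le> y" "k * y \<le> 1" using b[OF t, of 0] LT unfolding y_def by auto
    have "(1 + k * y)^2 \<le> 2^2" using y ak by (intro power_mono) auto
    moreover have "8^2 \<le> (a * k)^2" using ak by (intro power_mono) auto
    ultimately have "1 + 2 * k * y \<le> k^2 * (a^2 - y^2)"
        by (simp add: algebra_simps power2_eq_square)
    then have "0 \<le> (k^2 * (a^2 - y^2) - (1 + 2 * k * y)) * (q t 0)^2" by simp
    also have "\<dots> = f 0" unfolding f_def eflux_def h_def bc(1)[OF t] y_def[symmetric]
        by (simp add: algebra_simps power2_eq_square)
    finally show ?thesis .
  qed
  define \<alpha> where "\<alpha> = 4 * k * s^2 + 8 * s^2 + 2 * s + 2 * B + a * (8 * k * s^2 + k * B + D) + L * A"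
  define \<beta> where "\<beta> = 4 * k * s + 2 * k * D + (8 * k * s^2 + k * B + D) / a + L / a * (k * A)"
  define \<omega> where "\<omega> = A / L + a / L * (k * A)"
  define \<rho> where "\<rho> = 7 / (8 * exp 1 * L * k)"
  define ed where "ed x = edens a k (h x) (b t x) (p t x) (q t x)" for x
  have pw: "(- 2 * k * b t x * bt t x - 2 * h x * bt t x) * (p t x)^2
        + 2 * (k * (a^2 - (b t x)^2) - 2 * h x * b t x) * p t x * m t x
      - 2 * h x * (r t x * p t x + q t x * m t x) + 2 * k * q t x * r t x
      \<le> fx x + (- \<rho> * ed x + \<alpha> * (p t x)^2 + \<beta> * (q t x)^2 + \<omega> * (w t x)^2 + N * d)" (is "?l x \<le> ?u
          x")
    if x: "x \<in> {0..L}" for x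
  proof -
    note bb = b[OF t x]
    have "eprod a k L (h x) (b t x) (bt t x) (bx t x) (p t x) (q t x) (g t x) \<le>
      - (h x / L) * ((q t x)^2 + (a^2 - (b t x)^2) * (p t x)^2)
     + \<alpha> * (p t x)^2 + \<beta> * (q t x)^2 + \<omega> * (w t x)^2 + N * d"
      unfolding \<alpha>_def \<beta>_def \<omega>_def
      by (rule eprod_bound[OF ak(1,2) LT h(3,2)[OF x] s ABD _ _ _ _ g[OF t x] N[OF t x]])
          (use bb in auto)
    moreover have "\<rho> * ed x \<le> h x / L * ((q t x)^2 + (a^2 - (b t x)^2) * (p t x)^2)"
      unfolding \<rho>_def ed_def by (rule dissipation_bound[OF ak _ _ h(1,2)[OF x] LT]) (use bb in auto)
    ultimately show ?thesis
      unfolding fx_def energy_identity[OF eq[OF t x], of k "bt t x" "h x" "p t x" "q t x"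
          "bx t x" L]
      by linarith
  qed
  define P2 where "P2 = integral {0..L} (\<lambda>x. (p t x)^2)"
  define Q2 where "Q2 = integral {0..L} (\<lambda>x. (q t x)^2)"
  define W2 where "W2 = integral {0..L} (\<lambda>x. (w t x)^2)"
  have Et: "E t = integral {0..L} ed" unfolding ed_def h_def ..
  have ed: "(ed has_integral E t) {0..L}"
    unfolding Et by (rule integrable_integral, unfold ed_def edens_def)
        (intro integrable_continuous_real continuous_intros sl)
  have sq: "((\<lambda>x. (p t x)^2) has_integral P2) {0..L}" "((\<lambda>x. (q t x)^2) has_integral Q2) {0..L}"
    "((\<lambda>x. (w t x)^2) has_integral W2) {0..L}"
    unfolding P2_def Q2_def W2_def by (intro integrable_integral integrable_continuous_real
        continuous_intros sl w)+
  have cN: "((\<lambda>x. N * d) has_integral (L * (N * d))) {0..L}"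
    using has_integral_const_real[of "N * d" 0 L] LT by simp
  have u: "(?u has_integral (f L - f 0 + (- \<rho> * E t + \<alpha> * P2 + \<beta> * Q2 + \<omega> * W2
      + L * (N * d)))) {0..L}"
    by (intro has_integral_add fx has_integral_mult_right ed sq cN)
  have l: "(?l has_integral E' t) {0..L}"
    unfolding h_def[symmetric] by (rule integrable_integral)
        (intro integrable_continuous_real continuous_intros sl)
  have "E' t \<le> f L - f 0 + (- \<rho> * E t + \<alpha> * P2 + \<beta> * Q2 + \<omega> * W2 + L * (N * d))"
    by (rule has_integral_le[OF l u pw])
  \<comment> \<open>The energy does not contain w itself; the zero of w at \<open>L\<close> allows
    w^2 to be traded for w_x^2.\<close>
  also have "\<omega> * W2 \<le> \<omega> * (L^2 * P2)"
  proof (rule mult_left_mono)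
    show "W2 \<le> L^2 * P2" unfolding W2_def P2_def
      by (rule poincare[OF LT sl(4) der(3)[OF t] bc(2)[OF t]])
    show "0 \<le> \<omega>" unfolding \<omega>_def using ABD ak LT by simp
  qed
  also have "f L - f 0 + (- \<rho> * E t + \<alpha> * P2 + \<beta> * Q2 + \<omega> * (L^2 * P2) + L * (N * d))
      \<le> - \<rho> * E t + ((\<alpha> + \<omega> * L^2) * P2 + \<beta> * Q2) + L * N * d"
    using fL f0 by (simp add: algebra_simps)
  also have "(\<alpha> + \<omega> * L^2) * P2 + \<beta> * Q2 \<le> 2 * R * P2 + 2 * R / a^2 * Q2"
  proof (intro add_mono mult_right_mono)
    have "\<omega> * L^2 = L * A + a * L * (k * A)"
        using LT unfolding \<omega>_def by (simp add: field_simps power2_eq_square)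
    then show "\<alpha> + \<omega> * L^2 \<le> 2 * R" using R1 unfolding \<alpha>_def by linarith
    have "\<beta> = (a^2 * (4 * k * s + 2 * k * D) + a * (8 * k * s^2 + k * B + D)
        + a * L * (k * A)) / a^2"
      unfolding \<beta>_def using ak by (simp add: field_simps power2_eq_square)
    also have "\<dots> \<le> 2 * R / a^2" using R2 by (rule divide_right_mono) simp
    finally show "\<beta> \<le> 2 * R / a^2" .
    show "0 \<le> P2" "0 \<le> Q2" using sq by (auto intro: has_integral_nonneg)
  qed
  also have "2 * R * P2 + 2 * R / a^2 * Q2 \<le> 5 / 2 * R / (k * a^2) * E t"
  proof -
    have "((\<lambda>x. 53 / 64 * k * (a^2 * (p t x)^2 + (q t x)^2)) has_integral (53 / 64 * k * (a^2 * P2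
        + Q2))) {0..L}"
      by (intro has_integral_mult_right has_integral_add sq)
    then have "53 / 64 * k * (a^2 * P2 + Q2) \<le> E t"
    proof (rule has_integral_le[OF _ ed])
      show "53 / 64 * k * (a^2 * (p t x)^2 + (q t x)^2) \<le> ed x" if x: "x \<in> {0..L}" for x
        unfolding ed_def by (rule edens_lower[OF ak _ _ h(3,2)[OF x]]) (use b[OF t x] in auto)
    qed
    moreover have "0 \<le> P2" "0 \<le> Q2" using sq by (auto intro: has_integral_nonneg)
    then have "0 \<le> k * (a^2 * P2 + Q2)" using ak by simp
    \<comment> \<open>Rounding 53/64 down to 4/5 is what turns \<open>2 * R\<close> into
      \<open>5 / 2 * R\<close>.\<close>
    ultimately have "4 / 5 * (k * (a^2 * P2 + Q2)) \<le> E t" by linarith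
    then have "5 / 2 * R / (k * a^2) * (4 / 5 * (k * (a^2 * P2 + Q2)))
        \<le> 5 / 2 * R / (k * a^2) * E t"
      using R ak by (intro mult_left_mono) auto
    moreover have "5 / 2 * R / (k * a^2) * (4 / 5 * (k * (a^2 * P2 + Q2))) = 2 * R * P2
        + 2 * R / a^2 * Q2"
      using ak by (simp add: field_simps)
    ultimately show ?thesis by linarith
  qed
  finally show "E' t \<le> - (7 / (8 * exp 1 * L * k) - 5 / 2 * R / (k * a^2)) * E t + L * N * d"
    unfolding \<rho>_def by (simp add: algebra_simps)
qed

lemma energy_decay:
  assumes t: "t \<in> {0..T}"
    and \<mu>: "0 < \<mu>" "\<mu> \<le> 7 / (8 * exp 1 * L * k) - 5 / 2 * R / (k * a^2)"
  shows "E t \<le> exp (- \<mu> * t) * E 0 + L * N * d / \<mu>"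
proof -
  \<comment> \<open>Nonnegativity is what permits replacing the full rate by the smaller
    \<open>\<mu>\<close> in the differential inequality.\<close>
  have E0: "0 \<le> E t" if t: "t \<in> {0..T}" for t
  proof (rule integral_nonneg)
    define h where "h x = exp (- x / L)" for x
    have "continuous_on {0..L} h" unfolding h_def using LT by (auto intro!: continuous_intros)
    then show "(\<lambda>x. edens a k (exp (- x / L)) (b t x) (p t x) (q t x)) integrable_on {0..L}"
      unfolding edens_def h_def[symmetric]
      by (intro integrable_continuous_real continuous_intros cont_rect_slice[OF cont(1) t]
        cont_rect_slice[OF cont(4) t] cont_rect_slice[OF cont(5) t])
    show "0 \<le> edens a k (exp (- x / L)) (b t x) (p t x) (q t x)" if x: "x \<in> {0..L}" for x
    proof -
      have "0 \<le> 53 / 64 * k * (a^2 * (p t x)^2 + (q t x)^2)" using ak by simp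
      also have "\<dots> \<le> edens a k (exp (- x / L)) (b t x) (p t x) (q t x)"
        by (rule edens_lower[OF ak]) (use LT b[OF t x] x in auto)
      finally show ?thesis .
    qed
  qed
  have "0 \<le> 2 * k * \<bar>q t 0\<bar> + 2 * \<bar>p t 0\<bar>" using ak by simp
  also have "\<dots> \<le> N" using N[OF t, of 0] LT by simp
  finally have "0 \<le> N" .
  show ?thesis
  proof (rule gronwall_decay)
    show "E' t \<le> - \<mu> * E t + L * N * d" if "t \<in> {0..T}" for t
      using energy_dissipation(2)[OF that] mult_right_mono[OF \<mu>(2) E0[OF that]] by linarith
    show "0 \<le> L * N * d" using LT \<open>0 \<le> N\<close> ABD by simp
    show "(E has_real_derivative E' t) (at t within {0..T})" if "t \<in> {0..T}" for t
      by (rule energy_dissipation(1)[OF that])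
  qed (use t \<mu> in auto)
qed

end

section \<open>The source term\<close>

text \<open>The right-hand side \<open>Frhs\<close> after its last term has been rewritten with the equation of the
  stationary state \<open>v\<close>.\<close>

definition src :: "real \<Rightarrow> real \<Rightarrow> real \<Rightarrow> real \<Rightarrow> real \<Rightarrow> real \<Rightarrow> real \<Rightarrow> real" where
  "src \<theta> v v' v'' u p r = - 2 * r * (p + v') - \<theta> * (v + u) * r
      - 2 * ((v + u) * (p + v')^2 - v * v'^2)
     - 3/2 * \<theta> * ((v + u)^2 * (p + v') - v^2 * v') - u * (2 * v + u) * v''"

definition src_t :: "real \<Rightarrow> real \<Rightarrow> real \<Rightarrow> real \<Rightarrow> real \<Rightarrow> real \<Rightarrow> real \<Rightarrow> real \<Rightarrow> real \<Rightarrow> real" where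
  "src_t \<theta> v v' v'' u p r m rt = - 2 * rt * (p + v') - 2 * r * m - \<theta> * r * r - \<theta> * (v + u) * rt
     - 2 * (r * (p + v')^2 + 2 * (v + u) * (p + v') * m)
     - 3/2 * \<theta> * (2 * (v + u) * r * (p + v') + (v + u)^2 * m) - 2 * (v + u) * r * v''"

lemma src_has_derivative:
  assumes "(u has_real_derivative r t) (at t within S)" "(p has_real_derivative m) (at t within S)"
    "(r has_real_derivative rt) (at t within S)"
  shows "((\<lambda>t. src \<theta> v v' v'' (u t) (p t) (r t)) has_real_derivative
    src_t \<theta> v v' v'' (u t) (p t) (r t) m rt) (at t within S)"
proof -
  have "((\<lambda>t. - 2 * r t * (p t + v') - \<theta> * (v + u t) * r t
      - 2 * ((v + u t) * ((p t + v') * (p t + v')) - v * v'^2)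
     - 3/2 * \<theta> * ((v + u t) * (v + u t) * (p t + v') - v^2 * v') - u t * (2 * v + u t) * v'')
         has_real_derivative
   ((- 2 * rt) * (p t + v') + (m + 0) * (- 2 * r t) - (\<theta> * (0 + r t) * r t + rt * (\<theta> * (v + u t)))
    - 2 * ((0 + r t) * ((p t + v') * (p t + v')) + ((m + 0) * (p t + v') + (m + 0) * (p t + v')) *
        (v + u t) - 0)
    - 3/2 * \<theta> * (((0 + r t) * (v + u t) + (0 + r t) * (v + u t)) * (p t + v') + (m + 0) *
        ((v + u t) * (v + u t)) - 0)
    - ((r t * (2 * v + u t) + (0 + r t) * u t) * v''))) (at t within S)"
    by (intro DERIV_add DERIV_diff DERIV_mult DERIV_cmult DERIV_cmult_right DERIV_const assms)
  then show ?thesis unfolding src_def src_t_def power2_eq_square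
    by (rule DERIV_cong) algebra
qed

text \<open>The source vanishes for u = p = r = 0, because the contribution of the stationary state
  was subtracted. Hence it splits into multiples of u, p and r, and each of the three coefficients
  is small with s.\<close>

lemma src_decomposition:
  "src \<theta> v v' v'' u p r = - r * (2 * (p + v') + \<theta> * (v + u))
     - u * (2 * (p + v')^2 + 3/2 * \<theta> * (2 * v + u) * (p + v') + (2 * v + u) * v'')
     - p * (2 * v * (p + 2 * v') + 3/2 * \<theta> * v^2)"
  unfolding src_def by (simp add: field_simps power2_eq_square)

lemma abs_mult_le:
  fixes x y c d :: real
  assumes "\<bar>x\<bar> \<le> c" "\<bar>y\<bar> \<le> d"
  shows "\<bar>x * y\<bar> \<le> c * d"
  using mult_mono[OF assms] assms by (simp add: abs_mult)

lemma abs_mult_le_right: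
  fixes x y d :: real
  assumes "\<bar>y\<bar> \<le> d"
  shows "\<bar>x * y\<bar> \<le> d * \<bar>x\<bar>"
  using abs_mult_le[OF order_refl assms, of x] by (simp only: mult.commute[of d])

lemma abs_triangle3:
  fixes x y z :: real
  assumes "\<bar>x\<bar> \<le> A" "\<bar>y\<bar> \<le> B" "\<bar>z\<bar> \<le> C"
  shows "\<bar>- x - y - z\<bar> \<le> B + C + A"
  using assms by linarith

lemma abs_lincomb3:
  fixes x y z :: real
  assumes "\<bar>x\<bar> \<le> A" "\<bar>y\<bar> \<le> B" "\<bar>z\<bar> \<le> C" "0 \<le> c1" "0 \<le> c2" "0 \<le> c3"
  shows "\<bar>c1 * x + c2 * y + c3 * z\<bar> \<le> c1 * A + c2 * B + c3 * C"
proof -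
  have "\<bar>c1 * x\<bar> \<le> c1 * A" "\<bar>c2 * y\<bar> \<le> c2 * B" "\<bar>c3 * z\<bar> \<le> c3 * C"
    using assms by (simp_all add: abs_mult mult_left_mono)
  then show ?thesis by linarith
qed

lemma src_bound:
  fixes \<theta> s Z v v' v'' u p r :: real
  assumes \<theta>: "0 \<le> \<theta>" and b: "\<bar>v\<bar> \<le> s" "\<bar>v'\<bar> \<le> s" "\<bar>v''\<bar> \<le> 3/4 * Z" "\<bar>u\<bar> \<le> s" "\<bar>p\<bar> \<le> s"
  shows "\<bar>src \<theta> v v' v'' u p r\<bar> \<le> (8 * s^2 + 9 * \<theta> * s^2 + 9/4 * s * Z) * \<bar>u\<bar>
      + (6 * s^2 + 3/2 * \<theta> * s^2) * \<bar>p\<bar>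
     + (4 * s + 2 * \<theta> * s) * \<bar>r\<bar>"
proof -
  have 1: "\<bar>p + v'\<bar> \<le> 2 * s" "\<bar>v + u\<bar> \<le> 2 * s" "\<bar>2 * v + u\<bar> \<le> 3 * s" "\<bar>p + 2 * v'\<bar> \<le> 3 * s"
      using b by linarith+
  note m = abs_mult_le
  have r: "\<bar>2 * (p + v') + \<theta> * (v + u)\<bar> \<le> 4 * s + 2 * \<theta> * s"
    using 1(1) m[OF _ 1(2), of \<theta> \<theta>] \<theta> by (simp add: mult_ac)
  have u: "\<bar>2 * (p + v')^2 + 3/2 * \<theta> * (2 * v + u) * (p + v') + (2 * v + u) * v''\<bar> \<le> 8 * s^2
      + 9 * \<theta> * s^2 + 9/4 * s * Z"
  proof -
    have "\<bar>(p + v') * (p + v')\<bar> \<le> 2 * s * (2 * s)" by (rule m[OF 1(1,1)])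
    moreover have "\<bar>\<theta> * ((2 * v + u) * (p + v'))\<bar> \<le> \<theta> * (3 * s * (2 * s))"
        by (rule m[OF _ m[OF 1(3,1)]]) (use \<theta> in simp)
    moreover have "\<bar>(2 * v + u) * v''\<bar> \<le> 3 * s * (3/4 * Z)" by (rule m[OF 1(3) b(3)])
    moreover have "2 * (p + v')^2 + 3/2 * \<theta> * (2 * v + u) * (p + v') + (2 * v + u) * v''
       = 2 * ((p + v') * (p + v')) + 3/2 * (\<theta> * ((2 * v + u) * (p + v'))) + (2 * v + u) * v''"
      by (simp add: power2_eq_square)
    moreover have "8 * s^2 + 9 * \<theta> * s^2 + 9/4 * s * Z = 2 * (2 * s * (2 * s))
        + 3/2 * (\<theta> * (3 * s * (2 * s))) + 3 * s * (3/4 * Z)"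
      by (simp add: power2_eq_square)
    ultimately show ?thesis by linarith
  qed
  have p: "\<bar>2 * v * (p + 2 * v') + 3/2 * \<theta> * v^2\<bar> \<le> 6 * s^2 + 3/2 * \<theta> * s^2"
  proof -
    have "\<bar>v * (p + 2 * v')\<bar> \<le> s * (3 * s)" by (rule m[OF b(1) 1(4)])
    moreover have "\<bar>\<theta> * (v * v)\<bar> \<le> \<theta> * (s * s)" by (rule m[OF _ m[OF b(1,1)]]) (use \<theta> in simp)
    moreover have "2 * v * (p + 2 * v') + 3/2 * \<theta> * v^2 = 2 * (v * (p + 2 * v'))
        + 3/2 * (\<theta> * (v * v))"
      by (simp add: power2_eq_square)
    moreover have "6 * s^2 + 3/2 * \<theta> * s^2 = 2 * (s * (3 * s)) + 3/2 * (\<theta> * (s * s))"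
        by (simp add: power2_eq_square)
    ultimately show ?thesis by linarith
  qed
  show ?thesis
    using abs_triangle3[OF abs_mult_le_right[OF r, of r] abs_mult_le_right[OF u, of u]
        abs_mult_le_right[OF p, of p]]
    unfolding src_decomposition by simp
qed

text \<open>The subtracted \<open>2 * r * m\<close> is the term 2 b_t u_tx that differentiation of 2
  b u_tx in time moves to the right-hand side. It adds to the same product inside
  \<open>src_t\<close>, whence the 4 in front of \<open>r\<close> in the coefficient of
  \<open>m\<close>.\<close>

lemma src_t_bound:
  fixes \<theta> s Z v v' v'' u p r m rt :: real
  assumes \<theta>: "0 \<le> \<theta>" and b: "\<bar>v\<bar> \<le> s" "\<bar>v'\<bar> \<le> s" "\<bar>v''\<bar> \<le> 3/4 * Z" "\<bar>u\<bar> \<le> s" "\<bar>p\<bar> \<le> s" "\<bar>r\<bar> \<le> s"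
  shows "\<bar>src_t \<theta> v v' v'' u p r m rt - 2 * r * m\<bar>
      \<le> (\<theta> * s + 8 * s^2 + 12 * \<theta> * s^2 + 3 * s * Z) * \<bar>r\<bar>
     + (4 * s + 16 * s^2 + 6 * \<theta> * s^2) * \<bar>m\<bar> + (4 * s + 2 * \<theta> * s) * \<bar>rt\<bar>"
proof -
  have 1: "\<bar>p + v'\<bar> \<le> 2 * s" "\<bar>v + u\<bar> \<le> 2 * s" using b by linarith+
  note mm = abs_mult_le
  have t: "\<bar>\<theta>\<bar> \<le> \<theta>" using \<theta> by simp
  have pp: "\<bar>(p + v') * (p + v')\<bar> \<le> 2 * s * (2 * s)" by (rule mm[OF 1(1,1)])
  have bp: "\<bar>(v + u) * (p + v')\<bar> \<le> 2 * s * (2 * s)" by (rule mm[OF 1(2,1)])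
  have bb: "\<bar>(v + u) * (v + u)\<bar> \<le> 2 * s * (2 * s)" by (rule mm[OF 1(2,2)])
  have rt: "\<bar>2 * (p + v') + \<theta> * (v + u)\<bar> \<le> 4 * s + 2 * \<theta> * s"
    using 1(1) mm[OF t 1(2)] by (simp add: mult_ac)
  have m: "\<bar>4 * r + 4 * (v + u) * (p + v') + 3/2 * \<theta> * (v + u)^2\<bar> \<le> 4 * s + 16 * s^2 + 6 * \<theta> * s^2"
  proof -
    have "4 * r + 4 * (v + u) * (p + v') + 3/2 * \<theta> * (v + u)^2
      = 4 * r + 4 * ((v + u) * (p + v')) + 3/2 * (\<theta> * ((v + u) * (v + u)))"
      by (simp add: power2_eq_square mult.assoc)
    moreover have "4 * s + 16 * s^2 + 6 * \<theta> * s^2 = 4 * s + 4 * (2 * s * (2 * s))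
        + 3/2 * (\<theta> * (2 * s * (2 * s)))"
      by (simp add: power2_eq_square)
    ultimately show ?thesis
      using abs_lincomb3[OF b(6) bp mm[OF t bb], of 4 4 "3/2"] by simp
  qed
  have r: "\<bar>\<theta> * r + 2 * (p + v')^2 + 3 * \<theta> * (v + u) * (p + v') + 2 * (v + u) * v''\<bar>
      \<le> \<theta> * s + 8 * s^2 + 12 * \<theta> * s^2 + 3 * s * Z"
  proof -
    have "\<bar>2 * ((p + v') * (p + v')) + 3 * (\<theta> * ((v + u) * (p + v'))) + 2 * ((v + u) * v'')\<bar>
       \<le> 2 * (2 * s * (2 * s)) + 3 * (\<theta> * (2 * s * (2 * s))) + 2 * (2 * s * (3/4 * Z))"
      by (rule abs_lincomb3[OF pp mm[OF t bp] mm[OF 1(2) b(3)]]) simp_all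
    from abs_lincomb3[OF mm[OF t b(6)] this, of 0 0 1 1 0]
    have "\<bar>\<theta> * r + (2 * ((p + v') * (p + v')) + 3 * (\<theta> * ((v + u) * (p + v')))
        + 2 * ((v + u) * v''))\<bar>
      \<le> \<theta> * s + (2 * (2 * s * (2 * s)) + 3 * (\<theta> * (2 * s * (2 * s))) + 2 * (2 * s * (3/4 * Z)))" by
          simp
    moreover have "\<theta> * r + 2 * (p + v')^2 + 3 * \<theta> * (v + u) * (p + v') + 2 * (v + u) * v''
      = \<theta> * r + (2 * ((p + v') * (p + v')) + 3 * (\<theta> * ((v + u) * (p + v'))) + 2 * ((v + u) * v''))"
      by (simp add: power2_eq_square)
    moreover have "\<theta> * s + 8 * s^2 + 12 * \<theta> * s^2 + 3 * s * Z
      = \<theta> * s + (2 * (2 * s * (2 * s)) + 3 * (\<theta> * (2 * s * (2 * s))) + 2 * (2 * s * (3/4 * Z)))"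
      by (simp add: power2_eq_square)
    ultimately show ?thesis by presburger
  qed
  have "src_t \<theta> v v' v'' u p r m rt - 2 * r * m = - (rt * (2 * (p + v') + \<theta> * (v + u)))
     - m * (4 * r + 4 * (v + u) * (p + v') + 3/2 * \<theta> * (v + u)^2)
     - r * (\<theta> * r + 2 * (p + v')^2 + 3 * \<theta> * (v + u) * (p + v') + 2 * (v + u) * v'')"
    unfolding src_t_def by algebra
  then show ?thesis
    using abs_triangle3[OF abs_mult_le_right[OF rt, of rt] abs_mult_le_right[OF m, of m]
        abs_mult_le_right[OF r, of r]]
    by (simp only: add.commute[of "(4 * s + 16 * s^2 + 6 * \<theta> * s^2) * \<bar>m\<bar>"])
qed

text \<open>The last term on the left is c_t u_xx with c = a^2 - (v + u)^2. The equation writes c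
  u_xx through u_tt, u_tx and the source; the quotient (v + u) / c is of order 1 / (k a^2). In the
  products with u_tt and u_tx the factor \<bar>r\<bar> is bounded by s, whereas in the product with
  the source it is the source that is bounded, by \<open>s * \<Phi>\<close>, so that \<bar>r\<bar>
  survives and the estimate stays linear.\<close>

lemma differentiated_source_bound:
  fixes a k \<theta> s Z v v' v'' u p r m rt n :: real
  assumes ak: "0 < a" "0 < k" "8 \<le> a * k" and \<theta>: "0 \<le> \<theta>"
    and b: "\<bar>v\<bar> \<le> s" "\<bar>v'\<bar> \<le> s" "\<bar>v''\<bar> \<le> 3/4 * Z" "\<bar>u\<bar> \<le> s" "\<bar>p\<bar> \<le> s" "\<bar>r\<bar> \<le> s"
    and vu: "0 \<le> v + u" "k * (v + u) \<le> 1"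
    and eq: "rt + 2 * (v + u) * m - (a^2 - (v + u)^2) * n = src \<theta> v v' v'' u p r"
  defines "\<Phi> \<equiv> 4 * s + 2 * \<theta> * s + 14 * s^2 + 21/2 * \<theta> * s^2 + 9/4 * s * Z"
  shows "\<bar>src_t \<theta> v v' v'' u p r m rt - 2 * r * m - 2 * (v + u) * r * n\<bar>
    \<le> (\<theta> * s + 8 * s^2 + 12 * \<theta> * s^2 + 3 * s * Z + 21/10 * s * \<Phi> / (k * a^2)) * \<bar>r\<bar>
     + (4 * s + 16 * s^2 + 6 * \<theta> * s^2 + 21/5 * s / (k * a)^2) * \<bar>m\<bar>
     + (4 * s + 2 * \<theta> * s + 21/10 * s / (k * a^2)) * \<bar>rt\<bar>"
proof -
  define \<beta> where "\<beta> = v + u"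
  define c where "c = a^2 - \<beta>^2"
  define F where "F = src \<theta> v v' v'' u p r"
  have bb: "0 \<le> \<beta>" "k * \<beta> \<le> 1" using vu unfolding \<beta>_def by auto
  have c: "63/64 * a^2 \<le> c" unfolding c_def by (rule speed_bound(3)[OF ak bb])
  have a2: "0 < a^2" using ak by simp
  have c0: "0 < c" using c a2 by linarith
  have s0: "0 \<le> s" using b(1) by linarith
  have Z0: "0 \<le> Z" using b(3) by linarith
  have \<Phi>0: "0 \<le> \<Phi>" unfolding \<Phi>_def using s0 Z0 \<theta> by simp
  have F: "\<bar>F\<bar> \<le> s * \<Phi>" 
  proof -
    have "\<bar>F\<bar> \<le> (8 * s^2 + 9 * \<theta> * s^2 + 9/4 * s * Z) * \<bar>u\<bar> + (6 * s^2 + 3/2 * \<theta> * s^2) * \<bar>p\<bar>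
        + (4 * s + 2 * \<theta> * s) * \<bar>r\<bar>"
      unfolding F_def by (rule src_bound[OF \<theta> b(1-5)])
    also have "\<dots> \<le> (8 * s^2 + 9 * \<theta> * s^2 + 9/4 * s * Z) * s + (6 * s^2 + 3/2 * \<theta> * s^2) * s
        + (4 * s + 2 * \<theta> * s) * s"
      by (intro add_mono mult_left_mono b(4-6) add_nonneg_nonneg mult_nonneg_nonneg zero_le_power2 \<theta>
          s0 Z0) simp_all
    also have "\<dots> = s * \<Phi>" unfolding \<Phi>_def by (simp add: field_simps)
    finally show ?thesis .
  qed
  have n: "c * n = rt + 2 * \<beta> * m - F" using eq unfolding c_def \<beta>_def F_def by simp
  have \<beta>c: "\<beta> / c \<le> 64/63 / (k * a^2)"
  proof -
    have "\<beta> * (k * a^2) = (k * \<beta>) * a^2" by simp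
    also have "\<dots> \<le> 1 * a^2" using bb a2 by (intro mult_right_mono) auto
    also have "\<dots> \<le> 64/63 * c" using c by simp
    finally show ?thesis using c0 ak a2 by (simp add: field_simps)
  qed
  have \<beta>c0: "0 \<le> \<beta> / c" using bb c0 by simp
  have X: "\<bar>2 * \<beta> * r * n\<bar> \<le> 21/10 * s / (k * a^2) * \<bar>rt\<bar> + 21/5 * s / (k * a)^2 * \<bar>m\<bar>
      + 21/10 * s * \<Phi> / (k * a^2) * \<bar>r\<bar>"
  proof -
    define y where "y = 1 / (k * a^2)"
    have y: "0 \<le> y" "\<beta> / c \<le> 64/63 * y" using \<beta>c ak unfolding y_def by simp_all
    \<comment> \<open>Arranged so that \<open>n\<close> occurs only in the combination
      \<open>c * n\<close>, which the equation determines.\<close>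
    have "2 * \<beta> * r * n = (2 * (\<beta> / c)) * (r * (c * n))" using c0 by simp
    then have "\<bar>2 * \<beta> * r * n\<bar> = \<bar>2 * (\<beta> / c)\<bar> * (\<bar>r\<bar> * \<bar>rt + 2 * \<beta> * m - F\<bar>)"
      by (simp only: n abs_mult)
    also have "\<bar>2 * (\<beta> / c)\<bar> = 2 * (\<beta> / c)" using \<beta>c0 by (intro abs_of_nonneg) simp
    finally have "\<bar>2 * \<beta> * r * n\<bar> = 2 * (\<beta> / c) * (\<bar>r\<bar> * \<bar>rt + 2 * \<beta> * m - F\<bar>)" .
    also have "\<dots> \<le> 2 * (64/63 * y) * (s * \<bar>rt\<bar> + 2 / k * (s * \<bar>m\<bar>) + s * \<Phi> * \<bar>r\<bar>)"
    proof (rule mult_mono)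
      have "\<bar>r\<bar> * \<bar>rt + 2 * \<beta> * m - F\<bar> \<le> \<bar>r\<bar> * (\<bar>rt\<bar> + 2 * \<beta> * \<bar>m\<bar> + s * \<Phi>)"
      proof (rule mult_left_mono)
        have "\<bar>2 * \<beta> * m\<bar> = 2 * \<beta> * \<bar>m\<bar>" using bb by (simp add: abs_mult)
        then show "\<bar>rt + 2 * \<beta> * m - F\<bar> \<le> \<bar>rt\<bar> + 2 * \<beta> * \<bar>m\<bar> + s * \<Phi>" using F by linarith
      qed simp
      also have "\<dots> = \<bar>r\<bar> * \<bar>rt\<bar> + 2 * \<beta> * (\<bar>r\<bar> * \<bar>m\<bar>) + s * \<Phi> * \<bar>r\<bar>" by algebra
      also have "\<dots> \<le> s * \<bar>rt\<bar> + 2 / k * (s * \<bar>m\<bar>) + s * \<Phi> * \<bar>r\<bar>"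
      proof (intro add_mono mult_mono order_refl)
        show "2 * \<beta> \<le> 2 / k" using bb ak by (simp add: field_simps)
      qed (use b(6) bb ak s0 \<Phi>0 in simp_all)
      finally show "\<bar>r\<bar> * \<bar>rt + 2 * \<beta> * m - F\<bar> \<le> s * \<bar>rt\<bar> + 2 / k * (s * \<bar>m\<bar>) + s * \<Phi> * \<bar>r\<bar>" .
    qed (use y in auto)
    also have "\<dots> = 128/63 * (y * (s * \<bar>rt\<bar>) + 2 * (y / k) * (s * \<bar>m\<bar>) + y * (s * \<Phi> * \<bar>r\<bar>))"
      by (simp add: field_simps)
    \<comment> \<open>The factor 2 * 64/63 = 128/63 is rounded up to 21/10.\<close>
    also have "\<dots> \<le> 21/10 * (y * (s * \<bar>rt\<bar>) + 2 * (y / k) * (s * \<bar>m\<bar>) + y * (s * \<Phi> * \<bar>r\<bar>))"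
      using y s0 \<Phi>0 ak by (intro mult_right_mono) auto
    also have "\<dots> = 21/10 * s / (k * a^2) * \<bar>rt\<bar> + 21/5 * s / (k * a)^2 * \<bar>m\<bar>
        + 21/10 * s * \<Phi> / (k * a^2) * \<bar>r\<bar>"
      unfolding y_def by (simp add: field_simps power2_eq_square)
    finally show ?thesis .
  qed
  have "\<bar>src_t \<theta> v v' v'' u p r m rt - 2 * r * m - 2 * (v + u) * r * n\<bar>
    \<le> \<bar>src_t \<theta> v v' v'' u p r m rt - 2 * r * m\<bar> + \<bar>2 * \<beta> * r * n\<bar>" unfolding \<beta>_def by
        (rule abs_triangle_ineq4)
  also have "\<dots> \<le> ((\<theta> * s + 8 * s^2 + 12 * \<theta> * s^2 + 3 * s * Z) * \<bar>r\<bar>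
     + (4 * s + 16 * s^2 + 6 * \<theta> * s^2) * \<bar>m\<bar> + (4 * s + 2 * \<theta> * s) * \<bar>rt\<bar>)
     + (21/10 * s / (k * a^2) * \<bar>rt\<bar> + 21/5 * s / (k * a)^2 * \<bar>m\<bar> + 21/10 * s * \<Phi> / (k * a^2) *
         \<bar>r\<bar>)"
    by (rule add_mono[OF src_t_bound[OF \<theta> b] X])
  also have "\<dots> = (\<theta> * s + 8 * s^2 + 12 * \<theta> * s^2 + 3 * s * Z + 21/10 * s * \<Phi> / (k * a^2)) * \<bar>r\<bar>
     + (4 * s + 16 * s^2 + 6 * \<theta> * s^2 + 21/5 * s / (k * a)^2) * \<bar>m\<bar>
     + (4 * s + 2 * \<theta> * s + 21/10 * s / (k * a^2)) * \<bar>rt\<bar>"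
    by (simp only: distrib_right add_ac)
  finally show ?thesis .
qed

section \<open>Difference quotients in time\<close>

definition dquot :: "real \<Rightarrow> (real \<Rightarrow> real \<Rightarrow> real) \<Rightarrow> real \<Rightarrow> real \<Rightarrow> real" where
  "dquot h f t x = (f (t + h) x - f t x) / h"

lemma shift_tendsto_zero:
  fixes c :: real
  shows "(\<lambda>n. c / (real n + 1)) \<longlonglongrightarrow> 0"
  using LIMSEQ_Suc[OF lim_const_over_n[of c]] by (simp add: add.commute)

lemma shift_uniform_limit:
  fixes f :: "real \<Rightarrow> real \<Rightarrow> real"
  assumes f: "cont_rect T L f" and h: "h \<longlonglongrightarrow> 0" "\<And>n. 0 \<le> h n" "\<And>n. T' + h n \<le> T" and T': "T' \<le> T"
  shows "uniform_limit ({0..T'} \<times> {0..L}) (\<lambda>n z. f (fst z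
      + h n) (snd z)) (\<lambda>z. f (fst z) (snd z)) sequentially"
proof (rule uniform_limitI)
  fix e :: real assume e: "0 < e"
  have "uniformly_continuous_on ({0..T} \<times> {0..L}) (\<lambda>z. f (fst z) (snd z))"
    by (rule compact_uniformly_continuous[OF f]) (intro compact_Times compact_Icc)
  then obtain d where d: "0 < d" "\<And>z z'. z \<in> {0..T} \<times> {0..L} \<Longrightarrow> z' \<in> {0..T} \<times> {0..L} \<Longrightarrow> dist z' z < d
      \<Longrightarrow> dist (f (fst z') (snd z')) (f (fst z) (snd z)) < e"
    using e unfolding uniformly_continuous_on_def by metis
  have "\<forall>\<^sub>F n in sequentially. h n < d" using order_tendstoD(2)[OF h(1) d(1)] .
  then show "\<forall>\<^sub>F n in sequentially. \<forall>z\<in>{0..T'} \<times> {0..L}. dist (f (fst z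
      + h n) (snd z)) (f (fst z) (snd z)) < e"
  proof eventually_elim
    case (elim n)
    show ?case
    proof
      fix z assume z: "z \<in> {0..T'} \<times> {0..L}"
      have "dist (fst z + h n, snd z) z < d"
        using elim h(2)[of n] by (cases z) (simp add: dist_Pair_Pair dist_real_def)
      moreover have "z \<in> {0..T} \<times> {0..L}" "(fst z + h n, snd z) \<in> {0..T} \<times> {0..L}"
        using z T' h(2,3)[of n] by auto
      ultimately show "dist (f (fst z + h n) (snd z)) (f (fst z) (snd z)) < e"
        using d(2)[of z "(fst z + h n, snd z)"] by simp
    qed
  qed
qed

text \<open>By the mean value theorem the quotient equals \<open>ft\<close> at an intermediate time,
  and \<open>ft\<close> is uniformly continuous on the compact rectangle. Uniformity is needed
  twice: for the limit of the energies and for a source error that is the same at all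
  points.\<close>

lemma dquot_uniform_limit:
  fixes f ft :: "real \<Rightarrow> real \<Rightarrow> real"
  assumes der: "\<And>t x. t \<in> {0..T} \<Longrightarrow> x \<in> {0..L}
      \<Longrightarrow> ((\<lambda>t. f t x) has_real_derivative ft t x) (at t within {0..T})"
    and ft: "cont_rect T L ft" and h: "h \<longlonglongrightarrow> 0" "\<And>n. 0 < h n" "\<And>n. T' + h n \<le> T" and T': "T' \<le> T"
  shows "uniform_limit ({0..T'} \<times> {0..L}) (\<lambda>n z. dquot (h n) f (fst z) (snd z))
      (\<lambda>z. ft (fst z) (snd z)) sequentially"
proof (rule uniform_limitI)
  fix e :: real assume e: "0 < e"
  have "uniformly_continuous_on ({0..T} \<times> {0..L}) (\<lambda>z. ft (fst z) (snd z))"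
    by (rule compact_uniformly_continuous[OF ft]) (intro compact_Times compact_Icc)
  then obtain d where d: "0 < d" "\<And>z z'. z \<in> {0..T} \<times> {0..L} \<Longrightarrow> z' \<in> {0..T} \<times> {0..L} \<Longrightarrow> dist z' z < d
      \<Longrightarrow> dist (ft (fst z') (snd z')) (ft (fst z) (snd z)) < e"
    using e unfolding uniformly_continuous_on_def by metis
  have "\<forall>\<^sub>F n in sequentially. h n < d" using order_tendstoD(2)[OF h(1) d(1)] .
  then show "\<forall>\<^sub>F n in sequentially. \<forall>z\<in>{0..T'} \<times> {0..L}. dist (dquot (h n) f (fst z) (snd z))
      (ft (fst z) (snd z)) < e"
  proof eventually_elim
    case (elim n)
    show ?case
    proof
      fix z assume z: "z \<in> {0..T'} \<times> {0..L}"
      obtain t x where zz: "z = (t, x)" "t \<in> {0..T'}" "x \<in> {0..L}" using z by auto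
      have hT: "0 \<le> t" "t + h n \<le> T" using zz h(3)[of n] by auto
      have "\<exists>\<xi>\<in>{t<..<t + h n}. f (t + h n) x - f t x = (\<lambda>y. ft \<xi> x * y) (t + h n - t)"
      proof (rule mvt_simple)
        fix y assume y: "t \<le> y" "y \<le> t + h n"
        have "((\<lambda>t. f t x) has_real_derivative ft y x) (at y within {t..t + h n})"
          by (rule DERIV_subset[OF der]) (use y hT zz in auto)
        then show "((\<lambda>t. f t x) has_derivative (\<lambda>z. ft y x * z)) (at y within {t..t + h n})"
          by (simp add: has_field_derivative_def)
      qed (use h(2)[of n] in simp)
      then obtain \<xi> where \<xi>: "t < \<xi>" "\<xi> < t + h n" "f (t + h n) x - f t x = ft \<xi> x * h n" by auto
      then have "dquot (h n) f t x = ft \<xi> x" using h(2)[of n] unfolding dquot_def by simp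
      moreover have "dist (\<xi>, x) (t, x) < d"
          using \<xi> elim by (simp add: dist_Pair_Pair dist_real_def)
      ultimately show "dist (dquot (h n) f (fst z) (snd z)) (ft (fst z) (snd z)) < e"
        using d(2)[of "(t, x)" "(\<xi>, x)"] zz \<xi> hT by simp
    qed
  qed
qed

lemma dquot_derivative_x:
  assumes "(f (t + h) has_real_derivative fx (t + h) x) (at x within S)"
      "(f t has_real_derivative fx t x) (at x within S)"
  shows "(dquot h f t has_real_derivative dquot h fx t x) (at x within S)"
proof -
  have "((\<lambda>x. (f (t + h) x - f t x) / h) has_real_derivative (fx (t + h) x
      - fx t x) / h) (at x within S)"
    by (intro DERIV_cdivide DERIV_diff assms)
  then show ?thesis unfolding dquot_def[abs_def] .
qed

lemma dquot_derivative_t: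
  assumes der: "\<And>t. t \<in> {0..T} \<Longrightarrow> ((\<lambda>t. f t x) has_real_derivative ft t x) (at t within {0..T})"
    and "0 \<le> h" "T' + h \<le> T" "t \<in> {0..T'}"
  shows "((\<lambda>t. dquot h f t x) has_real_derivative dquot h ft t x) (at t within {0..T'})"
proof -
  have "((\<lambda>t. f t x) has_real_derivative ft t x) (at t within {0..T'})"
    by (rule DERIV_subset[OF der]) (use assms in auto)
  moreover have "((\<lambda>t. f t x) \<circ> (\<lambda>t. t + h) has_real_derivative ft (t
      + h) x * 1) (at t within {0..T'})"
  proof (rule DERIV_image_chain)
    show "((\<lambda>t. f t x) has_real_derivative ft (t + h) x) (at (t + h) within (\<lambda>t. t + h) ` {0..T'})"
      by (rule DERIV_subset[OF der]) (use assms in auto)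
    show "((\<lambda>t. t + h) has_real_derivative 1) (at t within {0..T'})"
        by (auto intro!: derivative_eq_intros)
  qed
  ultimately have "((\<lambda>t. (f (t + h) x - f t x) / h) has_real_derivative (ft (t + h) x
      - ft t x) / h) (at t within {0..T'})"
    by (intro DERIV_cdivide DERIV_diff) (auto simp: o_def)
  then show ?thesis unfolding dquot_def .
qed

lemma cont_rect_subset: "cont_rect T L f \<Longrightarrow> T' \<le> T \<Longrightarrow> cont_rect T' L f"
  by (erule continuous_on_subset) auto

lemma cont_rect_dquot:
  assumes f: "cont_rect T L f" and "0 < h" "T' + h \<le> T"
  shows "cont_rect T' L (dquot h f)"
proof -
  have "continuous_on ({0..T'} \<times> {0..L}) ((\<lambda>z. f (fst z) (snd z)) \<circ> (\<lambda>z. (fst z + h, snd z)))"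
    by (rule continuous_on_compose) (use assms in \<open>auto intro!: continuous_intros intro:
        continuous_on_subset\<close>)
  then have "continuous_on ({0..T'} \<times> {0..L}) (\<lambda>z. f (fst z + h) (snd z))" by (simp add: o_def)
  moreover have "continuous_on ({0..T'} \<times> {0..L}) (\<lambda>z. f (fst z) (snd z))"
    by (rule cont_rect_subset[OF f]) (use assms in simp)
  ultimately show ?thesis unfolding dquot_def using assms by (auto intro!: continuous_intros)
qed

lemma cont_rect_bounded:
  assumes "cont_rect T L f"
  shows "bounded ((\<lambda>z. f (fst z) (snd z)) ` ({0..T} \<times> {0..L}))"
  by (intro compact_imp_bounded compact_continuous_image[OF assms] compact_Times compact_Icc)

lemma edens_integral_tendsto:
  fixes a k L :: real and b p q :: "real \<Rightarrow> real" and pn qn :: "nat \<Rightarrow> real \<Rightarrow> real"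
  assumes L: "0 < L" and b: "continuous_on {0..L} b" and p: "continuous_on {0..L} p"
      and q: "continuous_on {0..L} q"
    and pn: "\<And>n. continuous_on {0..L} (pn n)" and qn: "\<And>n. continuous_on {0..L} (qn n)"
    and lim: "uniform_limit {0..L} pn p sequentially" "uniform_limit {0..L} qn q sequentially"
  shows "(\<lambda>n. integral {0..L} (\<lambda>x. edens a k (exp (- x / L)) (b x) (pn n x) (qn n x)))
    \<longlonglongrightarrow> integral {0..L} (\<lambda>x. edens a k (exp (- x / L)) (b x) (p x) (q x))"
proof -
  define h where "h x = exp (- x / L)" for x
  have h: "continuous_on {0..L} h" unfolding h_def using L by (auto intro!: continuous_intros)
  define w where "w x = k * (a^2 - (b x)^2) - 2 * h x * b x" for x
  have w: "continuous_on {0..L} w" unfolding w_def by (intro continuous_intros b h)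
  have bd: "bounded (g ` {0..L})" if "continuous_on {0..L} g" for g :: "real \<Rightarrow> real"
    using that by (intro compact_imp_bounded compact_continuous_image compact_Icc)
  have e: "edens a k (exp (- x / L)) (b x) y z = w x * (y * y) - 2 * (h x * (y * z)) + k * (z * z)"
      for x y z
    unfolding edens_def w_def h_def by (simp add: power2_eq_square)
  have u: "uniform_limit {0..L} (\<lambda>n x. w x * (pn n x * pn n x) - 2 * (h x * (pn n x * qn n x))
      + k * (qn n x * qn n x))
     (\<lambda>x. w x * (p x * p x) - 2 * (h x * (p x * q x)) + k * (q x * q x)) sequentially"
    by (intro uniform_limit_add uniform_limit_minus uniform_lim_mult uniform_limit_const lim bd
        continuous_intros p q w h)
  have c: "continuous_on {0..L} (\<lambda>x. w x * (pn n x * pn n x) - 2 * (h x * (pn n x * qn n x))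
      + k * (qn n x * qn n x))" for n
    by (intro continuous_intros w h pn qn)
  obtain I J where IJ: "\<And>n. ((\<lambda>x. w x * (pn n x * pn n x) - 2 * (h x * (pn n x * qn n x))
      + k * (qn n x * qn n x)) has_integral I n) {0..L}"
    "((\<lambda>x. w x * (p x * p x) - 2 * (h x * (p x * q x)) + k * (q x * q x)) has_integral J) {0..L}"
    "(I \<longlongrightarrow> J) sequentially"
    using uniform_limit_integral[OF u c] by auto
  then show ?thesis unfolding e integral_unique[OF IJ(1)] integral_unique[OF IJ(2)] by simp
qed

section \<open>Decay of the two energies\<close>

lemma DERIV_unique_Icc:
  fixes f :: "real \<Rightarrow> real"
  assumes "a < b" "x \<in> {a..b}" "(f has_real_derivative d) (at x within {a..b})"
      "(f has_real_derivative d') (at x within {a..b})"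
  shows "d = d'"
  using vector_derivative_unique_within_closed_interval[of a b x f d d'] assms
  unfolding has_real_derivative_iff_has_vector_derivative by simp

text \<open>The derivatives of u are parameters with their defining property instead of terms in
  \<open>dt\<close> and \<open>dx\<close>, and the one function \<open>utx\<close> serves as both
  mixed derivatives. The number \<open>s\<close> bounds everything of first order, while
  \<open>Z\<close> measures the second derivative of the stationary state.\<close>

locale perturbed_wave =
  fixes a k \<theta> L T s Z :: real and v v' v'' :: "real \<Rightarrow> real"
      and u ux ut utt utx uxx :: "real \<Rightarrow> real \<Rightarrow> real"
  assumes ak: "0 < a" "0 < k" "8 \<le> a * k" and \<theta>: "0 \<le> \<theta>" and L: "0 < L" and T: "0 < T"
    and der_t: "\<And>t x. t \<in> {0..T} \<Longrightarrow> x \<in> {0..L}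
        \<Longrightarrow> ((\<lambda>t. u t x) has_real_derivative ut t x) (at t within {0..T})"
      "\<And>t x. t \<in> {0..T} \<Longrightarrow> x \<in> {0..L} \<Longrightarrow> ((\<lambda>t. ux t x) has_real_derivative utx t x)
          (at t within {0..T})"
      "\<And>t x. t \<in> {0..T} \<Longrightarrow> x \<in> {0..L} \<Longrightarrow> ((\<lambda>t. ut t x) has_real_derivative utt t x)
          (at t within {0..T})"
    and der_x: "\<And>t x. t \<in> {0..T} \<Longrightarrow> x \<in> {0..L}
        \<Longrightarrow> (u t has_real_derivative ux t x) (at x within {0..L})"
      "\<And>t x. t \<in> {0..T} \<Longrightarrow> x \<in> {0..L} \<Longrightarrow> (ux t has_real_derivative uxx t x) (at x within {0..L})"
      "\<And>t x. t \<in> {0..T} \<Longrightarrow> x \<in> {0..L} \<Longrightarrow> (ut t has_real_derivative utx t x) (at x within {0..L})"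
    and cont: "cont_rect T L u" "cont_rect T L ux" "cont_rect T L ut" "cont_rect T L utt"
        "cont_rect T L utx" "cont_rect T L uxx"
    and der_v: "\<And>x. x \<in> {0..L} \<Longrightarrow> (v has_real_derivative v' x) (at x within {0..L})"
      and cont_v: "continuous_on {0..L} v'" "continuous_on {0..L} v''"
    and pde: "\<And>t x. t \<in> {0..T} \<Longrightarrow> x \<in> {0..L} \<Longrightarrow>
      utt t x + 2 * (v x + u t x) * utx t x - (a^2 - (v x + u t x)^2) * uxx t x
      = src \<theta> (v x) (v' x) (v'' x) (u t x) (ux t x) (ut t x)"
    and bc: "\<And>t. t \<in> {0..T} \<Longrightarrow> ux t 0 = k * ut t 0" "\<And>t. t \<in> {0..T} \<Longrightarrow> u t L = 0"
    and speed: "\<And>t x. t \<in> {0..T} \<Longrightarrow> x \<in> {0..L} \<Longrightarrow> 0 \<le> v x + u t x \<and> k * (v x + u t x) \<le> 1"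
    and s: "s \<le> a" and bounds: "\<And>t x. t \<in> {0..T} \<Longrightarrow> x \<in> {0..L} \<Longrightarrow> \<bar>v x\<bar> \<le> s \<and> \<bar>v' x\<bar> \<le> s \<and> \<bar>v'' x\<bar>
        \<le> 3/4 * Z
      \<and> \<bar>u t x\<bar> \<le> s \<and> \<bar>ux t x\<bar> \<le> s \<and> \<bar>ut t x\<bar> \<le> s"
begin

definition "\<Phi> = 4 * s + 2 * \<theta> * s + 14 * s^2 + 21/2 * \<theta> * s^2 + 9/4 * s * Z"
definition "cA = \<theta> * s + 8 * s^2 + 12 * \<theta> * s^2 + 3 * s * Z + 21/10 * s * \<Phi> / (k * a^2)"
definition "cB = 4 * s + 16 * s^2 + 6 * \<theta> * s^2 + 21/5 * s / (k * a)^2"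
definition "cD = 4 * s + 2 * \<theta> * s + 21/10 * s / (k * a^2)"
definition "cQ = 24 * s + 16 * k * s + 40 * (1+k) * s^2 + (1+k) * (10 * \<theta> * s + 36 * \<theta> * s^2)
    + 5 * (k+1) * s * Z"
text \<open>Divided by k a^2, the weight (1 + L^2)(1 + a^2) becomes (1 + L^2)(1/(k a^2) + 1/k), the
  form that is compared with the factor of \<open>P0\<close> and \<open>P1\<close> in
  \<open>kappa\<close>.\<close>

definition "cR = cQ * ((1 + L^2) * (1 + a^2))"

definition "b t x = v x + u t x"
definition "bx t x = v' x + ux t x"

definition "energy1 t = integral {0..L} (\<lambda>x. edens a k (exp (- x / L)) (b t x) (ux t x) (ut t x))"
definition "energy2 t = integral {0..L} (\<lambda>x. edens a k (exp (- x / L)) (b t x) (utx t x) (utt t x))"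

lemma s0: "0 \<le> s" and Z0: "0 \<le> Z"
  using bounds[of 0 0] L T by auto

lemma \<Phi>0: "0 \<le> \<Phi>" unfolding \<Phi>_def using s0 Z0 \<theta> by simp

lemma coeff_nonneg: "0 \<le> cA" "0 \<le> cB" "0 \<le> cD" "0 \<le> cR"
proof -
  note nn = s0 Z0 \<theta> \<Phi>0 ak(1,2)
  show "0 \<le> cA" "0 \<le> cB" "0 \<le> cD" unfolding cA_def cB_def cD_def using nn by simp_all
  have "0 \<le> cQ" unfolding cQ_def using nn by simp
  then show "0 \<le> cR" unfolding cR_def by simp
qed

lemma coeff_bounds:
  "4 * k * s^2 + 8 * s^2 + 2 * s + 2 * cB + a * (8 * k * s^2 + k * cB + cD) + 2 * L * cA
      + a * L * (k * cA) \<le> 2 * cR"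
  "a^2 * (4 * k * s + 2 * k * cD) + a * (8 * k * s^2 + k * cB + cD) + a * L * (k * cA) \<le> 2 * cR"
  using coefficient_bounds[OF ak \<theta> Z0 L s0 s] unfolding cR_def cQ_def cA_def cB_def cD_def \<Phi>_def
      mult.assoc[of 2] by auto

text \<open>Differentiating the constant trace u(t, L) = 0 in time provides the condition w_t = 0 at
  \<open>L\<close> that the energy estimate for w = u asks for.\<close>

lemma utL: "ut t L = 0" if t: "t \<in> {0..T}" for t
proof -
  have "((\<lambda>t. u t L) has_real_derivative 0) (at t within {0..T})"
    by (rule has_field_derivative_transform_within[OF DERIV_const[of 0] zero_less_one t])
        (simp add: bc)
  then show ?thesis using DERIV_unique_Icc[OF T t] der_t(1)[OF t, of L] L by simp
qed

lemma b_deriv: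
  assumes "t \<in> {0..T}" "x \<in> {0..L}"
  shows "((\<lambda>t. b t x) has_real_derivative ut t x) (at t within {0..T})"
    "(b t has_real_derivative bx t x) (at x within {0..L})"
proof -
  show "((\<lambda>t. b t x) has_real_derivative ut t x) (at t within {0..T})"
    unfolding b_def using DERIV_add[OF DERIV_const[of "v x"] der_t(1)[OF assms]] by simp
  have "((\<lambda>x. v x + u t x) has_real_derivative v' x + ux t x) (at x within {0..L})"
    by (rule DERIV_add[OF der_v[OF assms(2)] der_x(1)[OF assms]])
  then show "(b t has_real_derivative bx t x) (at x within {0..L})"
      unfolding b_def[abs_def] bx_def .
qed

lemma cont_snd:
  assumes "continuous_on {0..L} f"
  shows "continuous_on ({0..T} \<times> {0..L}) (\<lambda>z. f (snd z))"
proof -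
  have "continuous_on ({0..T} \<times> {0..L}) (f \<circ> snd)"
    by (rule continuous_on_compose) (auto intro!: continuous_intros intro:
        continuous_on_subset[OF assms])
  then show ?thesis by (simp add: o_def)
qed

lemma v_cont: "continuous_on {0..L} v" by (rule DERIV_continuous_on[OF der_v])

lemma b_cont: "cont_rect T L b" "cont_rect T L bx"
  unfolding b_def bx_def by (intro continuous_intros cont cont_snd v_cont cont_v)+

lemma b_bounds:
  assumes "t \<in> {0..T}" "x \<in> {0..L}"
  shows "0 \<le> b t x \<and> k * b t x \<le> 1 \<and> b t x \<le> 2 * s \<and> \<bar>ut t x\<bar> \<le> s \<and> \<bar>bx t x\<bar> \<le> 2 * s"
  using speed[OF assms] bounds[OF assms] unfolding b_def bx_def by auto

text \<open>The coefficients are those of the differentiated source, which dominate the ones for the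
  source itself; thus both energies decay at one rate. The summand 0 is the uniform error
  \<open>d\<close> of \<open>forced_wave\<close>.\<close>

lemma src_le:
  assumes tx: "t \<in> {0..T}" "x \<in> {0..L}"
  shows "\<bar>src \<theta> (v x) (v' x) (v'' x) (u t x) (ux t x) (ut t x)\<bar> \<le> cA * \<bar>u t x\<bar> + cB * \<bar>ux t x\<bar>
      + cD * \<bar>ut t x\<bar> + 0"
proof -
  note nn = s0 Z0 \<theta> \<Phi>0 ak(1,2)
  have "\<bar>src \<theta> (v x) (v' x) (v'' x) (u t x) (ux t x) (ut t x)\<bar>
      \<le> (8 * s^2 + 9 * \<theta> * s^2 + 9/4 * s * Z) * \<bar>u t x\<bar>
      + (6 * s^2 + 3/2 * \<theta> * s^2) * \<bar>ux t x\<bar> + (4 * s + 2 * \<theta> * s) * \<bar>ut t x\<bar>"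
    using bounds[OF tx] by (intro src_bound[OF \<theta>]) auto
  also have "\<dots> \<le> cA * \<bar>u t x\<bar> + cB * \<bar>ux t x\<bar> + cD * \<bar>ut t x\<bar>"
  proof (intro add_mono mult_right_mono)
    have p: "0 \<le> \<theta> * s" "0 \<le> \<theta> * s^2" "0 \<le> s * Z" "0 \<le> 21/10 * s * \<Phi> / (k * a^2)"
        "0 \<le> 21/5 * s / (k * a)^2" "0 \<le> 21/10 * s / (k * a^2)"
      "0 \<le> s^2" using nn by simp_all
    show "8 * s^2 + 9 * \<theta> * s^2 + 9/4 * s * Z \<le> cA" unfolding cA_def using p by linarith
    show "6 * s^2 + 3/2 * \<theta> * s^2 \<le> cB" unfolding cB_def using p s0 by linarith
    show "4 * s + 2 * \<theta> * s \<le> cD" unfolding cD_def using p by linarith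
  qed auto
  finally show ?thesis by simp
qed

section \<open>Decay of both energies at a common rate\<close>

context
  fixes \<mu> :: real
  assumes \<mu>: "0 < \<mu>" "\<mu> \<le> 7 / (8 * exp 1 * L * k) - 5 / 2 * cR / (k * a^2)"
begin

lemma energy1_decay:
  assumes t: "t \<in> {0..T}"
  shows "energy1 t \<le> exp (- \<mu> * t) * energy1 0"
proof -
  have "energy1 t \<le> exp (- \<mu> * t) * energy1 0 + L * (2 * k * s + 2 * s) * 0 / \<mu>"
    unfolding energy1_def
  proof (rule forced_wave.energy_decay[OF forced_wave.intro t \<mu>, where w = u and bt = ut and bx = bx
      and m = utx and n = uxx
      and r = utt and s = s and A = cA and B = cB and D = cD
      and g = "\<lambda>t x. src \<theta> (v x) (v' x) (v'' x) (u t x) (ux t x) (ut t x)"];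
      (rule ak L s0 coeff_nonneg order_refl coeff_bounds | fact b_deriv | fact der_t | fact der_x |
          fact cont | fact b_cont
        | fact bc | fact b_bounds | fact src_le | fact utL)?)
    show "2 * k * \<bar>ut t x\<bar> + 2 * \<bar>ux t x\<bar> \<le> 2 * k * s + 2 * s" if "t \<in> {0..T}" "x \<in> {0..L}" for t x
      using bounds[OF that] ak by (intro add_mono mult_left_mono) auto
  qed (unfold b_def, fact pde)
  then show ?thesis by simp
qed

text \<open>The source in the equation formally satisfied by w = u_t: the time derivative of the
  source, minus 2 b_t u_tx, plus c_t u_xx, where b_t = u_t and c_t = - 2 b u_t.\<close>

definition "gt t x = src_t \<theta> (v x) (v' x) (v'' x) (u t x) (ux t x) (ut t x) (utx t x) (utt t x)
   - 2 * ut t x * utx t x - 2 * b t x * ut t x * uxx t x"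

lemma gt_bound:
  assumes tx: "t \<in> {0..T}" "x \<in> {0..L}"
  shows "\<bar>gt t x\<bar> \<le> cA * \<bar>ut t x\<bar> + cB * \<bar>utx t x\<bar> + cD * \<bar>utt t x\<bar>"
  unfolding gt_def b_def cA_def cB_def cD_def \<Phi>_def
  using bounds[OF tx] speed[OF tx] by (intro
      differentiated_source_bound[OF ak \<theta> _ _ _ _ _ _ _ _ pde[OF tx]]) auto

definition "F t x = src \<theta> (v x) (v' x) (v'' x) (u t x) (ux t x) (ut t x)"
definition "Ft t x = src_t \<theta> (v x) (v' x) (v'' x) (u t x) (ux t x) (ut t x) (utx t x) (utt t x)"
definition "c t x = a^2 - (b t x)^2"

lemma Ft_cont: "cont_rect T L Ft"
  unfolding Ft_def src_t_def by (intro continuous_intros cont cont_snd v_cont cont_v)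

lemma F_deriv:
  assumes "t \<in> {0..T}" "x \<in> {0..L}"
  shows "((\<lambda>t. F t x) has_real_derivative Ft t x) (at t within {0..T})"
  unfolding F_def Ft_def using src_has_derivative[OF der_t[OF assms]] .

lemma c_deriv:
  assumes "t \<in> {0..T}" "x \<in> {0..L}"
  shows "((\<lambda>t. c t x) has_real_derivative - 2 * b t x * ut t x) (at t within {0..T})"
  unfolding c_def power2_eq_square
  by (rule DERIV_cong[OF DERIV_diff[OF DERIV_const
      DERIV_mult[OF b_deriv(1)[OF assms] b_deriv(1)[OF assms]]]]) simp

text \<open>The discrete product rule puts the shift \<open>t + h\<close> on one factor only, so the
  principal part keeps the unshifted coefficients. The quotient thus solves an equation with the
  same operator, and only derivatives of u up to order two occur.\<close>

lemma dquot_pde: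
  assumes "t \<in> {0..T}" "t + h \<in> {0..T}" "x \<in> {0..L}"
  shows "dquot h utt t x + 2 * b t x * dquot h utx t x - (a^2 - (b t x)^2) * dquot h uxx t x
    = dquot h F t x - 2 * (dquot h b t x * utx (t + h) x) + dquot h c t x * uxx (t + h) x"
proof -
  have "utt t x = F t x - 2 * b t x * utx t x + c t x * uxx t x"
    using pde[OF assms(1,3)] unfolding F_def b_def c_def by simp
  moreover have "utt (t + h) x = F (t + h) x - 2 * b (t + h) x * utx (t + h) x
      + c (t + h) x * uxx (t + h) x"
    using pde[OF assms(2,3)] unfolding F_def b_def c_def by simp
  ultimately show ?thesis
    unfolding dquot_def c_def[symmetric] divide_inverse by algebra
qed


text \<open>Ending at \<open>T'\<close> before \<open>T\<close> leaves room for the shift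
  \<open>t + h\<close>; the steps are at most T - T'.\<close>

lemma energy2_decay_interior:
  assumes T': "0 < T'" "T' < T" and t: "t \<in> {0..T'}"
  shows "energy2 t \<le> exp (- \<mu> * t) * energy2 0"
proof -
  define h where "h n = (T - T') / (real n + 1)" for n
  have h: "h \<longlonglongrightarrow> 0" unfolding h_def by (rule shift_tendsto_zero)
  have h0: "0 < h n" for n using T' unfolding h_def by simp
  have hT: "T' + h n \<le> T" for n
  proof -
    have "h n \<le> (T - T') / 1" unfolding h_def using T' by (intro divide_left_mono) auto
    then show ?thesis by simp
  qed
  have h0': "0 \<le> h n" for n using h0[of n] by simp
  have T'T: "T' \<le> T" using T' by simp
  have tT: "y \<in> {0..T}" "y + h n \<in> {0..T}" if "y \<in> {0..T'}" for y n
    using that T' h0'[of n] hT[of n] by auto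
  let ?S = "{0..T'} \<times> {0..L}"
  \<comment> \<open>The equation for the quotient holds by this definition; what has to be proved is
    that the sources converge uniformly to \<open>gt\<close>, and \<open>dquot_pde\<close> brings
    them into a form where the limit can be taken.\<close>
  define g where "g n t x = dquot (h n) utt t x + 2 * b t x * dquot (h n) utx t x
      - (a^2 - (b t x)^2) * dquot (h n) uxx t x" for n t x
  note dq = dquot_uniform_limit[OF _ _ h h0 hT T'T]
  have lim: "uniform_limit ?S (\<lambda>n z. dquot (h n) u (fst z) (snd z)) (\<lambda>z. ut (fst z) (snd z))
      sequentially"
    "uniform_limit ?S (\<lambda>n z. dquot (h n) ux (fst z) (snd z)) (\<lambda>z. utx (fst z) (snd z)) sequentially"
    "uniform_limit ?S (\<lambda>n z. dquot (h n) ut (fst z) (snd z)) (\<lambda>z. utt (fst z) (snd z)) sequentially"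
    "uniform_limit ?S (\<lambda>n z. dquot (h n) b (fst z) (snd z)) (\<lambda>z. ut (fst z) (snd z)) sequentially"
    "uniform_limit ?S (\<lambda>n z. dquot (h n) F (fst z) (snd z)) (\<lambda>z. Ft (fst z) (snd z)) sequentially"
    by (rule dq[OF der_t(1) cont(3)] dq[OF der_t(2) cont(5)] dq[OF der_t(3) cont(4)]
        dq[OF b_deriv(1) cont(3)] dq[OF F_deriv Ft_cont]; assumption)+
  have ct: "cont_rect T L (\<lambda>t x. - 2 * b t x * ut t x)" by (intro continuous_intros b_cont cont)
  have limc: "uniform_limit ?S (\<lambda>n z. dquot (h n) c (fst z) (snd z)) (\<lambda>z.
      - 2 * b (fst z) (snd z) * ut (fst z) (snd z)) sequentially"
    by (rule dq[OF c_deriv ct]; assumption)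
  note sh = shift_uniform_limit[OF _ h h0' hT T'T]
  note bd = cont_rect_bounded[OF cont_rect_subset[OF _ T'T]]
  have "uniform_limit ?S (\<lambda>n z. dquot (h n) F (fst z) (snd z)
      - 2 * (dquot (h n) b (fst z) (snd z) * utx (fst z + h n) (snd z))
       + dquot (h n) c (fst z) (snd z) * uxx (fst z + h n) (snd z))
    (\<lambda>z. Ft (fst z) (snd z) - 2 * (ut (fst z) (snd z) * utx (fst z) (snd z))
       + (- 2 * b (fst z) (snd z) * ut (fst z) (snd z)) * uxx (fst z) (snd z)) sequentially"
  proof (intro uniform_limit_add uniform_limit_minus)
    have m: "uniform_limit ?S (\<lambda>n z. dquot (h n) b (fst z) (snd z) * utx (fst z + h n) (snd z))
      (\<lambda>z. ut (fst z) (snd z) * utx (fst z) (snd z)) sequentially"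
      by (rule uniform_lim_mult[OF lim(4) sh[OF cont(5)] bd[OF cont(3)] bd[OF cont(5)]])
    have b2: "bounded ((\<lambda>_. 2 :: real) ` ?S)"
        by (rule finite_imp_bounded) (simp add: image_constant_conv)
    have cm: "cont_rect T L (\<lambda>t x. ut t x * utx t x)" by (intro continuous_intros cont)
    show "uniform_limit ?S (\<lambda>n z. 2 * (dquot (h n) b (fst z) (snd z) * utx (fst z + h n) (snd z)))
      (\<lambda>z. 2 * (ut (fst z) (snd z) * utx (fst z) (snd z))) sequentially"
      by (rule uniform_lim_mult[OF uniform_limit_const m b2 bd[OF cm]])
    show "uniform_limit ?S (\<lambda>n z. dquot (h n) c (fst z) (snd z) * uxx (fst z + h n) (snd z))
      (\<lambda>z. (- 2 * b (fst z) (snd z) * ut (fst z) (snd z)) * uxx (fst z) (snd z)) sequentially"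
      by (rule uniform_lim_mult[OF limc sh[OF cont(6)] bd[OF ct] bd[OF cont(6)]])
  qed (rule lim(5))
  also have "?this \<longleftrightarrow> uniform_limit ?S (\<lambda>n z. g n (fst z) (snd z)) (\<lambda>z. gt (fst z) (snd z))
      sequentially"
  proof (rule uniform_limit_cong')
    fix n z assume z: "z \<in> ?S"
    show "dquot (h n) F (fst z) (snd z) - 2 * (dquot (h n) b (fst z) (snd z) * utx (fst z
        + h n) (snd z))
       + dquot (h n) c (fst z) (snd z) * uxx (fst z + h n) (snd z) = g n (fst z) (snd z)"
      unfolding g_def using z by (intro dquot_pde[symmetric] tT) auto
  qed (simp add: gt_def Ft_def)
  finally have limg: "uniform_limit ?S (\<lambda>n z. g n (fst z) (snd z)) (\<lambda>z. gt (fst z) (snd z))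
      sequentially" .
  obtain M where M: "\<And>t x. t \<in> {0..T} \<Longrightarrow> x \<in> {0..L} \<Longrightarrow> \<bar>utt t x\<bar> \<le> M \<and> \<bar>utx t x\<bar> \<le> M"
  proof -
    obtain M1 M2 where M: "\<forall>z\<in>{0..T} \<times> {0..L}. \<bar>utt (fst z) (snd z)\<bar> \<le> M1"
      "\<forall>z\<in>{0..T} \<times> {0..L}. \<bar>utx (fst z) (snd z)\<bar> \<le> M2"
      using cont_rect_bounded[OF cont(4)] cont_rect_bounded[OF cont(5)] unfolding bounded_iff
          ball_simps(9) real_norm_def by blast
    have "\<bar>utt t x\<bar> \<le> max M1 M2 \<and> \<bar>utx t x\<bar> \<le> max M1 M2" if "t \<in> {0..T}" "x \<in> {0..L}" for t x
      using M(1)[rule_format, of "(t, x)"] M(2)[rule_format, of "(t, x)"] that by auto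
    then show ?thesis by (rule that)
  qed
  \<comment> \<open>The bound M + 1 covers the quotients once they are within e \<le> 1 of their
    limits, so neither \<open>N\<close> nor \<open>K\<close> depends on e.\<close>
  define N where "N = 2 * k * (M + 1) + 2 * (M + 1)"
  define K where "K = L * N * (1 + cA + cB + cD) / \<mu>"
  define En where "En n t = integral {0..L}
      (\<lambda>x. edens a k (exp (- x / L)) (b t x) (dquot (h n) ux t x) (dquot (h n) ut t x))" for n t
  have En_lim: "(\<lambda>n. En n t) \<longlonglongrightarrow> energy2 t" if t: "t \<in> {0..T'}" for t
    unfolding En_def energy2_def
  proof (rule edens_integral_tendsto[OF L])
    show "continuous_on {0..L} (b t)" "continuous_on {0..L} (utx t)" "continuous_on {0..L} (utt t)"
      by (rule cont_rect_slice[OF b_cont(1) tT(1)[OF t]] cont_rect_slice[OF cont(5) tT(1)[OF t]]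
          cont_rect_slice[OF cont(4) tT(1)[OF t]])+
    show "continuous_on {0..L} (dquot (h n) ux t)" "continuous_on {0..L} (dquot (h n) ut t)" for n
      by (rule cont_rect_slice[OF cont_rect_dquot[OF cont(2) h0 hT] t]
          cont_rect_slice[OF cont_rect_dquot[OF cont(3) h0 hT] t])+
    have sl: "uniform_limit {0..L} (\<lambda>n. f n t) (f' t) sequentially"
      if "uniform_limit ?S (\<lambda>n z. f n (fst z) (snd z)) (\<lambda>z. f' (fst z) (snd z)) sequentially"
          for f :: "nat \<Rightarrow> real \<Rightarrow> real \<Rightarrow> real" and f'
    proof (rule uniform_limitI)
      fix e :: real assume "0 < e"
      from uniform_limitD[OF that this]
      show "\<forall>\<^sub>F n in sequentially. \<forall>x\<in>{0..L}. dist (f n t x) (f' t x) < e"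
        by eventually_elim (use t in force)
    qed
    show "uniform_limit {0..L} (\<lambda>n. dquot (h n) ux t) (utx t) sequentially"
        "uniform_limit {0..L} (\<lambda>n. dquot (h n) ut t) (utt t) sequentially"
      by (rule sl[OF lim(2)] sl[OF lim(3)])+
  qed
  \<comment> \<open>Two limits are taken in order: the step tends to 0 with the tolerance e fixed,
    afterwards e tends to 0.\<close>
  have *: "energy2 t \<le> exp (- \<mu> * t) * energy2 0 + K * e" if e: "0 < e" "e \<le> 1" for e
  proof (rule tendsto_le[OF sequentially_bot _ En_lim[OF t]])
    show "(\<lambda>n. exp (- \<mu> * t) * En n 0 + K * e) \<longlonglongrightarrow> exp (- \<mu> * t) * energy2 0 + K * e"
      by (intro tendsto_intros En_lim) (use T' in simp)
    have "\<forall>\<^sub>F n in sequentially. \<forall>z\<in>?S. dist (dquot (h n) u (fst z) (snd z)) (ut (fst z) (snd z))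
        < e"
      "\<forall>\<^sub>F n in sequentially. \<forall>z\<in>?S. dist (dquot (h n) ux (fst z) (snd z)) (utx (fst z) (snd z))
          < e"
      "\<forall>\<^sub>F n in sequentially. \<forall>z\<in>?S. dist (dquot (h n) ut (fst z) (snd z)) (utt (fst z) (snd z))
          < e"
      "\<forall>\<^sub>F n in sequentially. \<forall>z\<in>?S. dist (g n (fst z) (snd z)) (gt (fst z) (snd z)) < e"
      using uniform_limitD[OF lim(1) e(1)] uniform_limitD[OF lim(2) e(1)]
          uniform_limitD[OF lim(3) e(1)] uniform_limitD[OF limg e(1)] .
    then show "\<forall>\<^sub>F n in sequentially. En n t \<le> exp (- \<mu> * t) * En n 0 + K * e"
    proof eventually_elim
      case (elim n)
      have cl: "\<bar>dquot (h n) u t x - ut t x\<bar> \<le> e" "\<bar>dquot (h n) ux t x - utx t x\<bar> \<le> e"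
        "\<bar>dquot (h n) ut t x - utt t x\<bar> \<le> e" "\<bar>g n t x - gt t x\<bar> \<le> e" if "t \<in> {0..T'}" "x \<in> {0..L}"
            for t x
      proof -
        have z: "(t, x) \<in> ?S" using that by simp
        show "\<bar>dquot (h n) u t x - ut t x\<bar> \<le> e" "\<bar>dquot (h n) ux t x - utx t x\<bar> \<le> e"
          "\<bar>dquot (h n) ut t x - utt t x\<bar> \<le> e" "\<bar>g n t x - gt t x\<bar> \<le> e"
          using elim(1)[rule_format, OF z] elim(2)[rule_format, OF z] elim(3)[rule_format, OF z]
              elim(4)[rule_format, OF z]
          by (simp_all add: dist_real_def)
      qed
      have "En n t \<le> exp (- \<mu> * t) * En n 0 + L * N * ((1 + cA + cB + cD) * e) / \<mu>"
        unfolding En_def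
      proof (rule forced_wave.energy_decay[OF forced_wave.intro t \<mu>, where bt = ut and bx = bx
          and w = "dquot (h n) u"
            and m = "dquot (h n) utx" and n = "dquot (h n) uxx"
            and r = "dquot (h n) utt" and s = s and A = cA and B = cB and D = cD and g = "g n"])
        fix y x assume y: "y \<in> {0..T'}" and x: "x \<in> {0..L}"
        note yT = tT[OF y]
        show "((\<lambda>t. b t x) has_real_derivative ut y x) (at y within {0..T'})"
          by (rule DERIV_subset[OF b_deriv(1)[OF yT(1) x]]) (use T' in auto)
        show "(b y has_real_derivative bx y x) (at x within {0..L})"
            by (rule b_deriv(2)[OF yT(1) x])
        show "(dquot (h n) u y has_real_derivative dquot (h n) ux y x) (at x within {0..L})"
          "(dquot (h n) ux y has_real_derivative dquot (h n) uxx y x) (at x within {0..L})"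
          "(dquot (h n) ut y has_real_derivative dquot (h n) utx y x) (at x within {0..L})"
          by (rule dquot_derivative_x[where f = u
              and fx = ux, OF der_x(1)[OF yT(2) x] der_x(1)[OF yT(1) x]]
              dquot_derivative_x[where f = ux
                  and fx = uxx, OF der_x(2)[OF yT(2) x] der_x(2)[OF yT(1) x]]
              dquot_derivative_x[where f = ut
                  and fx = utx, OF der_x(3)[OF yT(2) x] der_x(3)[OF yT(1) x]])+
        show "((\<lambda>t. dquot (h n) ux t x) has_real_derivative dquot (h n) utx y x)
            (at y within {0..T'})"
          by (rule dquot_derivative_t[where f = ux and ft = utx, OF der_t(2)[OF _ x] h0' hT y])
        show "((\<lambda>t. dquot (h n) ut t x) has_real_derivative dquot (h n) utt y x)
            (at y within {0..T'})"
          by (rule dquot_derivative_t[where f = ut and ft = utt, OF der_t(3)[OF _ x] h0' hT y])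
        show "dquot (h n) utt y x + 2 * b y x * dquot (h n) utx y x
            - (a\<^sup>2 - (b y x)\<^sup>2) * dquot (h n) uxx y x = g n y x"
          unfolding g_def ..
        show "0 \<le> b y x \<and> k * b y x \<le> 1 \<and> b y x \<le> 2 * s \<and> \<bar>ut y x\<bar> \<le> s \<and> \<bar>bx y x\<bar> \<le> 2 * s"
          by (rule b_bounds[OF yT(1) x])
        note cl = cl[OF y x]
        show "\<bar>g n y x\<bar> \<le> cA * \<bar>dquot (h n) u y x\<bar> + cB * \<bar>dquot (h n) ux y x\<bar>
            + cD * \<bar>dquot (h n) ut y x\<bar> + (1 + cA + cB + cD) * e"
        proof -
          \<comment> \<open>One e comes from replacing the source by its limit, the others from
            returning from the limits \<open>ut\<close>, \<open>utx\<close>, \<open>utt\<close> to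
            the quotients; together they make up the uniform error (1 + cA + cB + cD) e.\<close>
          have "\<bar>g n y x\<bar> \<le> \<bar>gt y x\<bar> + e" using cl(4) by linarith
          also have "\<bar>gt y x\<bar> \<le> cA * \<bar>ut y x\<bar> + cB * \<bar>utx y x\<bar> + cD * \<bar>utt y x\<bar>"
              by (rule gt_bound[OF yT(1) x])
          also have "cA * \<bar>ut y x\<bar> \<le> cA * (\<bar>dquot (h n) u y x\<bar> + e)"
              by (rule mult_left_mono[OF _ coeff_nonneg(1)]) (use cl(1) in linarith)
          also have "cB * \<bar>utx y x\<bar> \<le> cB * (\<bar>dquot (h n) ux y x\<bar> + e)"
              by (rule mult_left_mono[OF _ coeff_nonneg(2)]) (use cl(2) in linarith)
          also have "cD * \<bar>utt y x\<bar> \<le> cD * (\<bar>dquot (h n) ut y x\<bar> + e)"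
              by (rule mult_left_mono[OF _ coeff_nonneg(3)]) (use cl(3) in linarith)
          finally show ?thesis by (simp add: algebra_simps)
        qed
        show "2 * k * \<bar>dquot (h n) ut y x\<bar> + 2 * \<bar>dquot (h n) ux y x\<bar> \<le> N"
        proof -
          have "\<bar>dquot (h n) ut y x\<bar> \<le> M + 1" "\<bar>dquot (h n) ux y x\<bar> \<le> M + 1"
              using cl(2,3) M[OF yT(1) x] e by linarith+
          then show ?thesis unfolding N_def using ak by (intro add_mono mult_left_mono) auto
        qed
      next
        fix y assume y: "y \<in> {0..T'}"
        note yT = tT[OF y]
        show "dquot (h n) ux y 0 = k * dquot (h n) ut y 0" "dquot (h n) u y L = 0"
            "dquot (h n) ut y L = 0"
          unfolding dquot_def using bc[OF yT(1)] bc[OF yT(2)] utL[OF yT(1)] utL[OF yT(2)]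
              by (simp_all add: right_diff_distrib)
      next
        show "0 \<le> (1 + cA + cB + cD) * e" using e coeff_nonneg by simp
        show "cont_rect T' L b" "cont_rect T' L ut" "cont_rect T' L bx"
          by (rule cont_rect_subset[OF b_cont(1) T'T] cont_rect_subset[OF cont(3) T'T]
              cont_rect_subset[OF b_cont(2) T'T])+
        show "cont_rect T' L (dquot (h n) ux)" "cont_rect T' L (dquot (h n) ut)"
            "cont_rect T' L (dquot (h n) utx)"
          "cont_rect T' L (dquot (h n) uxx)" "cont_rect T' L (dquot (h n) utt)"
          by (rule cont_rect_dquot[OF cont(2) h0 hT] cont_rect_dquot[OF cont(3) h0 hT]
              cont_rect_dquot[OF cont(5) h0 hT]
              cont_rect_dquot[OF cont(6) h0 hT] cont_rect_dquot[OF cont(4) h0 hT])+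
      qed (rule ak L s0 coeff_nonneg coeff_bounds)+
      then show "En n t \<le> exp (- \<mu> * t) * En n 0 + K * e" unfolding K_def by (simp add: mult_ac)
    qed
  qed
  show ?thesis
  proof (rule field_le_epsilon)
    fix e :: real assume e: "0 < e"
    define e' where "e' = min 1 (e / (\<bar>K\<bar> + 1))"
    have e': "0 < e'" "e' \<le> 1" "e' \<le> e / (\<bar>K\<bar> + 1)" unfolding e'_def using e by auto
    have "K * e' \<le> (\<bar>K\<bar> + 1) * e'" using e' by (intro mult_right_mono) auto
    also have "\<dots> \<le> e" using e' by (simp add: field_simps)
    finally show "energy2 t \<le> exp (- \<mu> * t) * energy2 0 + e" using *[OF e'(1,2)] by linarith
  qed
qed

text \<open>The final time has no room for a forward quotient and is reached by continuity of
  \<open>energy2\<close>, an integral of functions continuous up to t = T.\<close>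

lemma energy2_decay:
  assumes t: "t \<in> {0..T}"
  shows "energy2 t \<le> exp (- \<mu> * t) * energy2 0"
proof -
  have *: "energy2 t - exp (- \<mu> * t) * energy2 0 \<le> 0" if "t \<in> {0..<T}" for t
  proof -
    have "energy2 t \<le> exp (- \<mu> * t) * energy2 0"
      by (rule energy2_decay_interior[of "(t + T) / 2"]) (use that T in auto)
    then show ?thesis by simp
  qed
  define h where "h x = exp (- x / L)" for x
  have "continuous_on {0..L} h" unfolding h_def using L by (auto intro!: continuous_intros)
  then have "cont_rect T L (\<lambda>t x. edens a k (h x) (b t x) (utx t x) (utt t x))"
    unfolding edens_def by (intro continuous_intros cont b_cont cont_snd)
  then have "continuous_on {0..T} energy2"
    unfolding energy2_def[abs_def] h_def by (rule cont_rect_integral)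
  then have "continuous_on {0..T} (\<lambda>t. energy2 t - exp (- \<mu> * t) * energy2 0)"
      by (intro continuous_intros)
  moreover have "closure {0..<T} = {0..T}" using T by simp
  ultimately have "energy2 t - exp (- \<mu> * t) * energy2 0 \<le> 0"
    using continuous_le_on_closure[of "{0..<T}" "\<lambda>t. energy2 t - exp (- \<mu> * t) * energy2 0" t 0] * t
        by simp
  then show ?thesis by simp
qed

end
end

section \<open>Equivalence with the Sobolev norm\<close>

text \<open>These constants depend on \<open>a\<close> instead of \<open>s\<close>, so that they are the same for all solutions.\<close>

definition src_const :: "real \<Rightarrow> real \<Rightarrow> real \<Rightarrow> real" where
  "src_const a \<theta> V = (8 * a^2 + 9 * \<theta> * a^2 + 3 * a * V) + (6 * a^2 + 3/2 * \<theta> * a^2)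
      + (4 * a + 2 * \<theta> * a)"

definition norm_energy_const :: "real \<Rightarrow> real \<Rightarrow> real \<Rightarrow> real \<Rightarrow> real \<Rightarrow> real" where
  "norm_energy_const a k \<theta> L V =
     (1 + 20 * (1 + a + src_const a \<theta> V)^2 / a^4) * (1 + L^2) / (53 / 64 * k * min 1 (a^2))"

definition energy_norm_const :: "real \<Rightarrow> real \<Rightarrow> real \<Rightarrow> real \<Rightarrow> real" where
  "energy_norm_const a k \<theta> V = 2 * k * (1 + a^2) * (1 + 5 * (a^2 + a + src_const a \<theta> V)^2)"

lemma sum5_squared:
  fixes y1 y2 y3 y4 y5 :: real
  shows "(y1 + y2 + y3 + y4 + y5)^2 \<le> 5 * (y1^2 + y2^2 + y3^2 + y4^2 + y5^2)"
proof -
  have "0 \<le> (y1-y2)^2 + (y1-y3)^2 + (y1-y4)^2 + (y1-y5)^2 + (y2-y3)^2 + (y2-y4)^2 + (y2-y5)^2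
     + (y3-y4)^2 + (y3-y5)^2 + (y4-y5)^2" by simp
  also have "\<dots> = 5 * (y1^2 + y2^2 + y3^2 + y4^2 + y5^2) - (y1 + y2 + y3 + y4 + y5)^2" by algebra
  finally show ?thesis by simp
qed

lemma square_le_of_abs_le:
  fixes y m y1 y2 y3 y4 y5 :: real
  assumes "\<bar>y\<bar> \<le> m * (\<bar>y1\<bar> + \<bar>y2\<bar> + \<bar>y3\<bar> + \<bar>y4\<bar> + \<bar>y5\<bar>)"
  shows "y^2 \<le> 5 * m^2 * (y1^2 + y2^2 + y3^2 + y4^2 + y5^2)"
proof -
  have "\<bar>y\<bar>^2 \<le> (m * (\<bar>y1\<bar> + \<bar>y2\<bar> + \<bar>y3\<bar> + \<bar>y4\<bar> + \<bar>y5\<bar>))^2"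
    by (rule power_mono[OF assms]) simp
  also have "\<dots> \<le> m^2 * (5 * (\<bar>y1\<bar>^2 + \<bar>y2\<bar>^2 + \<bar>y3\<bar>^2 + \<bar>y4\<bar>^2 + \<bar>y5\<bar>^2))"
    unfolding power_mult_distrib by (rule mult_left_mono[OF sum5_squared]) simp
  finally show ?thesis by (simp only: power2_abs mult.assoc mult.left_commute[of "m^2" 5])
qed

context perturbed_wave
begin

definition "norm2 t = integral {0..L} (\<lambda>x. (u t x)^2 + (ux t x)^2 + (uxx t x)^2 + (ut t x)^2
    + (utx t x)^2)"
definition "energy t = energy1 t + energy2 t"

lemma slices:
  assumes "t \<in> {0..T}"
  shows "continuous_on {0..L} (u t)" "continuous_on {0..L} (ux t)" "continuous_on {0..L} (ut t)"
    "continuous_on {0..L} (utt t)" "continuous_on {0..L} (utx t)" "continuous_on {0..L} (uxx t)"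
    "continuous_on {0..L} (b t)"
  by (rule cont_rect_slice[OF cont(1) assms] cont_rect_slice[OF cont(2) assms]
      cont_rect_slice[OF cont(3) assms]
     cont_rect_slice[OF cont(4) assms] cont_rect_slice[OF cont(5) assms]
         cont_rect_slice[OF cont(6) assms]
     cont_rect_slice[OF b_cont(1) assms])+

lemma edens_integrable:
  assumes t: "t \<in> {0..T}"
  shows "(\<lambda>x. edens a k (exp (- x / L)) (b t x) (ux t x) (ut t x)) integrable_on {0..L}"
    "(\<lambda>x. edens a k (exp (- x / L)) (b t x) (utx t x) (utt t x)) integrable_on {0..L}"
proof -
  define h where "h x = exp (- x / L)" for x
  have h: "continuous_on {0..L} h" unfolding h_def using L by (auto intro!: continuous_intros)
  show "(\<lambda>x. edens a k (exp (- x / L)) (b t x) (ux t x) (ut t x)) integrable_on {0..L}"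
    "(\<lambda>x. edens a k (exp (- x / L)) (b t x) (utx t x) (utt t x)) integrable_on {0..L}"
    unfolding edens_def h_def[symmetric]
    by (intro integrable_continuous_real continuous_intros slices[OF t] h)+
qed

lemma energy_integral:
  assumes t: "t \<in> {0..T}"
  shows "energy t = integral {0..L} (\<lambda>x. edens a k (exp (- x / L)) (b t x) (ux t x) (ut t x)
    + edens a k (exp (- x / L)) (b t x) (utx t x) (utt t x))"
  unfolding energy_def energy1_def energy2_def
      by (rule integral_add[symmetric, OF edens_integrable[OF t]])

section \<open>Comparison of energy and norm, with constants that see the stationary state only
  through \<open>V\<close>\<close>

context
  fixes V :: real
  assumes V: "\<And>x. x \<in> {0..L} \<Longrightarrow> \<bar>v'' x\<bar> \<le> V"
begin

lemma V0: "0 \<le> V" using V[of 0] L by simp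

lemma src_const0: "0 \<le> src_const a \<theta> V"
  unfolding src_const_def using ak \<theta> V0 by simp

lemma src_const_bound:
  assumes tx: "t \<in> {0..T}" "x \<in> {0..L}"
  shows "\<bar>src \<theta> (v x) (v' x) (v'' x) (u t x) (ux t x) (ut t x)\<bar>
    \<le> src_const a \<theta> V * (\<bar>u t x\<bar> + \<bar>ux t x\<bar> + \<bar>ut t x\<bar>)"
proof -
  note bb = bounds[OF tx]
  \<comment> \<open>The general source bound is applied with s := a and Z := 4/3 V, which removes
    the dependence on the individual solution.\<close>
  have "\<bar>v x\<bar> \<le> a" "\<bar>v' x\<bar> \<le> a" "\<bar>v'' x\<bar> \<le> 3/4 * (4/3 * V)" "\<bar>u t x\<bar> \<le> a" "\<bar>ux t x\<bar> \<le> a"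
    using bb s V[OF tx(2)] by auto
  moreover have "9/4 * a * (4/3 * V) = 3 * a * V" by simp
  ultimately
  have "\<bar>src \<theta> (v x) (v' x) (v'' x) (u t x) (ux t x) (ut t x)\<bar>
      \<le> (8 * a^2 + 9 * \<theta> * a^2 + 3 * a * V) * \<bar>u t x\<bar>
     + (6 * a^2 + 3/2 * \<theta> * a^2) * \<bar>ux t x\<bar> + (4 * a + 2 * \<theta> * a) * \<bar>ut t x\<bar>"
    using src_bound[OF \<theta>, of "v x" a "v' x" "v'' x" "4/3 * V" "u t x" "ux t x" "ut t x"]
        by presburger
  also have "\<dots> \<le> src_const a \<theta> V * \<bar>u t x\<bar> + src_const a \<theta> V * \<bar>ux t x\<bar>
      + src_const a \<theta> V * \<bar>ut t x\<bar>"
  proof (intro add_mono mult_right_mono)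
    have p: "0 \<le> 8 * a^2 + 9 * \<theta> * a^2 + 3 * a * V" "0 \<le> 6 * a^2 + 3/2 * \<theta> * a^2"
        "0 \<le> 4 * a + 2 * \<theta> * a"
      using ak \<theta> V0 by simp_all
    show "8 * a^2 + 9 * \<theta> * a^2 + 3 * a * V \<le> src_const a \<theta> V"
        "6 * a^2 + 3/2 * \<theta> * a^2 \<le> src_const a \<theta> V"
      "4 * a + 2 * \<theta> * a \<le> src_const a \<theta> V"
      unfolding src_const_def using p by linarith+
  qed auto
  finally show ?thesis by (simp add: algebra_simps)
qed

lemma speed_bounds:
  assumes tx: "t \<in> {0..T}" "x \<in> {0..L}"
  shows "\<bar>2 * b t x\<bar> \<le> a" "a^2 / 2 \<le> a^2 - (b t x)^2" "a^2 - (b t x)^2 \<le> a^2" "0 \<le> b t x"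
      "k * b t x \<le> 1"
proof -
  note bb = b_bounds[OF tx]
  show b: "0 \<le> b t x" "k * b t x \<le> 1" using bb by auto
  note sp = speed_bound[OF ak b]
  show "\<bar>2 * b t x\<bar> \<le> a" using sp(1) b ak by simp
  have "0 \<le> a^2" by simp
  then show "a^2 / 2 \<le> a^2 - (b t x)^2" using sp(3) by linarith
qed simp

text \<open>The norm contains u_xx but not u_tt, the energies contain u_tt but not u_xx. The
  equation exchanges the two, here by dividing by the subsonic factor, which is at least a^2 / 2;
  \<open>utt_square\<close> is the opposite direction. The constant 20 is 4 from this division times
  5 from the square of a sum of five terms.\<close>

lemma uxx_square:
  assumes tx: "t \<in> {0..T}" "x \<in> {0..L}"
  shows "(uxx t x)^2 \<le> 20 * (1 + a + src_const a \<theta> V)^2 / a^4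
     * ((u t x)^2 + (ux t x)^2 + (ut t x)^2 + (utx t x)^2 + (utt t x)^2)"
proof -
  define c where "c = a^2 - (b t x)^2"
  have c: "a^2 / 2 \<le> c" using speed_bounds(2)[OF tx] unfolding c_def .
  have c0: "0 < a^2 / 2" using ak by simp
  define F where "F = src \<theta> (v x) (v' x) (v'' x) (u t x) (ux t x) (ut t x)"
  define m where "m = 1 + a + src_const a \<theta> V"
  have "c * uxx t x = utt t x + (2 * b t x) * utx t x - F"
    using pde[OF tx] unfolding c_def b_def F_def by simp
  then have "\<bar>c * uxx t x\<bar> \<le> \<bar>utt t x\<bar> + \<bar>(2 * b t x) * utx t x\<bar> + \<bar>F\<bar>" by linarith
  moreover have "\<bar>(2 * b t x) * utx t x\<bar> \<le> a * \<bar>utx t x\<bar>"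
    unfolding abs_mult[of "2 * b t x"] by (rule mult_right_mono[OF speed_bounds(1)[OF tx]]) simp
  moreover have "\<bar>F\<bar> \<le> src_const a \<theta> V * (\<bar>u t x\<bar> + \<bar>ux t x\<bar> + \<bar>ut t x\<bar>)"
    unfolding F_def by (rule src_const_bound[OF tx])
  ultimately have "\<bar>c * uxx t x\<bar> \<le> \<bar>utt t x\<bar> + a * \<bar>utx t x\<bar>
      + src_const a \<theta> V * (\<bar>u t x\<bar> + \<bar>ux t x\<bar> + \<bar>ut t x\<bar>)"
    by simp
  also have "\<bar>utt t x\<bar> + a * \<bar>utx t x\<bar> + src_const a \<theta> V * (\<bar>u t x\<bar> + \<bar>ux t x\<bar> + \<bar>ut t x\<bar>)
     \<le> m * \<bar>utt t x\<bar> + m * \<bar>utx t x\<bar> + m * (\<bar>u t x\<bar> + \<bar>ux t x\<bar> + \<bar>ut t x\<bar>)"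
  proof (intro add_mono mult_right_mono)
    show "\<bar>utt t x\<bar> \<le> m * \<bar>utt t x\<bar>" using mult_right_mono[of 1 m
        "\<bar>utt t x\<bar>"] ak src_const0 unfolding m_def by simp
  qed (use ak src_const0 in \<open>auto simp: m_def\<close>)
  also have "\<dots> = m * (\<bar>u t x\<bar> + \<bar>ux t x\<bar> + \<bar>ut t x\<bar> + \<bar>utx t x\<bar> + \<bar>utt t x\<bar>)" by algebra
  finally have "(c * uxx t x)^2 \<le> 5 * m^2 * ((u t x)^2 + (ux t x)^2 + (ut t x)^2 + (utx t x)^2
      + (utt t x)^2)"
    by (rule square_le_of_abs_le)
  moreover have "(a^2 / 2)^2 * (uxx t x)^2 \<le> (c * uxx t x)^2"
    unfolding power_mult_distrib using c c0 by (intro mult_right_mono power_mono) auto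
  moreover have "(a^2 / 2)^2 = a^4 / 4" by (simp add: power_divide flip: power_mult)
  ultimately have "a^4 / 4 * (uxx t x)^2 \<le> 5 * m^2 * ((u t x)^2 + (ux t x)^2 + (ut t x)^2
      + (utx t x)^2 + (utt t x)^2)"
    by simp
  then have "4 / a^4 * (a^4 / 4 * (uxx t x)^2)
      \<le> 4 / a^4 * (5 * m^2 * ((u t x)^2 + (ux t x)^2 + (ut t x)^2 + (utx t x)^2 + (utt t x)^2))"
    by (rule mult_left_mono) simp
  then show ?thesis using ak unfolding m_def[symmetric] by simp
qed

lemma utt_square:
  assumes tx: "t \<in> {0..T}" "x \<in> {0..L}"
  shows "(utt t x)^2 \<le> 5 * (a^2 + a + src_const a \<theta> V)^2
     * ((u t x)^2 + (ux t x)^2 + (uxx t x)^2 + (ut t x)^2 + (utx t x)^2)"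
proof (rule square_le_of_abs_le)
  define c where "c = a^2 - (b t x)^2"
  have c: "\<bar>c\<bar> \<le> a^2" using speed_bounds(2,3)[OF tx] zero_le_power2[of a] unfolding c_def
      by linarith
  define F where "F = src \<theta> (v x) (v' x) (v'' x) (u t x) (ux t x) (ut t x)"
  define m where "m = a^2 + a + src_const a \<theta> V"
  have "utt t x = c * uxx t x - (2 * b t x) * utx t x + F"
    using pde[OF tx] unfolding c_def b_def F_def by simp
  then have "\<bar>utt t x\<bar> \<le> \<bar>c * uxx t x\<bar> + \<bar>(2 * b t x) * utx t x\<bar> + \<bar>F\<bar>" by linarith
  moreover have "\<bar>c * uxx t x\<bar> \<le> a^2 * \<bar>uxx t x\<bar>"
    unfolding abs_mult by (rule mult_right_mono[OF c]) simp
  moreover have "\<bar>(2 * b t x) * utx t x\<bar> \<le> a * \<bar>utx t x\<bar>"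
    unfolding abs_mult[of "2 * b t x"] by (rule mult_right_mono[OF speed_bounds(1)[OF tx]]) simp
  moreover have "\<bar>F\<bar> \<le> src_const a \<theta> V * (\<bar>u t x\<bar> + \<bar>ux t x\<bar> + \<bar>ut t x\<bar>)"
    unfolding F_def by (rule src_const_bound[OF tx])
  ultimately have "\<bar>utt t x\<bar> \<le> a^2 * \<bar>uxx t x\<bar> + a * \<bar>utx t x\<bar>
      + src_const a \<theta> V * (\<bar>u t x\<bar> + \<bar>ux t x\<bar> + \<bar>ut t x\<bar>)"
    by simp
  also have "a^2 * \<bar>uxx t x\<bar> + a * \<bar>utx t x\<bar> + src_const a \<theta> V * (\<bar>u t x\<bar> + \<bar>ux t x\<bar> + \<bar>ut t x\<bar>)
     \<le> m * \<bar>uxx t x\<bar> + m * \<bar>utx t x\<bar> + m * (\<bar>u t x\<bar> + \<bar>ux t x\<bar> + \<bar>ut t x\<bar>)"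
    by (intro add_mono mult_right_mono) (use ak src_const0 in \<open>auto simp: m_def\<close>)
  also have "\<dots> = m * (\<bar>u t x\<bar> + \<bar>ux t x\<bar> + \<bar>uxx t x\<bar> + \<bar>ut t x\<bar> + \<bar>utx t x\<bar>)" by algebra
  finally show "\<bar>utt t x\<bar> \<le> (a^2 + a + src_const a \<theta> V) * (\<bar>u t x\<bar> + \<bar>ux t x\<bar> + \<bar>uxx t x\<bar> + \<bar>ut t x\<bar>
      + \<bar>utx t x\<bar>)"
    unfolding m_def .
qed

lemma exp_weight: "0 \<le> exp (- x / L)" "exp (- x / L) \<le> 1" if "x \<in> {0..L}" for x
  using that L by auto

lemma energy_le_norm:
  assumes t: "t \<in> {0..T}"
  shows "energy t \<le> energy_norm_const a k \<theta> V * norm2 t"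
proof -
  define m where "m = 5 * (a^2 + a + src_const a \<theta> V)^2"
  have m0: "0 \<le> m" unfolding m_def by simp
  have e: "edens a k (exp (- x / L)) (b t x) p q \<le> 2 * k * (1 + a^2) * (p^2 + q^2)"
      if x: "x \<in> {0..L}" for x p q
  proof -
    note sp = speed_bounds[OF t x]
    have "edens a k (exp (- x / L)) (b t x) p q
        \<le> k * (1 + 8 / 63 * exp (- x / L)) * (q^2 + (a^2 - (b t x)^2) * p^2)"
      by (rule edens_upper[OF ak sp(4,5) exp_weight[OF x]])
    also have "\<dots> \<le> k * 2 * ((1 + a^2) * (p^2 + q^2))"
    proof (intro mult_mono)
      have "(a^2 - (b t x)^2) * p^2 \<le> (1 + a^2) * p^2"
          by (rule mult_right_mono) (use sp(3) in linarith, simp)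
      moreover have "q^2 \<le> (1 + a^2) * q^2" using mult_right_mono[of 1 "1 + a^2" "q^2"] by simp
      ultimately show "q^2 + (a^2 - (b t x)^2) * p^2 \<le> (1 + a^2) * (p^2 + q^2)"
          unfolding distrib_left by linarith
      have "0 \<le> a^2" by simp
      then show "0 \<le> q^2 + (a^2 - (b t x)^2) * p^2"
          using sp(2) by (intro add_nonneg_nonneg mult_nonneg_nonneg zero_le_power2) linarith
      show "1 + 8 / 63 * exp (- x / L) \<le> 2" using exp_weight(2)[OF x] by linarith
    qed (use ak exp_weight(1)[OF x] in auto)
    also have "\<dots> = 2 * k * (1 + a^2) * (p^2 + q^2)" by algebra
    finally show ?thesis .
  qed
  have "energy t \<le> integral {0..L} (\<lambda>x. energy_norm_const a k \<theta> V * ((u t x)^2 + (ux t x)^2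
      + (uxx t x)^2 + (ut t x)^2 + (utx t x)^2))"
    unfolding energy_integral[OF t]
  proof (rule integral_le)
    fix x assume x: "x \<in> {0..L}"
    define Y where "Y = (u t x)^2 + (ux t x)^2 + (uxx t x)^2 + (ut t x)^2 + (utx t x)^2"
    have "edens a k (exp (- x / L)) (b t x) (ux t x) (ut t x)
        + edens a k (exp (- x / L)) (b t x) (utx t x) (utt t x)
      \<le> 2 * k * (1 + a^2) * ((ux t x)^2 + (ut t x)^2) + 2 * k * (1 + a^2) *
          ((utx t x)^2 + (utt t x)^2)"
      by (rule add_mono[OF e[OF x] e[OF x]])
    also have "\<dots> = 2 * k * (1 + a^2) * ((ux t x)^2 + (ut t x)^2 + (utx t x)^2 + (utt t x)^2)"
        by algebra
    also have "\<dots> \<le> 2 * k * (1 + a^2) * ((1 + m) * Y)"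
    proof (rule mult_left_mono)
      have "(utt t x)^2 \<le> m * Y" using utt_square[OF t x] unfolding m_def Y_def .
      moreover have "(ux t x)^2 + (ut t x)^2 + (utx t x)^2 \<le> Y" unfolding Y_def by simp
      ultimately show "(ux t x)^2 + (ut t x)^2 + (utx t x)^2 + (utt t x)^2 \<le> (1 + m) * Y"
          unfolding distrib_right by linarith
    qed (use ak in simp)
    finally show "edens a k (exp (- x / L)) (b t x) (ux t x) (ut t x)
        + edens a k (exp (- x / L)) (b t x) (utx t x) (utt t x)
      \<le> energy_norm_const a k \<theta> V * ((u t x)^2 + (ux t x)^2 + (uxx t x)^2 + (ut t x)^2 +
          (utx t x)^2)"
      unfolding energy_norm_const_def m_def[symmetric] Y_def[symmetric] by (simp add: mult_ac)
  qed (intro integrable_add edens_integrable[OF t] integrable_continuous_real continuous_intros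
      slices[OF t])+
  then show ?thesis unfolding norm2_def by simp
qed

text \<open>Two summands of the norm are absent from the energy: u_xx is recovered by
  \<open>uxx_square\<close>, and u by Poincare, which accounts for the factor 1 + L^2. The minimum
  with a^2 passes from a^2 p^2 + q^2 to p^2 + q^2.\<close>

lemma norm_le_energy:
  assumes t: "t \<in> {0..T}"
  shows "norm2 t \<le> norm_energy_const a k \<theta> L V * energy t"
proof -
  define K where "K = 20 * (1 + a + src_const a \<theta> V)^2 / a^4"
  define \<nu> where "\<nu> = 53 / 64 * k * min 1 (a^2)"
  have \<nu>: "0 < \<nu>" unfolding \<nu>_def using ak by simp
  have K0: "0 \<le> K" unfolding K_def by simp
  define I where "I f = integral {0..L} (\<lambda>x. (f t x)^2 :: real)" for f
  have ii: "(\<lambda>x. (f t x)^2) integrable_on {0..L}" if "continuous_on {0..L} (f t)"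
      for f :: "real \<Rightarrow> real \<Rightarrow> real"
    using that by (intro integrable_continuous_real continuous_intros)
  have I: "((\<lambda>x. (f t x)^2) has_integral I f) {0..L}" if "continuous_on {0..L} (f t)" for f
    unfolding I_def using ii[where f = f, OF that] by (rule integrable_integral)
  note IS = I[where f = u, OF slices(1)[OF t]]
    I[where f = ux, OF slices(2)[OF t]]
    I[where f = ut, OF slices(3)[OF t]]
    I[where f = utt, OF slices(4)[OF t]]
    I[where f = utx, OF slices(5)[OF t]]
    I[where f = uxx, OF slices(6)[OF t]]
  have I0: "0 \<le> I ut" "0 \<le> I utx" "0 \<le> I utt"
    by (rule has_integral_nonneg[OF IS(3)] has_integral_nonneg[OF IS(5)]
        has_integral_nonneg[OF IS(4)]; simp)+
  have pc: "I u \<le> L^2 * I ux"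
    unfolding I_def by (rule poincare[OF L slices(2)[OF t] der_x(1)[OF t] bc(2)[OF t]])
  have "I uxx \<le> K * (I u + I ux + I ut + I utx + I utt)"
  proof (rule has_integral_le[OF IS(6)])
    show "((\<lambda>x. K * ((u t x)^2 + (ux t x)^2 + (ut t x)^2 + (utx t x)^2
        + (utt t x)^2)) has_integral K * (I u + I ux + I ut + I utx + I utt)) {0..L}"
      by (intro has_integral_mult_right has_integral_add IS)
    show "(uxx t x)^2 \<le> K * ((u t x)^2 + (ux t x)^2 + (ut t x)^2 + (utx t x)^2 + (utt t x)^2)"
        if "x \<in> {0..L}" for x
      unfolding K_def by (rule uxx_square[OF t that])
  qed
  moreover have "norm2 t = I u + I ux + I uxx + I ut + I utx"
    unfolding norm2_def by (rule integral_unique) (intro has_integral_add IS)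
  ultimately have "norm2 t \<le> (1 + K) * (I u + I ux + I ut + I utx + I utt)"
    using I0(3) by (simp add: algebra_simps)
  also have "\<dots> \<le> (1 + K) * ((1 + L^2) * (I ux + I ut + I utx + I utt))"
  proof (rule mult_left_mono)
    have "I u + I ux \<le> (1 + L^2) * I ux" using pc unfolding distrib_right by simp
    moreover have "1 * (I ut + I utx + I utt) \<le> (1 + L^2) * (I ut + I utx + I utt)"
      using I0 by (intro mult_right_mono) auto
    ultimately show "I u + I ux + I ut + I utx + I utt \<le> (1 + L^2) * (I ux + I ut + I utx + I utt)"
      unfolding distrib_left by linarith
  qed (use K0 in simp)
  also have "I ux + I ut + I utx + I utt \<le> energy t / \<nu>"
  proof -
    have "\<nu> * (I ux + I ut + (I utx + I utt)) \<le> energy t"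
    proof (rule has_integral_le)
      show "((\<lambda>x. \<nu> * ((ux t x)^2 + (ut t x)^2
          + ((utx t x)^2 + (utt t x)^2))) has_integral \<nu> * (I ux + I ut + (I utx + I utt))) {0..L}"
        by (intro has_integral_mult_right has_integral_add IS)
      show "((\<lambda>x. edens a k (exp (- x / L)) (b t x) (ux t x) (ut t x)
          + edens a k (exp (- x / L)) (b t x) (utx t x) (utt t x)) has_integral energy t) {0..L}"
        unfolding energy_integral[OF t] by
            (intro integrable_integral integrable_add edens_integrable[OF t])
      fix x assume x: "x \<in> {0..L}"
      have e: "\<nu> * (p^2 + q^2) \<le> edens a k (exp (- x / L)) (b t x) p q" for p q
      proof -
        have "\<nu> * (p^2 + q^2) = 53 / 64 * k * (min 1 (a^2) * p^2 + min 1 (a^2) * q^2)"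
            unfolding \<nu>_def by algebra
        also have "\<dots> \<le> 53 / 64 * k * (a^2 * p^2 + 1 * q^2)"
          using ak by (intro mult_left_mono add_mono mult_right_mono) auto
        also have "\<dots> \<le> edens a k (exp (- x / L)) (b t x) p q"
          using edens_lower[OF ak speed_bounds(4,5)[OF t x] exp_weight[OF x], of p q] by simp
        finally show ?thesis .
      qed
      show "\<nu> * ((ux t x)^2 + (ut t x)^2 + ((utx t x)^2 + (utt t x)^2))
        \<le> edens a k (exp (- x / L)) (b t x) (ux t x) (ut t x) + edens a k (exp (- x / L)) (b t x)
            (utx t x) (utt t x)"
        unfolding distrib_left[of \<nu> "(ux t x)^2 + (ut t x)^2"] by (rule add_mono[OF e e])
    qed
    then show ?thesis using \<nu> by (simp add: field_simps)
  qed
  finally have "norm2 t \<le> (1 + K) * ((1 + L^2) * (energy t / \<nu>))"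
      using K0 by (simp add: mult_left_mono)
  then show ?thesis unfolding norm_energy_const_def K_def[symmetric] \<nu>_def[symmetric] by simp
qed

lemma norm2_decay:
  assumes t: "t \<in> {0..T}" and \<mu>: "0 < \<mu>" "\<mu> \<le> 7 / (8 * exp 1 * L * k) - 5 / 2 * cR / (k * a^2)"
  shows "norm2 t \<le> norm_energy_const a k \<theta> L V * energy_norm_const a k \<theta> V * exp (- \<mu> * t) * norm2
      0"
proof -
  have n0: "0 \<le> norm_energy_const a k \<theta> L V" unfolding norm_energy_const_def using ak by simp
  have e0: "energy 0 \<le> energy_norm_const a k \<theta> V * norm2 0"
    by (rule energy_le_norm) (use T in simp)
  have "energy t \<le> exp (- \<mu> * t) * energy 0"
    using energy1_decay[OF \<mu> t] energy2_decay[OF \<mu> t] unfolding energy_def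
        by (simp add: distrib_left)
  also have "\<dots> \<le> exp (- \<mu> * t) * (energy_norm_const a k \<theta> V * norm2 0)"
    by (rule mult_left_mono[OF e0]) simp
  finally have e: "energy t \<le> exp (- \<mu> * t) * (energy_norm_const a k \<theta> V * norm2 0)" .
  have "norm2 t \<le> norm_energy_const a k \<theta> L V * energy t" by (rule norm_le_energy[OF t])
  also have "\<dots> \<le> norm_energy_const a k \<theta> L V *
      (exp (- \<mu> * t) * (energy_norm_const a k \<theta> V * norm2 0))"
    by (rule mult_left_mono[OF e n0])
  finally show ?thesis by (simp add: mult_ac)
qed

end

lemma sup_le_norm2:
  assumes t: "t \<in> {0..T}" and x: "x \<in> {0..L}"
  shows "(u t x)^2 \<le> (1 / L + 1) * norm2 t" "(ux t x)^2 \<le> (1 / L + 1) * norm2 t"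
      "(ut t x)^2 \<le> (1 / L + 1) * norm2 t"
proof -
  have le: "(1 / L + 1) * integral {0..L} (\<lambda>x. (f x)^2 + (g x)^2) \<le> (1 / L + 1) * norm2 t"
    if "continuous_on {0..L} f" "continuous_on {0..L} g"
     "\<And>x. (f x)^2 + (g x)^2 \<le> (u t x)^2 + (ux t x)^2 + (uxx t x)^2 + (ut t x)^2 + (utx t x)^2"
         for f g
    unfolding norm2_def
    by (intro mult_left_mono integral_le integrable_continuous_real continuous_intros slices[OF t]
        that(1,2))
      (use that(3) L in auto)
  show "(u t x)^2 \<le> (1 / L + 1) * norm2 t"
    using sobolev[OF L slices(2)[OF t] der_x(1)[OF t] x]
    by (rule order_trans[OF _ le]) (simp_all add: slices[OF t])
  show "(ux t x)^2 \<le> (1 / L + 1) * norm2 t"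
    using sobolev[OF L slices(6)[OF t] der_x(2)[OF t] x]
    by (rule order_trans[OF _ le]) (simp_all add: slices[OF t])
  show "(ut t x)^2 \<le> (1 / L + 1) * norm2 t"
    using sobolev[OF L slices(5)[OF t] der_x(3)[OF t] x]
    by (rule order_trans[OF _ le]) (simp_all add: slices[OF t])
qed

end

section \<open>Partial derivatives on a closed rectangle\<close>

lemma deriv_in_works:
  assumes "f differentiable_on S" "x \<in> S"
  shows "(f has_real_derivative deriv_in S f x) (at x within S)"
  using assms unfolding differentiable_on_def deriv_in_def
      has_real_derivative_iff_has_vector_derivative
  by (simp add: vector_derivative_works[symmetric])

lemma deriv_in_eq:
  assumes "a < b" "x \<in> {a..b}" "(f has_real_derivative d) (at x within {a..b})"
  shows "deriv_in {a..b} f x = d"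
proof (rule DERIV_unique_Icc[OF assms(1,2) _ assms(3)])
  have "f differentiable at x within {a..b}"
    using assms(3) by (auto simp: has_field_derivative_def differentiable_def)
  then show "(f has_real_derivative deriv_in {a..b} f x) (at x within {a..b})"
    unfolding deriv_in_def has_real_derivative_iff_has_vector_derivative
        by (simp add: vector_derivative_works[symmetric])
qed

lemma deriv_in_cong:
  assumes "\<And>y. y \<in> S \<Longrightarrow> f y = g y" "x \<in> S"
  shows "deriv_in S f x = deriv_in S g x"
proof -
  have "(f has_vector_derivative d) (at x within S) \<longleftrightarrow> (g has_vector_derivative d) (at x within S)"
      for d
    using assms by (metis has_vector_derivative_transform)
  then show ?thesis unfolding deriv_in_def vector_derivative_def by simp
qed

text \<open>Differentiate \<open>u t x = u t 0 + \<integral> ux t\<close> in time, then the result in space; this works up to the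
  boundary, where only one-sided derivatives are available.\<close>

lemma mixed_partials:
  fixes u ux ut uxt :: "real \<Rightarrow> real \<Rightarrow> real"
  assumes T: "0 < T"
    and ux: "\<And>t x. t \<in> {0..T} \<Longrightarrow> x \<in> {0..L} \<Longrightarrow> (u t has_real_derivative ux t x) (at x within {0..L})"
    and ut: "\<And>t x. t \<in> {0..T} \<Longrightarrow> x \<in> {0..L}
        \<Longrightarrow> ((\<lambda>t. u t x) has_real_derivative ut t x) (at t within {0..T})"
    and uxt: "\<And>t x. t \<in> {0..T} \<Longrightarrow> x \<in> {0..L}
        \<Longrightarrow> ((\<lambda>t. ux t x) has_real_derivative uxt t x) (at t within {0..T})"
    and cont: "cont_rect T L ux" "cont_rect T L uxt"
    and t: "t \<in> {0..T}" and x: "x \<in> {0..L}"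
  shows "(ut t has_real_derivative uxt t x) (at x within {0..L})"
proof -
  have eq: "ut t y = ut t 0 + integral {0..y} (uxt t)" if y: "y \<in> {0..L}" for y
  proof (rule DERIV_unique_Icc[OF T t ut[OF t y]])
    have sub: "{0..T} \<times> {0..y} \<subseteq> {0..T} \<times> {0..L}" using y by auto
    have i: "((\<lambda>t. integral {0..y} (ux t)) has_real_derivative integral {0..y} (uxt t))
        (at t within {0..T})"
    proof (rule integral_rect_derivative[OF _ _ _ t])
      show "((\<lambda>t. ux t x) has_real_derivative uxt t x) (at t within {0..T})" if "t \<in> {0..T}"
          "x \<in> {0..y}" for t x
        by (rule uxt[OF that(1)]) (use that y in simp)
    qed (rule continuous_on_subset[OF cont(1) sub] continuous_on_subset[OF cont(2) sub])+
    have "((\<lambda>t. u t 0 + integral {0..y} (ux t)) has_real_derivative ut t 0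
        + integral {0..y} (uxt t)) (at t within {0..T})"
      using DERIV_add[OF ut[OF t, of 0] i] y by simp
    then show "((\<lambda>t. u t y) has_real_derivative ut t 0
        + integral {0..y} (uxt t)) (at t within {0..T})"
    proof (rule has_field_derivative_transform_within[OF _ zero_less_one t])
      fix t' assume t': "t' \<in> {0..T}"
      have "(ux t' has_integral (u t' y - u t' 0)) {0..y}"
      proof (rule fundamental_theorem_of_calculus)
        fix z assume z: "z \<in> {0..y}"
        have "(u t' has_real_derivative ux t' z) (at z within {0..y})"
          by (rule DERIV_subset[OF ux[OF t']]) (use z y in auto)
        then show "(u t' has_vector_derivative ux t' z) (at z within {0..y})"
          by (simp only: has_real_derivative_iff_has_vector_derivative)
      qed (use y in simp)
      then show "u t' 0 + integral {0..y} (ux t') = u t' y" by (simp add: integral_unique)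
    qed
  qed
  have "((\<lambda>y. integral {0..y} (uxt t)) has_real_derivative uxt t x) (at x within {0..L})"
    unfolding has_real_derivative_iff_has_vector_derivative
    by (rule integral_has_vector_derivative[OF cont_rect_slice[OF cont(2) t] x])
  from DERIV_add[OF DERIV_const[of "ut t 0"] this]
  have "((\<lambda>y. ut t 0 + integral {0..y} (uxt t)) has_real_derivative uxt t x) (at x within {0..L})"
      by simp
  then show ?thesis by (rule has_field_derivative_transform_within[OF _ zero_less_one x])
      (rule eq[symmetric])
qed

text \<open>\<open>Ck_rect\<close> supplies the two mixed derivatives as separate continuous
  functions. The last clause identifies them, as the energy method uses a single function for
  both.\<close>

lemma Ck_rect_2D:
  assumes T: "0 < T" and L: "0 < L" and u: "Ck_rect 2 T L u" 
  shows "cont_rect T L u" "cont_rect T L (dx L u)" "cont_rect T L (dt T u)"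
    "cont_rect T L (dt T (dt T u))" "cont_rect T L (dx L (dt T u))" "cont_rect T L (dx L (dx L u))"
    "\<And>t x. t \<in> {0..T} \<Longrightarrow> x \<in> {0..L} \<Longrightarrow> ((\<lambda>t. u t x) has_real_derivative dt T u t x)
        (at t within {0..T})"
    "\<And>t x. t \<in> {0..T} \<Longrightarrow> x \<in> {0..L} \<Longrightarrow> ((\<lambda>t. dt T u t x) has_real_derivative dt T (dt T u) t x)
        (at t within {0..T})"
    "\<And>t x. t \<in> {0..T} \<Longrightarrow> x \<in> {0..L} \<Longrightarrow> (u t has_real_derivative dx L u t x) (at x within {0..L})"
    "\<And>t x. t \<in> {0..T} \<Longrightarrow> x \<in> {0..L} \<Longrightarrow> (dx L u t has_real_derivative dx L (dx L u) t x)
        (at x within {0..L})"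
    "\<And>t x. t \<in> {0..T} \<Longrightarrow> x \<in> {0..L} \<Longrightarrow> (dt T u t has_real_derivative dx L (dt T u) t x)
        (at x within {0..L})"
    "\<And>t x. t \<in> {0..T} \<Longrightarrow> x \<in> {0..L} \<Longrightarrow> ((\<lambda>t. dx L u t x) has_real_derivative dx L (dt T u) t x)
        (at t within {0..T})"
proof -
  note u' = u[unfolded numeral_2_eq_2 Ck_rect.simps case_prod_unfold]
  show c: "cont_rect T L u" "cont_rect T L (dx L u)" "cont_rect T L (dt T u)"
    "cont_rect T L (dt T (dt T u))" "cont_rect T L (dx L (dt T u))" "cont_rect T L (dx L (dx L u))"
    using u' by blast+
  have cxt: "cont_rect T L (dt T (dx L u))" using u' by blast
  have t: "((\<lambda>t. f t x) has_real_derivative dt T f t x) (at t within {0..T})"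
    if "\<forall>x\<in>{0..L}. (\<lambda>t. f t x) differentiable_on {0..T}" "t \<in> {0..T}" "x \<in> {0..L}" for f t x
    using that unfolding dt_def by (intro deriv_in_works) auto
  have x: "(f t has_real_derivative dx L f t x) (at x within {0..L})"
    if "\<forall>t\<in>{0..T}. (\<lambda>x. f t x) differentiable_on {0..L}" "t \<in> {0..T}" "x \<in> {0..L}" for f t x
    using that unfolding dx_def by (intro deriv_in_works) auto
  show d: "((\<lambda>t. u t x) has_real_derivative dt T u t x) (at t within {0..T})"
    "((\<lambda>t. dt T u t x) has_real_derivative dt T (dt T u) t x) (at t within {0..T})"
    "(u t has_real_derivative dx L u t x) (at x within {0..L})"
    "(dx L u t has_real_derivative dx L (dx L u) t x) (at x within {0..L})"
    "(dt T u t has_real_derivative dx L (dt T u) t x) (at x within {0..L})" if "t \<in> {0..T}"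
        "x \<in> {0..L}" for t x
    by (rule t x; use that u' in blast)+
  have xt: "((\<lambda>t. dx L u t x) has_real_derivative dt T (dx L u) t x) (at t within {0..T})"
      if "t \<in> {0..T}" "x \<in> {0..L}" for t x
    by (rule t; use that u' in blast)
  show "((\<lambda>t. dx L u t x) has_real_derivative dx L (dt T u) t x) (at t within {0..T})"
      if tx: "t \<in> {0..T}" "x \<in> {0..L}" for t x
  proof -
    have "(dt T u t has_real_derivative dt T (dx L u) t x) (at x within {0..L})"
      by (rule mixed_partials[OF T d(3) d(1) xt c(2) cxt tx])
    then have "dx L (dt T u) t x = dt T (dx L u) t x"
      unfolding dx_def[of L "dt T u"] by (rule deriv_in_eq[OF L tx(2)])
    then show ?thesis using xt[OF tx] by simp
  qed
qed

lemma Ck_on_2D: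
  assumes "Ck_on 2 S f"
  shows "continuous_on S f" "continuous_on S (deriv_in S f)"
      "continuous_on S (deriv_in S (deriv_in S f))"
    "\<And>x. x \<in> S \<Longrightarrow> (f has_real_derivative deriv_in S f x) (at x within S)"
    "\<And>x. x \<in> S \<Longrightarrow> (deriv_in S f has_real_derivative deriv_in S (deriv_in S f) x) (at x within S)"
  using assms unfolding numeral_2_eq_2 Ck_on.simps by (auto intro: deriv_in_works)

lemma DERIV_isconst_within:
  fixes f :: "real \<Rightarrow> real"
  assumes L: "0 < L" and d: "\<And>x. x \<in> {0..L} \<Longrightarrow> (f has_real_derivative 0) (at x within {0..L})"
      and x: "x \<in> {0..L}"
  shows "f x = f 0"
proof -
  have "f x \<le> f 0" using x by (intro nonincreasing_within[OF _ _ d]) auto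
  moreover have "- f x \<le> - f 0"
    using x by (intro nonincreasing_within[of x L "\<lambda>x. - f x"
        "\<lambda>_. 0"]) (auto intro: DERIV_minus[OF d, simplified])
  ultimately show ?thesis by simp
qed

text \<open>By the stationary equation, (a^2 - v^2) v' - \<theta>/2 v^3 has derivative 0, and the
  condition on v' at 0 makes this constant vanish.\<close>

lemma stationary_first_integral:
  assumes L: "0 < L" and st: "stationary_subsonic a \<theta> L ub"
    and bc: "deriv_in {0..L} ub 0 = \<theta> / 2 * (\<bar>ub 0\<bar> * (ub 0)^2 / (a^2 - (ub 0)^2))"
    and pos: "\<forall>x\<in>{0..L}. 0 < ub x" and x: "x \<in> {0..L}"
  shows "(a^2 - (ub x)^2) * deriv_in {0..L} ub x = \<theta> / 2 * (ub x)^3"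
proof -
  define v where "v = deriv_in {0..L} ub"
  define w where "w = deriv_in {0..L} v"
  note C = Ck_on_2D[of "{0..L}" ub, folded v_def w_def]
  have Ck: "Ck_on 2 {0..L} ub" using st unfolding stationary_subsonic_def by blast
  have ode: "(a^2 - (ub x)^2) * w x = 2 * ub x * (v x)^2 + 3/2 * \<theta> * ub x * ub x * v x"
      and sub: "\<bar>ub x\<bar> < a"
    if "x \<in> {0..L}" for x
  proof -
    have "\<bar>ub x\<bar> = ub x" using pos that by (simp add: abs_of_pos)
    moreover have "\<bar>ub x\<bar> < a \<and> (a^2 - (ub x)^2) * w x = 2 * ub x * (v x)^2
        + 3/2 * \<theta> * ub x * \<bar>ub x\<bar> * v x"
      using st that unfolding stationary_subsonic_def v_def w_def by blast
    ultimately show "(a^2 - (ub x)^2) * w x = 2 * ub x * (v x)^2 + 3/2 * \<theta> * ub x * ub x * v x"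
        "\<bar>ub x\<bar> < a"
      by simp_all
  qed
  define G where "G x = (a^2 - ub x * ub x) * v x - \<theta> / 2 * (ub x * ub x * ub x)" for x
  have "(G has_real_derivative 0) (at x within {0..L})" if x: "x \<in> {0..L}" for x
  proof -
    have d: "(G has_real_derivative (0 - (v x * ub x + v x * ub x)) * v x
        + w x * (a^2 - ub x * ub x)
       - \<theta> / 2 * ((v x * ub x + v x * ub x) * ub x + v x * (ub x * ub x))) (at x within {0..L})"
      unfolding G_def[abs_def] by (intro DERIV_diff DERIV_mult DERIV_cmult DERIV_const
          C(4,5)[OF Ck x])
    have e: "(0 - (v x * ub x + v x * ub x)) * v x + w x * (a^2 - ub x * ub x)
       - \<theta> / 2 * ((v x * ub x + v x * ub x) * ub x + v x * (ub x * ub x)) = 0"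
      using ode[OF x] by algebra
    show ?thesis using d unfolding e .
  qed
  from DERIV_isconst_within[OF L this x] have "G x = G 0" .
  moreover have "G 0 = 0"
  proof -
    have 0: "0 \<in> {0..L}" using L by simp
    have u0: "0 < ub 0" "ub 0 < a" using sub[OF 0] pos 0 by auto
    then have "(ub 0)^2 < a^2" by (intro power_strict_mono) auto
    moreover define D where "D = a^2 - (ub 0)^2"
    ultimately have D: "0 < D" by simp
    have "v 0 = \<theta> / 2 * (ub 0 * (ub 0)^2 / D)" using bc u0 unfolding v_def D_def by simp
    then have "D * v 0 = \<theta> / 2 * (ub 0 * (ub 0)^2)" using D by simp
    then have "(a^2 - ub 0 * ub 0) * v 0 = \<theta> / 2 * (ub 0 * ub 0 * ub 0)"
      unfolding D_def power2_eq_square by (simp only: mult.assoc)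
    then show ?thesis unfolding G_def by simp
  qed
  ultimately have "G x = 0" by simp
  then show ?thesis unfolding G_def v_def[symmetric] power2_eq_square power3_eq_cube by simp
qed

section \<open>Stationary states and the constants\<close>

text \<open>Eliminating v' by the first integral gives v'' = \<theta>^2 v^5 (3 a^2 - v^2) / (4 (a^2
  - v^2)^3), a nonnegative quantity. Replacing v by s in v^5 and in the denominator, and dropping -
  v^2, yields the bound.\<close>

lemma stationary_second_derivative_bound:
  fixes a \<theta> s v v' v'' :: real
  assumes \<theta>: "0 \<le> \<theta>" and v: "0 < v" "v \<le> s" and s: "s < a"
    and v': "(a^2 - v^2) * v' = \<theta> / 2 * v^3"
    and v'': "(a^2 - v^2) * v'' = 2 * v * v'^2 + 3/2 * \<theta> * v * \<bar>v\<bar> * v'"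
  shows "\<bar>v''\<bar> \<le> 3/4 * (\<theta>^2 * (a^2 * s^5 / (a^2 - s^2)^3))"
proof -
  define c where "c = a^2 - v^2"
  define D where "D = a^2 - s^2"
  have "s^2 < a^2" using v s by (intro power_strict_mono) auto
  then have D: "0 < D" unfolding D_def by simp
  have "v^2 \<le> s^2" using v by (intro power_mono) auto
  then have cD: "D \<le> c" unfolding c_def D_def by simp
  then have c: "0 < c" using D by simp
  have ca: "v^2 = a^2 - c" unfolding c_def by simp
  define i where "i = 1 / c"
  have ci: "c * i = 1" unfolding i_def using c by simp
  have i3: "i^3 / 4 = 1 / (4 * c^3)" unfolding i_def by (simp add: power_divide)
  have e1: "c * v' = \<theta> / 2 * v^3" using v' unfolding c_def .
  have e2: "c * v'' = 2 * v * v'^2 + 3/2 * \<theta> * v * v * v'" using v'' v unfolding c_def by simp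
  have e3: "v' = \<theta> / 2 * v^3 * i" using e1 ci by algebra
  have "v'' = (2 * v * v'^2 + 3/2 * \<theta> * v * v * v') * i" using e2 ci by algebra
  also have "\<dots> = \<theta>^2 * v^5 * (2 * v^2 * i^3 + 3 * i^2) * (1 / 4)"
    unfolding e3 by (simp add: eval_nat_numeral algebra_simps)
  also have "i^2 = c * i^3" using ci by algebra
  also have "\<theta>^2 * v^5 * (2 * v^2 * i^3 + 3 * (c * i^3)) * (1 / 4)
      = \<theta>^2 * v^5 * (2 * v^2 + 3 * c) * (i^3 / 4)"
    by (simp add: algebra_simps)
  also have "2 * v^2 + 3 * c = 3 * a^2 - v^2" unfolding ca by simp
  finally have e2: "v'' = \<theta>^2 * v^5 * (3 * a^2 - v^2) / (4 * c^3)"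
    unfolding i3 by (simp only: times_divide_eq_right mult_1_right)
  have va: "0 \<le> 3 * a^2 - v^2" using ca c zero_le_power2[of a] by linarith
  have "0 \<le> v''" unfolding e2 using c v va
      by (intro divide_nonneg_nonneg mult_nonneg_nonneg) simp_all
  then have "\<bar>v''\<bar> = v''" by (rule abs_of_nonneg)
  also have "v'' = \<theta>^2 * v^5 * (3 * a^2 - v^2) / (4 * c^3)" by (rule e2)
  also have "\<dots> \<le> \<theta>^2 * s^5 * (3 * a^2) / (4 * D^3)"
  proof (rule frac_le)
    show "\<theta>^2 * v^5 * (3 * a^2 - v^2) \<le> \<theta>^2 * s^5 * (3 * a^2)"
    proof (rule mult_mono)
      show "\<theta>^2 * v^5 \<le> \<theta>^2 * s^5" using v by (intro mult_left_mono power_mono) auto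
      show "3 * a^2 - v^2 \<le> 3 * a^2" by simp
    qed (use v va in simp_all)
    show "4 * D^3 \<le> 4 * c^3" using power_mono[OF cD, of 3] D by simp
  qed (use D v in auto)
  also have "\<dots> = 3/4 * (\<theta>^2 * (a^2 * s^5 / D^3))" by simp
  finally show ?thesis unfolding D_def .
qed

text \<open>All fractions are bounded below by polynomials through 0 < a^2 - s^2 \<le> a^2, or
  dropped as nonnegative, with one exception: \<open>Y1\<close> stays a fraction because it has to
  pay for s Z.\<close>

lemma P0_P1_lower:
  fixes a \<theta> k s :: real
  assumes \<theta>: "0 \<le> \<theta>" and k: "0 < k" and s: "0 \<le> s" "s < a"
  defines "Z \<equiv> \<theta>^2 * (a^2 * s^5 / (a^2 - s^2)^3)"
  shows "24 * s + 16 * k * s + 40 * (1 + k) * s^2 + (1 + k) * (10 * \<theta> * s + 36 * \<theta> * s^2)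
      + 5 * (k + 1) * s * Z
    \<le> P0 a \<theta> k s + P1 a \<theta> k s"
proof -
  define D where "D = a^2 - s^2"
  have a: "0 < a" using s by simp
  have s2: "s^2 < a^2" using s by (intro power_strict_mono) auto
  then have D: "0 < D" "D \<le> a^2" unfolding D_def by simp_all
  define X1 where "X1 = a^2 * s / D"
  define X2 where "X2 = (s^4 + 3 * a^2 * s^2) / (2 * D)"
  define X3 where "X3 = (3 * a^2 * s + s^3) / D"
  define Y1 where "Y1 = (3 * a^4 * s^4 + 2 * a^2 * s^6 + s^8) / (2 * D^3)"
  define Y2 where "Y2 = (2 * s^7 + 3 * a^2 * s^5 + 3 * a^4 * s^3) / (4 * D^3)"
  define W where "W = \<theta>^3 * ((9 * a^6 * s^3 + 2 * s^9 + 6 * a^4 * s^5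
      + 11 * a^2 * s^7) / (8 * D^4)) * s
        + \<theta>^2 * ((s^7 + 6 * a^4 * s^3 + 3 * a^2 * s^5) / (2 * D^3)) * s + \<theta> * (s^3 / D) * s"
  define W' where "W' = \<theta>^3 * ((6 * a^6 * s^6 + 4 * a^2 * s^10 + s^12 + 3 * a^4 * s^8) / (2 * D^5))
        + \<theta>^2 * ((a^4 * s^3 + a^2 * s^5) / (2 * D^3)) + \<theta>^2 * (3 * a^4 * s^4 / D^3)"
  have W: "0 \<le> W" "0 \<le> W'" unfolding W_def W'_def using D s \<theta> a by simp_all
  have X1: "s \<le> X1" unfolding X1_def using D s mult_right_mono[OF D(2) s(1)]
      by (simp add: field_simps)
  have X2: "3/2 * s^2 \<le> X2"
  proof -
    have "D * (3 * s^2) \<le> a^2 * (3 * s^2)" using D by (intro mult_right_mono) auto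
    moreover have "0 \<le> s^4" using s by simp
    moreover have "3/2 * s^2 * (2 * D) = D * (3 * s^2)" "3 * a^2 * s^2 = a^2 * (3 * s^2)"
        by simp_all
    ultimately have "3/2 * s^2 * (2 * D) \<le> s^4 + 3 * a^2 * s^2" by linarith
    then show ?thesis unfolding X2_def using D by (intro mult_imp_le_div_pos) simp_all
  qed
  have X3: "3 * s \<le> X3"
  proof -
    have "D * (3 * s) \<le> a^2 * (3 * s)" using D s by (intro mult_right_mono) auto
    moreover have "0 \<le> s^3" using s by simp
    moreover have "3 * s * D = D * (3 * s)" "3 * a^2 * s = a^2 * (3 * s)" by simp_all
    ultimately have "3 * s * D \<le> 3 * a^2 * s + s^3" by linarith
    then show ?thesis unfolding X3_def using D by (intro mult_imp_le_div_pos)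
  qed
  \<comment> \<open>Because s \<le> a, the term 3 a^4 s^4 contributes three further copies of a^2
    s^6 to the two already there; over 2 D^3 this makes 5/2.\<close>
  have Y1: "5/2 * (a^2 * s^6 / D^3) \<le> Y1"
  proof -
    have "s^2 * (a^2 * s^4) \<le> a^2 * (a^2 * s^4)" using s2 by (intro mult_right_mono) auto
    have "5 * (a^2 * s^6) \<le> 3 * a^4 * s^4 + 2 * a^2 * s^6 + s^8"
    proof -
      have "3 * a^4 * s^4 = 3 * (a^2 * (a^2 * s^4))" "a^2 * s^6 = s^2 * (a^2 * s^4)"
          "3 * a^4 * s^4 = 3 * (a^4 * s^4)"
        by algebra+
      moreover have "0 \<le> s^8" using s by simp
      ultimately show ?thesis using \<open>s^2 * (a^2 * s^4) \<le> a^2 * (a^2 * s^4)\<close> by linarith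
    qed
    then have "5 * (a^2 * s^6) / (2 * D^3) \<le> Y1"
        unfolding Y1_def using D by (intro divide_right_mono) auto
    then show ?thesis by simp
  qed
  have Y2: "0 \<le> Y2" unfolding Y2_def using D s by simp
  have sZ: "s * Z = \<theta>^2 * (a^2 * s^6 / D^3)"
    unfolding Z_def D_def by (simp add: eval_nat_numeral)
  define B0 where "B0 = \<theta>^2 * Y1 + \<theta> * X1 + \<theta> * X2 + \<theta>^2 * Y2 * s + 2 * s^2 + \<theta> * X3 * s + 2 * s
      + 2 * s^2 + 3/2 * \<theta> * s^2 + \<theta> * s"
  define B1 where "B1 = W + 4 * s^2 + \<theta> * X3 * (2 * s) + W' + \<theta> * X1 + \<theta> * X2 + 2 * s + 2 * s
      + 2 * s^2 + 4 * s^2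
    + 3 * \<theta> * s^2 + 3/2 * \<theta> * s^2 + \<theta> * s + \<theta> * s"
  have p0: "P0 a \<theta> k s = 4 * k * s^2 + 2 * k * (1 + \<theta>/2) * s + 4 * k * (1 + \<theta>/2) * s^2 + 2 * s
      + 4 * (1 + \<theta>/2) * s^2 + 2 * (k + 1) * B0"
    unfolding P0_def B0_def X1_def X2_def X3_def Y1_def Y2_def D_def ..
  have p1: "P1 a \<theta> k s = 8 * s + 2 * s + 8 * s^2 + 4 * k * s^2 + 4 * k * s + 2 * (k + 1) * B1"
    unfolding P1_def B1_def X1_def X2_def X3_def W_def W'_def D_def by (simp add: add_ac)
  have t: "\<theta> * s \<le> \<theta> * X1" "3/2 * (\<theta> * s^2) \<le> \<theta> * X2" "3 * (\<theta> * s^2) \<le> \<theta> * X3 * s"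
    using mult_left_mono[OF X1 \<theta>] mult_left_mono[OF X2 \<theta>]
        mult_right_mono[OF mult_left_mono[OF X3 \<theta>] s(1)]
    by (simp_all add: power2_eq_square mult_ac)
  have tY2: "0 \<le> \<theta>^2 * Y2 * s" using Y2 s by (intro mult_nonneg_nonneg) simp_all
  have tY: "5/2 * (s * Z) \<le> \<theta>^2 * Y1" unfolding sZ using mult_left_mono[OF Y1, of "\<theta>^2"] by simp
  have B0: "5/2 * (s * Z) + 2 * (\<theta> * s) + 6 * (\<theta> * s^2) + 4 * s^2 + 2 * s \<le> B0"
    unfolding B0_def using t tY tY2 by linarith
  have B1: "3 * (\<theta> * s) + 12 * (\<theta> * s^2) + 10 * s^2 + 4 * s \<le> B1"
    unfolding B1_def using t W by linarith
  have "2 * (k + 1) * (5/2 * (s * Z) + 2 * (\<theta> * s) + 6 * (\<theta> * s^2) + 4 * s^2 + 2 * s)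
      \<le> 2 * (k + 1) * B0"
    "2 * (k + 1) * (3 * (\<theta> * s) + 12 * (\<theta> * s^2) + 10 * s^2 + 4 * s) \<le> 2 * (k + 1) * B1"
    using B0 B1 k by (intro mult_left_mono; simp)+
  moreover have "0 \<le> k * (\<theta> * s)" "0 \<le> k * (\<theta> * s^2)" "0 \<le> \<theta> * s^2" "0 \<le> k * s"
      using k \<theta> s by simp_all
  moreover have "2 * (k + 1) * (5/2 * (s * Z) + 2 * (\<theta> * s) + 6 * (\<theta> * s^2) + 4 * s^2 + 2 * s)
      + 2 * (k + 1) * (3 * (\<theta> * s) + 12 * (\<theta> * s^2) + 10 * s^2 + 4 * s)
    = 5 * (k + 1) * s * Z + (1 + k) * (10 * \<theta> * s + 36 * \<theta> * s^2) + 28 * s^2 + 28 * (k * s^2) + 12 *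
        s + 12 * (k * s)"
    by (simp add: field_simps)
  moreover have "4 * k * s^2 + 2 * k * (1 + \<theta>/2) * s + 4 * k * (1 + \<theta>/2) * s^2 + 2 * s
      + 4 * (1 + \<theta>/2) * s^2
      + (8 * s + 2 * s + 8 * s^2 + 4 * k * s^2 + 4 * k * s)
    = 12 * s + 6 * (k * s) + k * (\<theta> * s) + 12 * s^2 + 12 * (k * s^2) + 2 * (k * (\<theta> * s^2)) + 2 *
        (\<theta> * s^2)"
    by (simp add: field_simps)
  moreover have "24 * s + 16 * k * s + 40 * (1 + k) * s^2 = 24 * s + 16 * (k * s) + 40 * s^2
      + 40 * (k * s^2)"
    by (simp add: field_simps)
  ultimately show ?thesis unfolding p0 p1 by linarith
qed

lemma P0_P1_continuous:
  fixes S :: real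
  assumes S: "S < a"
  shows "continuous_on {0..S} (\<lambda>s. P0 a \<theta> k s + P1 a \<theta> k s)"
proof -
  have "a^2 - s^2 \<noteq> 0" if "s \<in> {0..S}" for s
    using power_strict_mono[of s a 2] that S by auto
  then show ?thesis unfolding P0_def P1_def by (intro continuous_intros) auto
qed

text \<open>The first summand 4 / k^2 in the square already gives 2 k^2 K_bdry \<ge> 64 / k^2, all
  other summands being nonnegative. The right side of the assumption is at most a^2.\<close>

lemma speed_from_K_bdry:
  fixes a \<theta> k u0 :: real
  assumes a: "0 < a" and k: "0 < k" and \<theta>: "0 < \<theta>" and u0: "0 < u0" "u0 < a"
    and le: "2 * k^2 * K_bdry a \<theta> k u0 \<le> a^2 - (u0 + 2 / k)^2"
  shows "8 \<le> a * k"
proof -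
  define Y where "Y = 2 * u0 / k
      + \<theta> * ((u0^4 + 3 * a^2 * u0^2 + 2 / k * a^2 * u0) / (2 * (a^2 - u0^2)))
      + 5/2 * (\<theta> / k^2)
      + \<theta> / k * ((3 * a^2 * u0 - u0^3) / (a^2 - u0^2))"
  have "u0^2 < a^2" using u0 by (intro power_strict_mono) auto
  then have D: "0 \<le> a^2 - u0^2" by simp
  have "0 \<le> u0 * (2 * a^2 + (a^2 - u0^2))"
    using u0 D by (intro mult_nonneg_nonneg add_nonneg_nonneg) simp_all
  also have "\<dots> = 3 * a^2 * u0 - u0^3" by algebra
  finally have "0 \<le> 3 * a^2 * u0 - u0^3" .
  then have Y: "0 \<le> Y" unfolding Y_def using D u0 k \<theta> a
      by (intro add_nonneg_nonneg mult_nonneg_nonneg divide_nonneg_nonneg) simp_all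
  have "(4 / k^2)^2 \<le> (4 / k^2 + Y)^2" using Y by (intro power_mono) auto
  then have "2 * k^2 * (2 * (4 / k^2)^2) \<le> 2 * k^2 * (2 * (4 / k^2 + Y)^2)"
    by (intro mult_left_mono) auto
  also have "\<dots> = 2 * k^2 * K_bdry a \<theta> k u0" unfolding K_bdry_def Y_def by (simp add: add.assoc)
  also have "\<dots> \<le> a^2" using le zero_le_power2[of "u0 + 2/k"] by linarith
  also have "2 * k^2 * (2 * (4 / k^2)^2) = 64 / k^2" using k by (simp add: power2_eq_square)
  finally have "8^2 \<le> (a * k)^2" using k by (simp add: pos_divide_le_eq power_mult_distrib)
  then show ?thesis by (rule power2_le_imp_le) (use a k in simp)
qed

text \<open>For v \<le> a/2 the quotient (a^2 - v^2) / (a^2 + 3 v^2) is at least 3/7, and e \<ge>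
  5/2; hence v < 7 / (15 k). The factor 2 in the conclusion is for the perturbed speed, which is at
  most twice the stationary one.\<close>

lemma stationary_bound_from_SUP:
  fixes a k L :: real
  assumes a: "0 < a" and k: "0 < k" and ub: "\<And>x. x \<in> {0..L} \<Longrightarrow> 0 < ub x \<and> ub x \<le> a / 2"
    and sup: "(SUP x\<in>{0..L}. ub x * (a^2 - (ub x)^2) / (a^2 + 3 * (ub x)^2)) < 1 / (2 * exp 1 * k)"
    and x: "x \<in> {0..L}"
  shows "2 * k * ub x \<le> 1"
proof -
  define f where "f y = ub y * (a^2 - (ub y)^2) / (a^2 + 3 * (ub y)^2)" for y
  have den: "0 < a^2 + 3 * (ub y)^2" for y using a by (simp add: add_pos_nonneg)
  have "f y \<le> a" if y: "y \<in> {0..L}" for y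
  proof -
    have "ub y * (a^2 - (ub y)^2) \<le> a * (a^2 + 3 * (ub y)^2)"
    proof (rule mult_mono)
      have "(ub y)^2 \<le> a^2" using ub[OF y] a by (intro power_mono) auto
      then show "a^2 - (ub y)^2 \<le> a^2 + 3 * (ub y)^2" "0 \<le> a^2 - (ub y)^2" by simp_all
    qed (use ub[OF y] a in auto)
    then show ?thesis unfolding f_def using den[of y] by (simp add: pos_divide_le_eq)
  qed
  then have "bdd_above (f ` {0..L})" by (auto intro!: bdd_aboveI[of _ a])
  then have "f x \<le> (SUP x\<in>{0..L}. f x)" using x by (rule cSUP_upper[rotated])
  also have "\<dots> < 1 / (2 * exp 1 * k)" using sup unfolding f_def .
  also have "\<dots> \<le> 1 / (5 * k)"
    using exp1_ge k by (intro divide_left_mono mult_right_mono) (auto simp: mult_pos_pos)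
  finally have fx: "f x < 1 / (5 * k)" .
  have "(ub x)^2 \<le> (a/2)^2" using ub[OF x] by (intro power_mono) auto
  then have u2: "4 * (ub x)^2 \<le> a^2" by (simp add: power_divide)
  then have "ub x * (3 * (a^2 + 3 * (ub x)^2)) \<le> ub x * (7 * (a^2 - (ub x)^2))"
    using ub[OF x] by (intro mult_left_mono) auto
  moreover have "ub x * (3 * (a^2 + 3 * (ub x)^2)) = 7 * (3/7 * ub x * (a^2 + 3 * (ub x)^2))"
    "ub x * (7 * (a^2 - (ub x)^2)) = 7 * (ub x * (a^2 - (ub x)^2))" by simp_all
  ultimately have "3/7 * ub x * (a^2 + 3 * (ub x)^2) \<le> ub x * (a^2 - (ub x)^2)" by linarith
  then have "3/7 * ub x \<le> f x" unfolding f_def using den[of x] by (simp add: pos_le_divide_eq)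
  with fx have "3/7 * ub x < 1 / (5 * k)" by linarith
  then have "3/7 * ub x * (5 * k) < 1" using k by (simp add: pos_less_divide_eq)
  moreover have "3/7 * ub x * (5 * k) = 15/14 * (2 * k * ub x)" by simp
  ultimately show ?thesis by linarith
qed

text \<open>The upper bounds are read off at x = v = 0, where subtracting nonnegative terms leaves
  at most k a^2 and k. An infimum is below a value only if the set is bounded below: compactness
  gives this for \<open>K1\<close>, and positivity of \<open>K1\<close> makes the second quotient
  nonnegative.\<close>

lemma K1_bounds:
  fixes a k L \<epsilon>2 :: real
  assumes a: "0 < a" and k: "0 < k" and L: "0 < L" and ub: "continuous_on {0..L} ub" "0 < ub 0"
    and e: "eps2_const a L k ub \<epsilon>2"
  shows "0 < K1 a L k ub \<epsilon>2" "K1 a L k ub \<epsilon>2 \<le> k * a^2" "0 < K1tilde a L k ub \<epsilon>2"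
      "K1tilde a L k ub \<epsilon>2 \<le> k"
proof -
  have \<epsilon>2: "0 < \<epsilon>2" using e unfolding eps2_const_def by simp
  show pos: "0 < K1 a L k ub \<epsilon>2" "0 < K1tilde a L k ub \<epsilon>2"
    using e unfolding eps2_const_def by simp_all
  let ?S = "{0..L} \<times> {-\<epsilon>2..\<epsilon>2}"
  define f where "f z = k1 a L k ub (fst z) (snd z) - (h2 L (fst z))^2 / k" for z
  have f: "K1 a L k ub \<epsilon>2 = (INF z\<in>?S. f z)" unfolding K1_def f_def h1_def by (simp add: split_beta)
  have cu: "continuous_on ?S (\<lambda>z. ub (fst z))"
    by (rule continuous_on_compose2[OF ub(1)]) (auto intro!: continuous_intros)
  have ch: "continuous_on ?S (\<lambda>z. h2 L (fst z))"
    unfolding h2_def using L by (auto intro!: continuous_intros)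
  have "continuous_on ?S f"
    unfolding f_def k1_def h1_def by (intro continuous_intros cu ch) (use k in simp)
  then have "compact (f ` ?S)" by (intro compact_continuous_image compact_Times compact_Icc)
  then have bdd: "bdd_below (f ` ?S)" by (intro bounded_imp_bdd_below compact_imp_bounded)
  have lower: "K1 a L k ub \<epsilon>2 \<le> f z" if "z \<in> ?S" for z
    unfolding f by (rule cINF_lower[OF bdd that])
  have 0: "(0, 0) \<in> ?S" using L \<epsilon>2 by simp
  have "f (0, 0) \<le> k * a^2"
  proof -
    have "0 \<le> k * (ub 0)^2" "0 \<le> 1 / k" using k by simp_all
    then show ?thesis unfolding f_def k1_def h1_def h2_def using ub(2) by (simp add: algebra_simps)
  qed
  then show "K1 a L k ub \<epsilon>2 \<le> k * a^2" using lower[OF 0] by linarith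
  define g where "g z = (k * k1 a L k ub (fst z) (snd z)
      - (h2 L (fst z))^2) / k1 a L k ub (fst z) (snd z)" for z
  have g: "K1tilde a L k ub \<epsilon>2 = (INF z\<in>?S. g z)"
      unfolding K1tilde_def g_def h1_def by (simp add: split_beta)
  have k1: "0 < k1 a L k ub (fst z) (snd z)"
      and kf: "k * k1 a L k ub (fst z) (snd z) - (h2 L (fst z))^2 = k * f z"
    if z: "z \<in> ?S" for z
  proof -
    have "0 < f z" using pos(1) lower[OF z] by linarith
    moreover have "0 \<le> (h2 L (fst z))^2 / k" using k by simp
    ultimately show "0 < k1 a L k ub (fst z) (snd z)" unfolding f_def by linarith
    show "k * k1 a L k ub (fst z) (snd z) - (h2 L (fst z))^2 = k * f z"
        unfolding f_def using k by (simp add: field_simps)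
  qed
  have "0 \<le> g z" if z: "z \<in> ?S" for z
    unfolding g_def kf[OF z] using k1[OF z] k pos(1) lower[OF z] by simp
  then have "bdd_below (g ` ?S)" by (auto intro!: bdd_belowI)
  then have "K1tilde a L k ub \<epsilon>2 \<le> g (0, 0)" unfolding g by (rule cINF_lower[OF _ 0])
  also have "\<dots> \<le> k"
    unfolding g_def using k1[OF 0] by (simp add: pos_divide_le_eq)
  finally show "K1tilde a L k ub \<epsilon>2 \<le> k" .
qed

text \<open>The time of a maximum point over the whole rectangle is taken as t0. Being attained, the
  overall bound \<open>T_Li\<close> at t0 inherits the strict inequality with a that admissibility
  states for each time.\<close>

lemma T_Li_max:
  fixes L T :: real
  assumes T: "0 < T" and L: "0 < L"
    and cont: "cont_rect T L u" "cont_rect T L (dx L u)" "cont_rect T L (dt T u)"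
      "continuous_on {0..L} ub" "continuous_on {0..L} (deriv_in {0..L} ub)"
  obtains t0 where "t0 \<in> {0..T}" "\<And>t. t \<in> {0..T} \<Longrightarrow> 0 \<le> T_Li L ub T u t \<and> T_Li L ub T u t
      \<le> T_Li L ub T u t0"
    "\<And>t x. t \<in> {0..T} \<Longrightarrow> x \<in> {0..L} \<Longrightarrow> \<bar>u t x\<bar> \<le> T_Li L ub T u t0 \<and> \<bar>dx L u t x\<bar> \<le> T_Li L ub T u t0
      \<and> \<bar>dt T u t x\<bar> \<le> T_Li L ub T u t0 \<and> \<bar>ub x\<bar> \<le> T_Li L ub T u t0 \<and> \<bar>deriv_in {0..L} ub x\<bar> \<le> T_Li
          L ub T u t0"
proof -
  let ?S = "{0..T} \<times> {0..L}"
  define v where "v = deriv_in {0..L} ub"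
  define M where "M t x = max \<bar>u t x\<bar> (max \<bar>dx L u t x\<bar> (max \<bar>dt T u t x\<bar> (max \<bar>ub x\<bar> \<bar>v x\<bar>)))"
      for t x
  have M: "T_Li L ub T u t = (SUP x\<in>{0..L}. M t x)" for t
    unfolding T_Li_def M_def v_def by simp
  have c: "continuous_on ?S (\<lambda>z. f (snd z))" if "continuous_on {0..L} f" for f :: "real \<Rightarrow> real"
    by (rule continuous_on_compose2[OF that]) (auto intro!: continuous_intros)
  have "continuous_on ?S (\<lambda>z. M (fst z) (snd z))"
    unfolding M_def v_def by (intro continuous_intros cont(1-3) c cont(4,5))
  moreover have "?S \<noteq> {}" using T L by auto
  ultimately obtain z where z: "z \<in> ?S" "\<forall>y\<in>?S. M (fst y) (snd y) \<le> M (fst z) (snd z)"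
    using continuous_attains_sup[OF compact_Times[OF compact_Icc compact_Icc]] by blast
  define S where "S = M (fst z) (snd z)"
  have MS: "M t x \<le> S" if "t \<in> {0..T}" "x \<in> {0..L}" for t x
    using z(2)[rule_format, of "(t, x)"] that unfolding S_def by simp
  have up: "M t x \<le> T_Li L ub T u t" if "t \<in> {0..T}" "x \<in> {0..L}" for t x
    unfolding M by (rule cSUP_upper[OF that(2)]) (auto intro!: bdd_aboveI[of _ S] MS[OF that(1)])
  have le: "T_Li L ub T u t \<le> S" if "t \<in> {0..T}" for t
    unfolding M using L by (intro cSUP_least MS[OF that]) auto
  have z': "fst z \<in> {0..T}" "snd z \<in> {0..L}" using z(1) by auto
  have S: "T_Li L ub T u (fst z) = S" using le[OF z'(1)] up[OF z'] unfolding S_def by simp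
  show ?thesis
  proof (rule that[OF z'(1)])
    show "0 \<le> T_Li L ub T u t \<and> T_Li L ub T u t \<le> T_Li L ub T u (fst z)" if t: "t \<in> {0..T}" for t
    proof
      have "0 \<le> \<bar>u t 0\<bar>" by simp
      also have "\<dots> \<le> M t 0" unfolding M_def by (rule max.cobounded1)
      also have "\<dots> \<le> T_Li L ub T u t" using up[OF t, of 0] L by simp
      finally show "0 \<le> T_Li L ub T u t" .
    qed (use le[OF t] S in simp)
    show "\<bar>u t x\<bar> \<le> T_Li L ub T u (fst z) \<and> \<bar>dx L u t x\<bar> \<le> T_Li L ub T u (fst z)
      \<and> \<bar>dt T u t x\<bar> \<le> T_Li L ub T u (fst z) \<and> \<bar>ub x\<bar> \<le> T_Li L ub T u (fst z) \<and> \<bar>deriv_in {0..L} ub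
          x\<bar> \<le> T_Li L ub T u (fst z)"
      if "t \<in> {0..T}" "x \<in> {0..L}" for t x
      using MS[OF that] unfolding S M_def v_def by auto
  qed
qed

section \<open>The decay theorem\<close>

text \<open>The last term of \<open>Frhs\<close> is the stationary right-hand side multiplied by
  (a^2 - (v + p)^2) / (a^2 - v^2), hence equal to (a^2 - (v + p)^2) v'' by the stationary equation.
  The signs of v and v + p remove the absolute values.\<close>

lemma Frhs_eq_src:
  fixes a \<theta> L x p q r :: real
  assumes st: "stationary_subsonic a \<theta> L ub" and x: "x \<in> {0..L}" and ub: "0 < ub x"
      and p: "0 \<le> ub x + p"
  shows "Frhs a \<theta> L ub x p q r
    = src \<theta> (ub x) (deriv_in {0..L} ub x) (deriv_in {0..L} (deriv_in {0..L} ub) x) p q r"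
proof -
  define v where "v = ub x"
  define v' where "v' = deriv_in {0..L} ub x"
  define v'' where "v'' = deriv_in {0..L} (deriv_in {0..L} ub) x"
  have v: "0 < v" "0 \<le> v + p" using ub p unfolding v_def by auto
  have "\<bar>v\<bar> < a" and ode: "(a^2 - v^2) * v'' = 2 * v * v'^2 + 3/2 * \<theta> * v * \<bar>v\<bar> * v'"
    using st x unfolding stationary_subsonic_def v_def v'_def v''_def by blast+
  then have "v^2 < a^2" using v by (intro power_strict_mono) auto
  then have D: "a^2 - v^2 \<noteq> 0" by simp
  have "v * (2 * v'^2 + 3/2 * \<theta> * \<bar>v\<bar> * v') = (a^2 - v^2) * v''"
      unfolding ode by (simp add: algebra_simps)
  then have "(a^2 - (v + p)^2) / (a^2 - v^2) * v * (2 * v'^2 + 3/2 * \<theta> * \<bar>v\<bar> * v')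
      = (a^2 - (v + p)^2) * v''"
    using D by (simp add: mult.assoc)
  moreover have "(a^2 - (v + p)^2) * v'' = (a^2 - v^2) * v'' - p * (2 * v + p) * v''" by algebra
  ultimately have e: "(a^2 - (v + p)^2) / (a^2 - v^2) * v * (2 * v'^2 + 3/2 * \<theta> * \<bar>v\<bar> * v')
     = 2 * v * v'^2 + 3/2 * \<theta> * v * v * v' - p * (2 * v + p) * v''" using ode v by simp
  have ab: "\<bar>p + v\<bar> = v + p" using v by simp
  show ?thesis
    unfolding Frhs_def Ftilde_def v_def[symmetric] v'_def[symmetric] v''_def[symmetric] e ab src_def
        by algebra
qed

text \<open>The solution at time 0 and the initial data agree only on the interval, not as total
  functions; \<open>deriv_in\<close> depends only on the values there.\<close>

lemma H2H1_norm_cong: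
  assumes L: "0 < L" and f: "\<And>x. x \<in> {0..L} \<Longrightarrow> f x = f' x" and g: "\<And>x. x \<in> {0..L} \<Longrightarrow> g x = g' x"
  shows "H2H1_norm L f g = H2H1_norm L f' g'"
proof -
  have 1: "deriv_in {0..L} f x = deriv_in {0..L} f' x" if "x \<in> {0..L}" for x
    by (rule deriv_in_cong[OF f that])
  have 2: "deriv_in {0..L} g x = deriv_in {0..L} g' x" if "x \<in> {0..L}" for x
    by (rule deriv_in_cong[OF g that])
  have 3: "deriv_in {0..L} (deriv_in {0..L} f) x = deriv_in {0..L} (deriv_in {0..L} f') x"
      if "x \<in> {0..L}" for x
    by (rule deriv_in_cong[OF 1 that])
  show ?thesis unfolding H2H1_norm_def
    by (intro arg_cong[where f = sqrt] integral_cong) (simp only: 1 2 3 f g)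
qed

lemma H2H1_norm_nonneg: "0 \<le> H2H1_norm L f g"
proof -
  define h where "h x = (f x)^2 + (deriv_in {0..L} f x)^2
      + (deriv_in {0..L} (deriv_in {0..L} f) x)^2
      + (g x)^2 + (deriv_in {0..L} g x)^2" for x
  have "0 \<le> integral {0..L} h"
  proof (cases "h integrable_on {0..L}")
    case True
    then show ?thesis by (rule integral_nonneg) (simp add: h_def)
  \<comment> \<open>For a function that is not integrable the integral has the default value
    0.\<close>
  qed (simp add: not_integrable_integral)
  then show ?thesis unfolding H2H1_norm_def h_def by simp
qed

lemma C1C0_norm_le:
  assumes L: "0 < L" and b: "\<And>x. x \<in> {0..L} \<Longrightarrow> \<bar>f x\<bar> \<le> B \<and> \<bar>deriv_in {0..L} f x\<bar> \<le> B \<and> \<bar>g x\<bar> \<le> B"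
  shows "C1C0_norm L f g \<le> B"
proof -
  have "sup_norm {0..L} h \<le> B" if "\<And>x. x \<in> {0..L} \<Longrightarrow> \<bar>h x\<bar> \<le> B" for h
    unfolding sup_norm_def using L by (intro cSUP_least that) auto
  then show ?thesis unfolding C1C0_norm_def One_nat_def Ck_norm.simps using b by simp
qed

text \<open>In units of q = 1/(4 e L k) the rate is 2 q - \<kappa> and the available decay is 7/2 q
  - 5/2 X, where X is the loss divided by 5/2. Since X \<le> \<kappa> \<le> q, one has 5/2 X \<le>
  \<kappa> + 3/2 q, which is the claim. X \<le> \<kappa> rests on \<open>K1\<close> \<le> k a^2,
  \<open>K1tilde\<close> \<le> k and the sign of the \<open>C_E1\<close> term.\<close>

lemma decay_rate_bounds:
  fixes a \<theta> L k \<epsilon>2 T s Q :: real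
  assumes pos: "0 < a" "0 < \<theta>" "0 < L" "0 < k"
    and K1: "0 < K1 a L k ub \<epsilon>2" "K1 a L k ub \<epsilon>2 \<le> k * a^2" "0 < K1tilde a L k ub \<epsilon>2"
        "K1tilde a L k ub \<epsilon>2 \<le> k"
    and Q: "0 \<le> Q" "Q \<le> (SUP t\<in>{0..T}. P0 a \<theta> k (T_Li L ub T u t) + P1 a \<theta> k (T_Li L ub T u t))"
    and \<kappa>: "kappa a \<theta> L k ub \<epsilon>2 T u \<le> 1 / (4 * exp 1 * L * k)"
  shows "1 / (4 * exp 1 * L * k) \<le> decay_rate a \<theta> L k ub \<epsilon>2 T u"
    and "decay_rate a \<theta> L k ub \<epsilon>2 T u
      \<le> 7 / (8 * exp 1 * L * k) - 5 / 2 * (Q * ((1 + L^2) * (1 + a^2))) / (k * a^2)"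
proof -
  define S where "S = (SUP t\<in>{0..T}. P0 a \<theta> k (T_Li L ub T u t) + P1 a \<theta> k (T_Li L ub T u t))"
  define q where "q = 1 / (4 * exp 1 * L * k)"
  define X where "X = (Q * ((1 + L^2) * (1 + a^2))) / (k * a^2)"
  have q: "1 / (2 * exp 1 * L * k) = 2 * q" "7 / (8 * exp 1 * L * k) = 7/2 * q"
      unfolding q_def using pos by (simp_all add: field_simps)
  have "X = Q * (1 + L^2) * (1 / (k * a^2) + 1 / k)"
      unfolding X_def using pos by (simp add: field_simps)
  also have "\<dots> \<le> S * (1 + L^2) * (1 / K1 a L k ub \<epsilon>2 + 1 / K1tilde a L k ub \<epsilon>2)"
  proof (intro mult_mono add_mono)
    show "1 / (k * a^2) \<le> 1 / K1 a L k ub \<epsilon>2" using K1 by (intro divide_left_mono) (auto simp: pos)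
    show "1 / k \<le> 1 / K1tilde a L k ub \<epsilon>2" using K1 by (intro divide_left_mono) (auto simp: pos)
  qed (use Q pos S_def in auto)
  also have "\<dots> \<le> kappa a \<theta> L k ub \<epsilon>2 T u"
  proof -
    have "0 \<le> 2 * k^2 * C_E1 a \<theta> k (ub 0) * (L / K1 a L k ub \<epsilon>2)"
      unfolding C_E1_def using pos K1 by simp
    then show ?thesis unfolding kappa_def S_def by simp
  qed
  finally have X: "X \<le> kappa a \<theta> L k ub \<epsilon>2 T u" .
  show "1 / (4 * exp 1 * L * k) \<le> decay_rate a \<theta> L k ub \<epsilon>2 T u"
    using \<kappa> unfolding decay_rate_def q q_def[symmetric] by linarith
  have "5 / 2 * (Q * ((1 + L^2) * (1 + a^2))) / (k * a^2) = 5/2 * X" unfolding X_def by simp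
  then show "decay_rate a \<theta> L k ub \<epsilon>2 T u
      \<le> 7 / (8 * exp 1 * L * k) - 5 / 2 * (Q * ((1 + L^2) * (1 + a^2))) / (k * a^2)"
    using \<kappa> X unfolding decay_rate_def q q_def[symmetric] by linarith
qed

lemma admissible_decay:
  fixes a \<theta> L \<gamma> k \<epsilon>2 T e0 V :: real
  assumes pos: "0 < a" "0 < \<theta>" "0 < L" "0 < k" and \<gamma>: "\<gamma> \<le> 1/2"
    and st: "stationary_subsonic a \<theta> L ub"
    and bc: "deriv_in {0..L} ub 0 = \<theta> / 2 * (\<bar>ub 0\<bar> * (ub 0)^2 / (a^2 - (ub 0)^2))"
    and ub: "\<forall>x\<in>{0..L}. 0 < ub x \<and> ub x < \<gamma> * a"
    and Kb: "2 * k^2 * K_bdry a \<theta> k (ub 0) \<le> a^2 - (ub 0 + 2 / k)^2"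
    and sup: "(SUP x\<in>{0..L}. ub x * (a^2 - (ub x)^2) / (a^2 + 3 * (ub x)^2)) < 1 / (2 * exp 1 * k)"
    and e2: "eps2_const a L k ub \<epsilon>2"
    and V: "\<And>x. x \<in> {0..L} \<Longrightarrow> \<bar>deriv_in {0..L} (deriv_in {0..L} ub) x\<bar> \<le> V"
    and T: "0 < T" and adm: "admissible a \<theta> L k ub \<epsilon>2 T e0 \<phi> \<psi> u"
    and small: "\<And>t x. t \<in> {0..T} \<Longrightarrow> x \<in> {0..L} \<Longrightarrow> \<bar>u t x\<bar> \<le> \<bar>ub x\<bar>"
    and t: "t \<in> {0..T}"
  defines "\<mu> \<equiv> decay_rate a \<theta> L k ub \<epsilon>2 T u"
    and "K \<equiv> norm_energy_const a k \<theta> L V * energy_norm_const a k \<theta> V"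
  shows "1 / (4 * exp 1 * L * k) \<le> \<mu>"
    and "H2H1_norm L (u t) (dt T u t) \<le> sqrt K * H2H1_norm L \<phi> \<psi> * exp (- (\<mu> / 2) * t)"
    and "C1C0_norm L (u t) (dt T u t) \<le> sqrt ((1 / L
        + 1) * K) * H2H1_norm L \<phi> \<psi> * exp (- (\<mu> / 2) * t)"
proof -
  have sol: "is_solution a \<theta> L k ub T \<phi> \<psi> u" and Tl: "\<And>t. t \<in> {0..T} \<Longrightarrow> T_Li L ub T u t < a"
    and \<kappa>: "kappa a \<theta> L k ub \<epsilon>2 T u \<le> 1 / (4 * exp 1 * L * k)"
    using adm unfolding admissible_def by blast+
  have Ck: "Ck_rect 2 T L u" and pde: "\<And>t x. t \<in> {0..T} \<Longrightarrow> x \<in> {0..L} \<Longrightarrow>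
        dt T (dt T u) t x + 2 * (ub x + u t x) * dx L (dt T u) t x
        - (a^2 - (ub x + u t x)^2) * dx L (dx L u) t x
        = Frhs a \<theta> L ub x (u t x) (dx L u t x) (dt T u t x)"
    and ic: "\<And>x. x \<in> {0..L} \<Longrightarrow> u 0 x = \<phi> x" "\<And>x. x \<in> {0..L} \<Longrightarrow> dt T u 0 x = \<psi> x"
    and bcu: "\<And>t. t \<in> {0..T} \<Longrightarrow> dx L u t 0 = k * dt T u t 0" "\<And>t. t \<in> {0..T} \<Longrightarrow> u t L = 0"
    using sol unfolding is_solution_def by blast+
  note C = Ck_rect_2D[OF T pos(3) Ck]
  have Cu: "Ck_on 2 {0..L} ub" using st unfolding stationary_subsonic_def by blast
  note U = Ck_on_2D[OF Cu]
  have ub2: "0 < ub x \<and> ub x \<le> a / 2" if "x \<in> {0..L}" for x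
  proof -
    have "\<gamma> * a \<le> 1/2 * a" by (rule mult_right_mono[OF \<gamma>]) (use pos in simp)
    with bspec[OF ub that] show ?thesis by linarith
  qed
  have 0: "0 \<in> {0..L}" using pos by simp
  have ak: "8 \<le> a * k"
    by (rule speed_from_K_bdry[OF pos(1,4,2) _ _ Kb]) (use ub2[OF 0] pos in auto)
  have ubk: "2 * k * ub x \<le> 1" if "x \<in> {0..L}" for x
    by (rule stationary_bound_from_SUP[OF pos(1,4) ub2 sup that])
  obtain t0 where t0: "t0 \<in> {0..T}"
    and TL: "\<And>t. t \<in> {0..T} \<Longrightarrow> 0 \<le> T_Li L ub T u t \<and> T_Li L ub T u t \<le> T_Li L ub T u t0"
    and bounds: "\<And>t x. t \<in> {0..T} \<Longrightarrow> x \<in> {0..L} \<Longrightarrow> \<bar>u t x\<bar> \<le> T_Li L ub T u t0 \<and> \<bar>dx L u t x\<bar>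
        \<le> T_Li L ub T u t0
      \<and> \<bar>dt T u t x\<bar> \<le> T_Li L ub T u t0 \<and> \<bar>ub x\<bar> \<le> T_Li L ub T u t0 \<and> \<bar>deriv_in {0..L} ub x\<bar> \<le> T_Li
          L ub T u t0"
    using T_Li_max[OF T pos(3) C(1-3) U(1,2)] by metis
  \<comment> \<open>One number, the largest value of \<open>T_Li\<close>, serves as the bound for
    all times, so the supremum in \<open>kappa\<close> has to be compared with \<open>P0\<close> +
    \<open>P1\<close> at this value only.\<close>
  define s where "s = T_Li L ub T u t0"
  have sa: "s < a" unfolding s_def by (rule Tl[OF t0])
  have s0: "0 \<le> s" unfolding s_def using TL[OF t0] by simp
  define Z where "Z = \<theta>^2 * (a^2 * s^5 / (a^2 - s^2)^3)"
  have v'': "\<bar>deriv_in {0..L} (deriv_in {0..L} ub) x\<bar> \<le> 3/4 * Z" if x: "x \<in> {0..L}" for x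
    unfolding Z_def
  proof (rule stationary_second_derivative_bound[where v = "ub x" and v' = "deriv_in {0..L} ub x"])
    show "(a^2 - (ub x)^2) * deriv_in {0..L} ub x = \<theta> / 2 * (ub x)^3"
      by (rule stationary_first_integral[OF pos(3) st bc _ x]) (use ub in blast)
    show "(a^2 - (ub x)^2) * deriv_in {0..L} (deriv_in {0..L} ub) x =
      2 * ub x * (deriv_in {0..L} ub x)^2 + 3/2 * \<theta> * ub x * \<bar>ub x\<bar> * deriv_in {0..L} ub x"
      using st x unfolding stationary_subsonic_def by blast
    show "ub x \<le> s" using bounds[OF t0 x] unfolding s_def by auto
  qed (use ub2[OF x] sa pos in auto)
  have speed: "0 \<le> ub x + u t x \<and> k * (ub x + u t x) \<le> 1" if "t \<in> {0..T}" "x \<in> {0..L}" for t x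
  proof -
    have "\<bar>u t x\<bar> \<le> ub x" using small[OF that] ub2[OF that(2)] by simp
    then have "0 \<le> ub x + u t x" "ub x + u t x \<le> 2 * ub x" by auto
    moreover from this(2) have "k * (ub x + u t x) \<le> k * (2 * ub x)"
        using pos by (intro mult_left_mono) auto
    ultimately show ?thesis using ubk[OF that(2)] by simp
  qed
  interpret perturbed_wave a k \<theta> L T s Z ub "deriv_in {0..L} ub"
      "deriv_in {0..L} (deriv_in {0..L} ub)"
    u "dx L u" "dt T u" "dt T (dt T u)" "dx L (dt T u)" "dx L (dx L u)"
  proof
    show "dt T (dt T u) t x + 2 * (ub x + u t x) * dx L (dt T u) t x
        - (a^2 - (ub x + u t x)^2) * dx L (dx L u) t x
      = src \<theta> (ub x) (deriv_in {0..L} ub x) (deriv_in {0..L} (deriv_in {0..L} ub) x) (u t x)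
          (dx L u t x) (dt T u t x)"
      if "t \<in> {0..T}" "x \<in> {0..L}" for t x
      unfolding pde[OF that] using speed[OF that] ub2[OF that(2)]
          by (intro Frhs_eq_src[OF st that(2)]) auto
    show "\<bar>ub x\<bar> \<le> s \<and> \<bar>deriv_in {0..L} ub x\<bar> \<le> s \<and> \<bar>deriv_in {0..L} (deriv_in {0..L} ub) x\<bar>
        \<le> 3/4 * Z
      \<and> \<bar>u t x\<bar> \<le> s \<and> \<bar>dx L u t x\<bar> \<le> s \<and> \<bar>dt T u t x\<bar> \<le> s" if "t \<in> {0..T}" "x \<in> {0..L}" for t x
      using bounds[OF that] v''[OF that(2)] unfolding s_def by blast
  qed (fact pos ak T C U bcu speed | use pos sa in simp)+
  have "cQ \<le> P0 a \<theta> k s + P1 a \<theta> k s"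
    unfolding cQ_def by (rule P0_P1_lower[of \<theta> k s a, folded Z_def]) (use pos s0 sa in simp_all)
  also have "\<dots> \<le> (SUP t\<in>{0..T}. P0 a \<theta> k (T_Li L ub T u t) + P1 a \<theta> k (T_Li L ub T u t))"
    unfolding s_def
  proof (rule cSUP_upper[OF t0])
    \<comment> \<open>Boundedness of the set behind the supremum in \<open>kappa\<close>: the values
      of \<open>T_Li\<close> lie in the compact interval from 0 to s < a, where \<open>P0\<close> +
      \<open>P1\<close> is continuous.\<close>
    have "compact ((\<lambda>s. P0 a \<theta> k s + P1 a \<theta> k s) ` {0..s})"
      by (intro compact_continuous_image P0_P1_continuous sa compact_Icc)
    then have "bdd_above ((\<lambda>s. P0 a \<theta> k s + P1 a \<theta> k s) ` {0..s})"
        by (intro bounded_imp_bdd_above compact_imp_bounded)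
    then show "bdd_above ((\<lambda>t. P0 a \<theta> k (T_Li L ub T u t) + P1 a \<theta> k (T_Li L ub T u t)) ` {0..T})"
      by (rule bdd_above_mono) (use TL s_def in force)
  qed
  finally have cQ: "cQ \<le> (SUP t\<in>{0..T}. P0 a \<theta> k (T_Li L ub T u t) + P1 a \<theta> k (T_Li L ub T u t))" .
  have cQ0: "0 \<le> cQ" unfolding cQ_def using s0 Z0 pos by simp
  have K1: "0 < K1 a L k ub \<epsilon>2" "K1 a L k ub \<epsilon>2 \<le> k * a^2" "0 < K1tilde a L k ub \<epsilon>2"
      "K1tilde a L k ub \<epsilon>2 \<le> k"
    by (rule K1_bounds[OF pos(1,4,3) U(1) _ e2]; use ub2[OF 0] in simp)+
  note dr = decay_rate_bounds[OF pos K1 cQ0 cQ \<kappa>, folded \<mu>_def cR_def]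
  show \<mu>4: "1 / (4 * exp 1 * L * k) \<le> \<mu>" by (rule dr(1))
  have "0 < 1 / (4 * exp 1 * L * k)" using pos by simp
  then have \<mu>: "0 < \<mu>" using \<mu>4 by linarith
  define H where "H t = H2H1_norm L (u t) (dt T u t)" for t
  have d: "deriv_in {0..L} (f t) = dx L f t" for f t by (rule ext) (simp add: dx_def)
  have H: "H t = sqrt (norm2 t)" for t unfolding H_def H2H1_norm_def norm2_def d ..
  have H0: "H 0 = H2H1_norm L \<phi> \<psi>" unfolding H_def by (rule H2H1_norm_cong[OF pos(3) ic])
  have dec: "norm2 t \<le> K * exp (- \<mu> * t) * norm2 0"
      unfolding K_def by (rule norm2_decay[OF V t \<mu> dr(2)])
  have ex: "sqrt (exp (- \<mu> * t)) = exp (- (\<mu> / 2) * t)"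
    by (rule real_sqrt_unique) (simp_all add: power2_eq_square flip: exp_add)
  have "sqrt (norm2 t) \<le> sqrt (K * exp (- \<mu> * t) * norm2 0)" using dec by simp
  also have "\<dots> = sqrt K * H2H1_norm L \<phi> \<psi> * exp (- (\<mu> / 2) * t)"
    unfolding real_sqrt_mult ex H0[symmetric] H by simp
  finally show h: "H2H1_norm L (u t) (dt T u t) \<le> sqrt K * H2H1_norm L \<phi> \<psi> * exp (- (\<mu> / 2) * t)"
    using H unfolding H_def by simp
  have "C1C0_norm L (u t) (dt T u t) \<le> sqrt ((1 / L + 1) * norm2 t)"
  proof (rule C1C0_norm_le[OF pos(3)])
    fix x assume x: "x \<in> {0..L}"
    show "\<bar>u t x\<bar> \<le> sqrt ((1 / L + 1) * norm2 t) \<and> \<bar>deriv_in {0..L} (u t) x\<bar>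
        \<le> sqrt ((1 / L + 1) * norm2 t)
      \<and> \<bar>dt T u t x\<bar> \<le> sqrt ((1 / L + 1) * norm2 t)"
      using sup_le_norm2[OF t x] unfolding d by (simp add: real_le_rsqrt)
  qed
  also have "\<dots> = sqrt (1 / L + 1) * H2H1_norm L (u t) (dt T u t)"
      using H[of t] unfolding H_def real_sqrt_mult by simp
  also have "\<dots> \<le> sqrt (1 / L + 1) * (sqrt K * H2H1_norm L \<phi> \<psi> * exp (- (\<mu> / 2) * t))"
    by (rule mult_left_mono[OF h]) (use pos in simp)
  also have "\<dots> = sqrt ((1 / L + 1) * K) * H2H1_norm L \<phi> \<psi> * exp (- (\<mu> / 2) * t)"
      unfolding real_sqrt_mult by simp
  finally show "C1C0_norm L (u t) (dt T u t)
      \<le> sqrt ((1 / L + 1) * K) * H2H1_norm L \<phi> \<psi> * exp (- (\<mu> / 2) * t)" .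
qed

theorem corollary4p7:
  fixes a \<theta> L \<gamma> k \<epsilon>1 \<epsilon>2 :: real
    and ub :: "real \<Rightarrow> real"
    and \<epsilon>0 C :: "real \<Rightarrow> real"
  assumes "0 < a" and "0 < \<theta>" and "0 < L"
    and "0 < \<gamma>" and "\<gamma> \<le> 1/2"
    and "0 < k" and "1 / (a * k) < 1 - \<gamma>"
    and "stationary_subsonic a \<theta> L ub"
    and "deriv_in {0..L} ub 0 = \<theta> / 2 * (\<bar>ub 0\<bar> * (ub 0)^2 / (a^2 - (ub 0)^2))"
    and "\<forall>x\<in>{0..L}. 0 < ub x \<and> ub x < \<gamma> * a"
    and "2 * k^2 * K_bdry a \<theta> k (ub 0) \<le> a^2 - (ub 0 + 2 / k)^2"
    and "eps1_const a \<theta> k (2 * k^2) \<epsilon>1"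
    and "sup_norm {0..L} ub < \<epsilon>1"
    and "(SUP x\<in>{0..L}. ub x * (a^2 - (ub x)^2) / (a^2 + 3 * (ub x)^2)) < 1 / (2 * exp 1 * k)"
    and "eps2_const a L k ub \<epsilon>2"
    and "\<forall>T>0. eps0_const a \<theta> L k \<gamma> ub \<epsilon>1 \<epsilon>2 T (\<epsilon>0 T) (C T)"
  shows "\<exists>\<eta>1>0. \<exists>\<eta>2>0.
      (\<forall>T>0. \<forall>\<phi> \<psi> u. admissible a \<theta> L k ub \<epsilon>2 T (\<epsilon>0 T) \<phi> \<psi> u \<longrightarrow>
        (\<forall>t\<in>{0..T}.
          H2H1_norm L (u t) (dt T u t)
            \<le> \<eta>1 * H2H1_norm L \<phi> \<psi> * exp (- (decay_rate a \<theta> L k ub \<epsilon>2 T u / 2) * t) \<and>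
          C1C0_norm L (u t) (dt T u t)
            \<le> \<eta>2 * H2H1_norm L \<phi> \<psi> * exp (- (decay_rate a \<theta> L k ub \<epsilon>2 T u / 2) * t)))
    \<and> (\<exists>T0>0. \<forall>T\<ge>T0. \<forall>\<phi> \<psi> u. admissible a \<theta> L k ub \<epsilon>2 T (\<epsilon>0 T) \<phi> \<psi> u \<longrightarrow>
          H2H1_norm L (u T) (dt T u T) \<le> 1/2 * H2H1_norm L \<phi> \<psi> \<and>
          C1C0_norm L (u T) (dt T u T) \<le> 1/2 * H2H1_norm L \<phi> \<psi>)"
proof -
  \<comment> \<open>The only quantity besides a, k, \<theta> and L that enters
    \<open>\<eta>1\<close> and \<open>\<eta>2\<close>; it belongs to the stationary state and is
    therefore independent of T and of the data.\<close>
  define V where "V = (SUP x\<in>{0..L}. \<bar>deriv_in {0..L} (deriv_in {0..L} ub) x\<bar>)"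
  have "Ck_on 2 {0..L} ub" using assms(8) unfolding stationary_subsonic_def by blast
  then have "continuous_on {0..L} (\<lambda>x. \<bar>deriv_in {0..L} (deriv_in {0..L} ub) x\<bar>)"
    by (intro continuous_intros Ck_on_2D(3))
  then have "bdd_above ((\<lambda>x. \<bar>deriv_in {0..L} (deriv_in {0..L} ub) x\<bar>) ` {0..L})"
    by (intro bounded_imp_bdd_above compact_imp_bounded compact_continuous_image compact_Icc)
  then have V: "\<bar>deriv_in {0..L} (deriv_in {0..L} ub) x\<bar> \<le> V" if "x \<in> {0..L}" for x
    unfolding V_def using that by (rule cSUP_upper[rotated])
  have V0: "0 \<le> V" using order_trans[OF abs_ge_zero V[of 0]] assms(3) by simp
  define c where "c = norm_energy_const a k \<theta> L V * energy_norm_const a k \<theta> V"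
  define r where "r = 1 / (4 * exp 1 * L * k)"
  define \<eta>1 where "\<eta>1 = sqrt c"
  define \<eta>2 where "\<eta>2 = sqrt ((1 / L + 1) * c)"
  have r: "0 < r" unfolding r_def using assms(3,6) by simp
  have "0 < c"
  proof -
    have "0 < norm_energy_const a k \<theta> L V"
      unfolding norm_energy_const_def using assms(1,6)
      by (intro divide_pos_pos mult_pos_pos add_pos_nonneg) simp_all
    moreover have "0 < energy_norm_const a k \<theta> V"
      unfolding energy_norm_const_def using assms(1,6)
      by (intro mult_pos_pos add_pos_nonneg) simp_all
    ultimately show ?thesis unfolding c_def by simp
  qed
  then have \<eta>: "0 < \<eta>1" "0 < \<eta>2" unfolding \<eta>1_def \<eta>2_def using assms(3)
      by (simp_all add: add_pos_nonneg)
  \<comment> \<open>The pointwise bounds in \<open>eps0_const\<close> hold for the solution whose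
    existence is asserted there; uniqueness carries them over to the solution u in
    \<open>admissible\<close>.\<close>
  have small: "\<bar>u t x\<bar> \<le> \<bar>ub x\<bar>"
    if tx: "0 < T" "admissible a \<theta> L k ub \<epsilon>2 T (\<epsilon>0 T) \<phi> \<psi> u" "t \<in> {0..T}" "x \<in> {0..L}"
        for T \<phi> \<psi> u t x
  proof -
    have "eps0_const a \<theta> L k \<gamma> ub \<epsilon>1 \<epsilon>2 T (\<epsilon>0 T) (C T)" using assms(16) tx(1) by blast
    note e = spec[OF spec[OF this[unfolded eps0_const_def, THEN conjunct2, THEN conjunct2], of \<phi>],
        of \<psi>]
    have "Ck_on 2 {0..L} \<phi> \<and> Ck_on 1 {0..L} \<psi> \<and> C2_compatible a \<theta> L k ub \<phi> \<psi> \<and> C2C1_norm L \<phi> \<psi>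
        \<le> \<epsilon>0 T"
      using tx(2) unfolding admissible_def by blast
    from mp[OF e this] obtain w where w: "\<forall>v. is_solution a \<theta> L k ub T \<phi> \<psi> v
        \<longrightarrow> (\<forall>t\<in>{0..T}. \<forall>x\<in>{0..L}. v t x = w t x)"
      "\<forall>t\<in>{0..T}. \<forall>x\<in>{0..L}. \<bar>w t x\<bar> \<le> Min {\<gamma> * a - \<bar>ub x\<bar>, \<bar>ub x\<bar>, 1 / k} \<and> \<bar>dx L w t x\<bar>
          \<le> min 1 (1 / k)"
      by (elim exE conjE) (rule that)
    have "u t x = w t x" using w(1) tx unfolding admissible_def by blast
    moreover have "\<bar>w t x\<bar> \<le> \<bar>ub x\<bar>" using w(2)[rule_format, OF tx(3,4)] by simp
    ultimately show ?thesis by simp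
  qed
  have decay: "r \<le> decay_rate a \<theta> L k ub \<epsilon>2 T u \<and>
      H2H1_norm L (u t) (dt T u t) \<le> \<eta>1 * H2H1_norm L \<phi> \<psi> * exp
          (- (decay_rate a \<theta> L k ub \<epsilon>2 T u / 2) * t) \<and>
      C1C0_norm L (u t) (dt T u t) \<le> \<eta>2 * H2H1_norm L \<phi> \<psi> * exp
          (- (decay_rate a \<theta> L k ub \<epsilon>2 T u / 2) * t)"
    if "0 < T" "admissible a \<theta> L k ub \<epsilon>2 T (\<epsilon>0 T) \<phi> \<psi> u" "t \<in> {0..T}" for T \<phi> \<psi> u t
    unfolding r_def \<eta>1_def \<eta>2_def c_def
    using admissible_decay[OF assms(1,2,3,6,5,8,9,10,11,14,15) V that(1,2) small[OF that(1,2)]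
        that(3)] by blast
  \<comment> \<open>Chosen so that T \<ge> T1 gives 2 max(\<eta>1, \<eta>2) \<le> r T / 2, which is
    less than 1 + r T / 2 \<le> exp (r T / 2). Here r bounds every decay rate from below
    independently of T.\<close>
  define T1 where "T1 = 4 * max \<eta>1 \<eta>2 / r"
  have T1: "max \<eta>1 \<eta>2 * exp (- (r / 2) * T) < 1 / 2" if "T1 \<le> T" for T
  proof -
    have "4 * max \<eta>1 \<eta>2 \<le> T * r" using that r unfolding T1_def by (simp only: pos_divide_le_eq)
    then have "2 * max \<eta>1 \<eta>2 < 1 + r / 2 * T" by (simp add: mult.commute)
    also have "\<dots> \<le> exp (r / 2 * T)" by (rule exp_ge_add_one_self)
    finally have "2 * max \<eta>1 \<eta>2 * exp (- (r / 2 * T)) < exp (r / 2 * T) * exp (- (r / 2 * T))"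
      by (rule mult_strict_right_mono) simp
    also have "exp (r / 2 * T) * exp (- (r / 2 * T)) = 1" by (simp flip: exp_add)
    finally show ?thesis by simp
  qed
  have final: "H2H1_norm L (u T) (dt T u T) \<le> 1/2 * H2H1_norm L \<phi> \<psi> \<and> C1C0_norm L (u T) (dt T u T)
      \<le> 1/2 * H2H1_norm L \<phi> \<psi>"
    if T: "max T1 1 \<le> T" and adm: "admissible a \<theta> L k ub \<epsilon>2 T (\<epsilon>0 T) \<phi> \<psi> u" for T \<phi> \<psi> u
  proof -
    define \<mu> where "\<mu> = decay_rate a \<theta> L k ub \<epsilon>2 T u"
    have T0: "0 < T" "T \<in> {0..T}" "T1 \<le> T" using T by auto
    note d = decay[OF T0(1) adm T0(2), folded \<mu>_def]
    have "r / 2 * T \<le> \<mu> / 2 * T" using d T0 by (intro mult_right_mono) auto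
    then have ex: "exp (- (\<mu> / 2) * T) \<le> exp (- (r / 2) * T)" by simp
    have half: "\<eta> * exp (- (\<mu> / 2) * T) \<le> 1 / 2" if "\<eta> \<le> max \<eta>1 \<eta>2" for \<eta>
    proof -
      have "\<eta> * exp (- (\<mu> / 2) * T) \<le> max \<eta>1 \<eta>2 * exp (- (r / 2) * T)"
        using that ex \<eta> by (intro mult_mono) auto
      then show ?thesis using T1[OF T0(3)] by linarith
    qed
    have H: "0 \<le> H2H1_norm L \<phi> \<psi>" by (rule H2H1_norm_nonneg)
    have "\<eta> * H2H1_norm L \<phi> \<psi> * exp (- (\<mu> / 2) * T) \<le> 1/2 * H2H1_norm L \<phi> \<psi>" if "\<eta> \<le> max \<eta>1 \<eta>2"
        for \<eta>
      using mult_right_mono[OF half[OF that] H] by (simp add: mult_ac)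
    from this[of \<eta>1] this[of \<eta>2] show ?thesis
        using d by (meson max.cobounded1 max.cobounded2 order_trans)
  qed
  show ?thesis
  proof (rule exI[of _ \<eta>1], rule conjI[OF \<eta>(1)], rule exI[of _ \<eta>2], rule conjI[OF \<eta>(2)], rule conjI)
    show "\<exists>T0>0. \<forall>T\<ge>T0. \<forall>\<phi> \<psi> u. admissible a \<theta> L k ub \<epsilon>2 T (\<epsilon>0 T) \<phi> \<psi> u \<longrightarrow>
          H2H1_norm L (u T) (dt T u T) \<le> 1/2 * H2H1_norm L \<phi> \<psi> \<and>
          C1C0_norm L (u T) (dt T u T) \<le> 1/2 * H2H1_norm L \<phi> \<psi>"
      by (rule exI[of _ "max T1 1"]) (use final in auto)
  qed (use decay in blast)
qed

end
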